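(* Let $\Omega_1\subset\mathbb{R}^{N_1}$ and $\Omega_2\subset\mathbb{R}^{N_2}$ be regions satisfying (B1) and (B2), let $\Omega_p:=\Omega_1\times\Omega_2$, and let $b$ satisfy (B4) on $\partial\Omega_p$ with associated functions $b_1$ on $\partial\Omega_1$ and $b_2$ on $\partial\Omega_2$. Let $\{\lambda_{1j}\}_{j\in\mathbb{N}}$, $\{g_{1j}\}_{j\in\mathbb{N}}$ be the Robin Laplacian eigenvalues and eigenfunctions on $\Omega_1$ with weight $b_1$, let $\{\delta_{2k}\}_{k\in\mathbb{N}_0}$, $\{s_{2k}\}_{k\in\mathbb{N}_0}$ be the harmonic Steklov eigenvalues and eigenfunctions on $\Omega_2$ with weight $b_2$, and put $u_{jk}:=g_{1j}\otimes s_{2k}$ for $j\in\mathbb{N}$, $k\in\mathbb{N}_0$. Then each $u_{jk}$ is a Robin–Steklov Laplacian (RSL) eigenfunction on $\Omega_p$ corresponding to the eigenpair $(\lambda_{1j},\delta_{2k})$.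
   Context: A region is a nonempty, connected, open subset of $\mathbb{R}^N$; $\mathbb{N}_0:=\mathbb{N}\cup\{0\}$. All function spaces are real; $\sigma$ denotes $(N-1)$-dimensional Hausdorff measure on a boundary ($\sigma_i$ the one on $\partial\Omega_i$), and in boundary integrals functions are replaced by their traces. Condition (B1) on a region $\Omega\subset\mathbb{R}^N$: $\Omega$ is bounded and its boundary $\partial\Omega:=\overline{\Omega}\setminus\Omega$ is the union of a finite number of disjoint closed Lipschitz surfaces, each having finite surface area. Condition (B2): $\Omega$ satisfies (B1); the imbedding of $H^1(\Omega)$ into $L^p(\Omega)$ is compact for $1\le p<p_s$, where $p_s=2N/(N-2)$ if $N\ge3$ and $p_s=\infty$ if $N=2$ (Rellich theorem); and the trace map $\gamma:H^1(\Omega)\to L^2(\partial\Omega,d\sigma)$ is compact ($L^2$-compact trace theorem). Condition (B3) on $b:\partial\Omega\to(0,\infty)$: $b$ is Borel measurable, $b\in L^\infty(\partial\Omega,d\sigma)$ and $b\ge b_0>0$ $\sigma$-a.e. for some constant $b_0$. Condition (B4): $b:\partial\Omega_p\to[0,\infty]$ is such that, for $x\in\partial\Omega_1$, $b(x,y)=b_1(x)$ for a.e. $y\in\Omega_2$, and, for $y\in\partial\Omega_2$, $b(x,y)=b_2(y)$ for a.e. $x\in\Omega_1$, with $b_1,b_2$ satisfying (B3) on $\partial\Omega_1,\partial\Omega_2$ respectively. For functions $f$ on $\Omega_1$ and $g$ on $\Omega_2$, $(f\otimes g)(x,y):=f(x)g(y)$. Robin eigendata on $\Omega_1$ with weight $b_1$: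 with $[u,v]_{b_1}:=\int_{\Omega_1}\nabla u\cdot\nabla v\,dx+\int_{\partial\Omega_1}b_1uv\,d\sigma_1$, pairs $(\lambda_{1j},g_{1j})$ with $g_{1j}\in H^1(\Omega_1)$, $[g_{1j},h]_{b_1}=\lambda_{1j}\int_{\Omega_1}g_{1j}h\,dx$ for all $h\in H^1(\Omega_1)$; the $\lambda_{1j}>0$ are all the eigenvalues repeated according to multiplicity, increasing to $\infty$, and $\{g_{1j}\}$ is a maximal $[\cdot,\cdot]_{b_1}$-orthonormal set in $H^1(\Omega_1)$. Harmonic Steklov eigendata on $\Omega_2$ with weight $b_2$: pairs $(\delta_{2k},s_{2k})$ with $0\ne s_{2k}\in H^1(\Omega_2)$ and $\int_{\Omega_2}\nabla s_{2k}\cdot\nabla h\,dy=\delta_{2k}\int_{\partial\Omega_2}b_2\,s_{2k}\,h\,d\sigma_2$ for all $h\in H^1(\Omega_2)$, where $\delta_{20}=0$, $s_{20}\equiv1$, and $\{\delta_{2k}\}_{k\ge1}$ is the increasing sequence of strictly positive Steklov eigenvalues with eigenfunctions $s_{2k}$, $k\ge1$, orthonormal for $[u,v]_{b_2}:=\int_{\Omega_2}\nabla u\cdot\nabla v\,dy+\int_{\partial\Omega_2}b_2uv\,d\sigma_2$; $\{s_{2k}\}_{k\ge0}$ is a maximal orthogonal set in the $[\cdot,\cdot]_{b_2}$-orthogonal complement of $H_0^1(\Omega_2)$ in $H^1(\Omega_2)$. RSL eigenproblem on $\Omega_p$: find $(\lambda,\delta,u)\in\mathbb{R}^2\times H^1(\Omega_p)$,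 $u\ne0$, with $$\int_{\Omega_p}\nabla u\cdot\nabla h\,dx\,dy+\int_{\Omega_2}\int_{\partial\Omega_1}b_1\,u\,h\,d\sigma_1\,dy=\lambda\int_{\Omega_p}u\,h\,dx\,dy+\delta\int_{\Omega_1}\int_{\partial\Omega_2}b_2\,u\,h\,d\sigma_2\,dx$$ for all $h\in H^1(\Omega_p)$; $u$ is then called an RSL eigenfunction corresponding to the eigenpair $(\lambda,\delta)$. *)

theory Defs
  imports "HOL-Analysis.Analysis"
begin

section \<open>Regions and Lebesgue spaces\<close>

definition region :: "'a::euclidean_space set \<Rightarrow> bool" where
  "region \<Omega> \<longleftrightarrow> \<Omega> \<noteq> {} \<and> connected \<Omega> \<and> open \<Omega>"

text \<open>Elements of function spaces are represented by Borel measurable functions (every Lebesgue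
  class contains one); equality in the function spaces is equality almost everywhere, and the values
  of a representative outside the space of the measure are irrelevant.\<close>

definition vol :: "'a::euclidean_space set \<Rightarrow> 'a measure" where
  "vol \<Omega> = restrict_space lborel \<Omega>"

definition Lp :: "'a measure \<Rightarrow> real \<Rightarrow> ('a \<Rightarrow> 'c::euclidean_space) set" where
  "Lp M p = {f. f \<in> borel_measurable M \<and> integrable M (\<lambda>x. norm (f x) powr p)}"

definition Lp_tendsto ::
  "'a measure \<Rightarrow> real \<Rightarrow> (nat \<Rightarrow> 'a \<Rightarrow> 'c::euclidean_space) \<Rightarrow> ('a \<Rightarrow> 'c) \<Rightarrow> bool" where
  "Lp_tendsto M p f g \<longleftrightarrow> (\<lambda>n. LINT x|M. norm (f n x - g x) powr p) \<longlonglongrightarrow> 0"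


section \<open>Sobolev spaces\<close>

fun Ck :: "nat \<Rightarrow> ('a::euclidean_space \<Rightarrow> real) \<Rightarrow> bool" where
  "Ck 0 f \<longleftrightarrow> continuous_on UNIV f"
| "Ck (Suc k) f \<longleftrightarrow>
     (\<forall>x. f differentiable at x) \<and> (\<forall>i\<in>Basis. Ck k (\<lambda>x. frechet_derivative f (at x) i))"

definition test_functions :: "'a::euclidean_space set \<Rightarrow> ('a \<Rightarrow> real) set" where
  "test_functions \<Omega> =
     {\<phi>. (\<forall>k. Ck k \<phi>) \<and> compact (closure {x. \<phi> x \<noteq> 0}) \<and> closure {x. \<phi> x \<noteq> 0} \<subseteq> \<Omega>}"

definition is_weak_gradient ::
  "'a::euclidean_space set \<Rightarrow> ('a \<Rightarrow> real) \<Rightarrow> ('a \<Rightarrow> 'a) \<Rightarrow> bool" where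
  "is_weak_gradient \<Omega> u G \<longleftrightarrow>
     (\<forall>\<phi>\<in>test_functions \<Omega>. \<forall>i\<in>Basis.
        (LINT x|vol \<Omega>. u x * frechet_derivative \<phi> (at x) i) = - (LINT x|vol \<Omega>. (G x \<bullet> i) * \<phi> x))"

definition H1 :: "'a::euclidean_space set \<Rightarrow> ('a \<Rightarrow> real) set" where
  "H1 \<Omega> = {u \<in> Lp (vol \<Omega>) 2. \<exists>G\<in>Lp (vol \<Omega>) 2. is_weak_gradient \<Omega> u G}"

text \<open>A weak gradient is determined almost everywhere; one representative is chosen.\<close>

definition wgrad :: "'a::euclidean_space set \<Rightarrow> ('a \<Rightarrow> real) \<Rightarrow> 'a \<Rightarrow> 'a" where
  "wgrad \<Omega> u = (SOME G. G \<in> Lp (vol \<Omega>) 2 \<and> is_weak_gradient \<Omega> u G)"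

definition H1_norm :: "'a::euclidean_space set \<Rightarrow> ('a \<Rightarrow> real) \<Rightarrow> real" where
  "H1_norm \<Omega> u =
     sqrt ((LINT x|vol \<Omega>. (u x)\<^sup>2) + (LINT x|vol \<Omega>. wgrad \<Omega> u x \<bullet> wgrad \<Omega> u x))"

definition H1_tendsto ::
  "'a::euclidean_space set \<Rightarrow> (nat \<Rightarrow> 'a \<Rightarrow> real) \<Rightarrow> ('a \<Rightarrow> real) \<Rightarrow> bool" where
  "H1_tendsto \<Omega> f u \<longleftrightarrow> (\<lambda>n. H1_norm \<Omega> (\<lambda>x. f n x - u x)) \<longlonglongrightarrow> 0"

definition H10 :: "'a::euclidean_space set \<Rightarrow> ('a \<Rightarrow> real) set" where
  "H10 \<Omega> = {u \<in> H1 \<Omega>. \<exists>\<phi>. (\<forall>n. \<phi> n \<in> test_functions \<Omega>) \<and> H1_tendsto \<Omega> \<phi> u}"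

definition nonzero_on :: "'a::euclidean_space set \<Rightarrow> ('a \<Rightarrow> real) \<Rightarrow> bool" where
  "nonzero_on \<Omega> u \<longleftrightarrow> \<not> (AE x in vol \<Omega>. u x = 0)"


section \<open>Hausdorff measure and Lipschitz surfaces\<close>

text \<open>The \<open>n\<close>-dimensional Hausdorff outer measure, normalised to agree with Lebesgue measure on
  \<open>n\<close>-dimensional space. Empty members of a cover get weight 0 explicitly because \<open>0 ^ 0 = 1\<close>.
  Covers are by bounded sets because \<^const>\<open>diameter\<close> is meaningful only for those.\<close>

definition hausdorff_weight :: "nat \<Rightarrow> 'a::euclidean_space set \<Rightarrow> ennreal" where
  "hausdorff_weight n U =
     (if U = {} then 0 else ennreal (unit_ball_vol (real n) * (diameter U / 2) ^ n))"

definition hausdorff_pre :: "nat \<Rightarrow> real \<Rightarrow> 'a::euclidean_space set \<Rightarrow> ennreal" where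
  "hausdorff_pre n d A =
     (INF U \<in> {U :: nat \<Rightarrow> 'a set. (\<forall>i. bounded (U i) \<and> diameter (U i) \<le> d) \<and> A \<subseteq> (\<Union>i. U i)}.
        (\<Sum>i. hausdorff_weight n (U i)))"

definition hausdorff_outer :: "nat \<Rightarrow> 'a::euclidean_space set \<Rightarrow> ennreal" where
  "hausdorff_outer n A = (SUP d \<in> {0<..}. hausdorff_pre n d A)"

text \<open>The Hausdorff outer measure is a metric outer measure, hence countably additive on Borel
  sets by Caratheodory's criterion.\<close>

definition hausdorff_measure :: "nat \<Rightarrow> 'a::euclidean_space measure" where
  "hausdorff_measure n = measure_of UNIV (sets borel) (hausdorff_outer n)"

definition bdry :: "'a::euclidean_space set \<Rightarrow> 'a set" where
  "bdry \<Omega> = closure \<Omega> - \<Omega>"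

definition surf :: "'a::euclidean_space set \<Rightarrow> 'a measure" where
  "surf \<Omega> = restrict_space (hausdorff_measure (DIM('a) - 1)) (bdry \<Omega>)"

text \<open>Near each of its points a Lipschitz surface is the graph, over the hyperplane orthogonal to
  some unit vector \<open>\<nu>\<close>, of a Lipschitz function \<open>\<psi>\<close>.\<close>

definition closed_lipschitz_surface :: "'a::euclidean_space set \<Rightarrow> bool" where
  "closed_lipschitz_surface S \<longleftrightarrow> S \<noteq> {} \<and> compact S \<and> connected S \<and>
     (\<forall>z\<in>S. \<exists>U \<nu> (\<psi> :: 'a \<Rightarrow> real) L. open U \<and> z \<in> U \<and> norm \<nu> = 1 \<and>
        L-lipschitz_on {x. x \<bullet> \<nu> = 0} \<psi> \<and>
        S \<inter> U = {x \<in> U. x \<bullet> \<nu> = \<psi> (x - (x \<bullet> \<nu>) *\<^sub>R \<nu>)})"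

definition cond_B1 :: "'a::euclidean_space set \<Rightarrow> bool" where
  "cond_B1 \<Omega> \<longleftrightarrow> bounded \<Omega> \<and>
     (\<exists>\<S>. finite \<S> \<and> disjoint \<S> \<and> \<Union>\<S> = bdry \<Omega> \<and>
        (\<forall>S\<in>\<S>. closed_lipschitz_surface S \<and>
           emeasure (hausdorff_measure (DIM('a) - 1)) S < \<infinity>))"


section \<open>Traces\<close>

text \<open>The trace map is the continuous extension to \<open>H1 \<Omega>\<close> of the restriction of functions that are
  Lipschitz continuous on the closure. The measure \<open>M\<close> is the surface measure on the boundary, or
  on the part of it on which the trace is taken.\<close>

definition has_trace ::
  "'a::euclidean_space set \<Rightarrow> 'a measure \<Rightarrow> ('a \<Rightarrow> real) \<Rightarrow> ('a \<Rightarrow> real) \<Rightarrow> bool" where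
  "has_trace \<Omega> M u t \<longleftrightarrow> t \<in> Lp M 2 \<and>
     (\<exists>\<phi> :: nat \<Rightarrow> 'a \<Rightarrow> real.
        (\<forall>n. \<phi> n \<in> H1 \<Omega> \<and> (\<exists>L. L-lipschitz_on (closure \<Omega>) (\<phi> n))) \<and>
        H1_tendsto \<Omega> \<phi> u \<and> Lp_tendsto M 2 \<phi> t)"

definition bdry_trace ::
  "'a::euclidean_space set \<Rightarrow> 'a measure \<Rightarrow> ('a \<Rightarrow> real) \<Rightarrow> 'a \<Rightarrow> real" where
  "bdry_trace \<Omega> M u = (SOME t. has_trace \<Omega> M u t)"

definition compact_H1_map ::
  "'a::euclidean_space set \<Rightarrow> 'a measure \<Rightarrow> real \<Rightarrow> (('a \<Rightarrow> real) \<Rightarrow> 'a \<Rightarrow> real) \<Rightarrow> bool" where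
  "compact_H1_map \<Omega> M p T \<longleftrightarrow>
     (\<forall>u\<in>H1 \<Omega>. T u \<in> Lp M p) \<and>
     (\<forall>u :: nat \<Rightarrow> 'a \<Rightarrow> real.
        (\<forall>n. u n \<in> H1 \<Omega>) \<and> bounded (range (\<lambda>n. H1_norm \<Omega> (u n))) \<longrightarrow>
        (\<exists>r v. strict_mono (r :: nat \<Rightarrow> nat) \<and> v \<in> Lp M p \<and> Lp_tendsto M p (\<lambda>n. T (u (r n))) v))"

definition cond_B2 :: "'a::euclidean_space set \<Rightarrow> bool" where
  "cond_B2 \<Omega> \<longleftrightarrow> cond_B1 \<Omega> \<and> DIM('a) \<ge> 2 \<and>
     (\<forall>p::real. 1 \<le> p \<and> (DIM('a) \<ge> 3 \<longrightarrow> p < 2 * real DIM('a) / (real DIM('a) - 2)) \<longrightarrow>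
        compact_H1_map \<Omega> (vol \<Omega>) p (\<lambda>u. u)) \<and>
     (\<forall>u\<in>H1 \<Omega>. \<exists>t. has_trace \<Omega> (surf \<Omega>) u t \<and>
        (\<forall>t'. has_trace \<Omega> (surf \<Omega>) u t' \<longrightarrow> (AE x in surf \<Omega>. t' x = t x))) \<and>
     compact_H1_map \<Omega> (surf \<Omega>) 2 (bdry_trace \<Omega> (surf \<Omega>))"


section \<open>Boundary weights\<close>

definition cond_B3 :: "'a::euclidean_space set \<Rightarrow> ('a \<Rightarrow> real) \<Rightarrow> bool" where
  "cond_B3 \<Omega> b \<longleftrightarrow> (\<forall>x\<in>bdry \<Omega>. b x > 0) \<and> b \<in> borel_measurable (surf \<Omega>) \<and>
     (\<exists>C. AE x in surf \<Omega>. b x \<le> C) \<and> (\<exists>b0>0. AE x in surf \<Omega>. b0 \<le> b x)"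

definition cond_B4 ::
  "'a::euclidean_space set \<Rightarrow> 'b::euclidean_space set \<Rightarrow> ('a \<times> 'b \<Rightarrow> ennreal) \<Rightarrow>
    ('a \<Rightarrow> real) \<Rightarrow> ('b \<Rightarrow> real) \<Rightarrow> bool" where
  "cond_B4 \<Omega>1 \<Omega>2 b b1 b2 \<longleftrightarrow>
     (\<forall>x\<in>bdry \<Omega>1. AE y in vol \<Omega>2. b (x, y) = ennreal (b1 x)) \<and>
     (\<forall>y\<in>bdry \<Omega>2. AE x in vol \<Omega>1. b (x, y) = ennreal (b2 y)) \<and>
     cond_B3 \<Omega>1 b1 \<and> cond_B3 \<Omega>2 b2"


section \<open>Robin and Steklov eigendata\<close>

abbreviation tr :: "'a::euclidean_space set \<Rightarrow> ('a \<Rightarrow> real) \<Rightarrow> 'a \<Rightarrow> real" where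
  "tr \<Omega> \<equiv> bdry_trace \<Omega> (surf \<Omega>)"

definition grad_form :: "'a::euclidean_space set \<Rightarrow> ('a \<Rightarrow> real) \<Rightarrow> ('a \<Rightarrow> real) \<Rightarrow> real" where
  "grad_form \<Omega> u v = (LINT x|vol \<Omega>. wgrad \<Omega> u x \<bullet> wgrad \<Omega> v x)"

definition bdry_form ::
  "'a::euclidean_space set \<Rightarrow> ('a \<Rightarrow> real) \<Rightarrow> ('a \<Rightarrow> real) \<Rightarrow> ('a \<Rightarrow> real) \<Rightarrow> real" where
  "bdry_form \<Omega> b u v = (LINT x|surf \<Omega>. b x * tr \<Omega> u x * tr \<Omega> v x)"

definition b_inner ::
  "'a::euclidean_space set \<Rightarrow> ('a \<Rightarrow> real) \<Rightarrow> ('a \<Rightarrow> real) \<Rightarrow> ('a \<Rightarrow> real) \<Rightarrow> real" where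
  "b_inner \<Omega> b u v = grad_form \<Omega> u v + bdry_form \<Omega> b u v"

definition robin_eigenfunction ::
  "'a::euclidean_space set \<Rightarrow> ('a \<Rightarrow> real) \<Rightarrow> real \<Rightarrow> ('a \<Rightarrow> real) \<Rightarrow> bool" where
  "robin_eigenfunction \<Omega> b lam u \<longleftrightarrow> u \<in> H1 \<Omega> \<and> nonzero_on \<Omega> u \<and>
     (\<forall>h\<in>H1 \<Omega>. b_inner \<Omega> b u h = lam * (LINT x|vol \<Omega>. u x * h x))"

text \<open>Sequences are indexed by \<open>j \<ge> 1\<close>. The clause before the last says that every eigenspace is
  spanned by the listed eigenfunctions belonging to that eigenvalue: together with
  orthonormality, all eigenvalues are listed, each as often as its multiplicity.\<close>

definition robin_eigendata ::
  "'a::euclidean_space set \<Rightarrow> ('a \<Rightarrow> real) \<Rightarrow> (nat \<Rightarrow> real) \<Rightarrow> (nat \<Rightarrow> 'a \<Rightarrow> real) \<Rightarrow> bool" where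
  "robin_eigendata \<Omega> b lam g \<longleftrightarrow>
     (\<forall>j\<ge>1. lam j > 0 \<and> robin_eigenfunction \<Omega> b (lam j) (g j)) \<and>
     mono_on {1..} lam \<and> filterlim lam at_top sequentially \<and>
     (\<forall>i\<ge>1. \<forall>j\<ge>1. b_inner \<Omega> b (g i) (g j) = (if i = j then 1 else 0)) \<and>
     (\<forall>\<mu> u. robin_eigenfunction \<Omega> b \<mu> u \<longrightarrow> finite {j. j \<ge> 1 \<and> lam j = \<mu>} \<and>
        (\<exists>c :: nat \<Rightarrow> real. AE x in vol \<Omega>. u x = (\<Sum>j | j \<ge> 1 \<and> lam j = \<mu>. c j * g j x))) \<and>
     \<not> (\<exists>h\<in>H1 \<Omega>. b_inner \<Omega> b h h = 1 \<and> (\<forall>j\<ge>1. b_inner \<Omega> b (g j) h = 0))"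

definition steklov_eigenfunction ::
  "'a::euclidean_space set \<Rightarrow> ('a \<Rightarrow> real) \<Rightarrow> real \<Rightarrow> ('a \<Rightarrow> real) \<Rightarrow> bool" where
  "steklov_eigenfunction \<Omega> b del s \<longleftrightarrow> s \<in> H1 \<Omega> \<and> nonzero_on \<Omega> s \<and>
     (\<forall>h\<in>H1 \<Omega>. grad_form \<Omega> s h = del * bdry_form \<Omega> b s h)"

definition H10_complement :: "'a::euclidean_space set \<Rightarrow> ('a \<Rightarrow> real) \<Rightarrow> ('a \<Rightarrow> real) set" where
  "H10_complement \<Omega> b = {w \<in> H1 \<Omega>. \<forall>v\<in>H10 \<Omega>. b_inner \<Omega> b w v = 0}"

definition steklov_eigendata ::
  "'a::euclidean_space set \<Rightarrow> ('a \<Rightarrow> real) \<Rightarrow> (nat \<Rightarrow> real) \<Rightarrow> (nat \<Rightarrow> 'a \<Rightarrow> real) \<Rightarrow> bool" where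
  "steklov_eigendata \<Omega> b del s \<longleftrightarrow>
     (\<forall>k. steklov_eigenfunction \<Omega> b (del k) (s k)) \<and>
     del 0 = 0 \<and> (AE x in vol \<Omega>. s 0 x = 1) \<and>
     mono_on {1..} del \<and>
     del ` {1..} = {\<mu>. \<mu> > 0 \<and> (\<exists>u. steklov_eigenfunction \<Omega> b \<mu> u)} \<and>
     (\<forall>i\<ge>1. \<forall>k\<ge>1. b_inner \<Omega> b (s i) (s k) = (if i = k then 1 else 0)) \<and>
     (\<forall>i k. i \<noteq> k \<longrightarrow> b_inner \<Omega> b (s i) (s k) = 0) \<and>
     (\<forall>k. s k \<in> H10_complement \<Omega> b) \<and>
     \<not> (\<exists>w\<in>H10_complement \<Omega> b. nonzero_on \<Omega> w \<and> (\<forall>k. b_inner \<Omega> b (s k) w = 0))"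


section \<open>The Robin--Steklov problem on a product region\<close>

text \<open>Traces of functions in \<open>H1 (\<Omega>1 \<times> \<Omega>2)\<close> on the two faces \<open>bdry \<Omega>1 \<times> \<Omega>2\<close> and
  \<open>\<Omega>1 \<times> bdry \<Omega>2\<close>; the surface measure on a face is the product measure with respect to which the
  boundary integrals of the problem are written.\<close>

definition trace_face1 ::
  "'a::euclidean_space set \<Rightarrow> 'b::euclidean_space set \<Rightarrow> ('a \<times> 'b \<Rightarrow> real) \<Rightarrow> 'a \<times> 'b \<Rightarrow> real" where
  "trace_face1 \<Omega>1 \<Omega>2 = bdry_trace (\<Omega>1 \<times> \<Omega>2) (surf \<Omega>1 \<Otimes>\<^sub>M vol \<Omega>2)"

definition trace_face2 ::
  "'a::euclidean_space set \<Rightarrow> 'b::euclidean_space set \<Rightarrow> ('a \<times> 'b \<Rightarrow> real) \<Rightarrow> 'a \<times> 'b \<Rightarrow> real" where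
  "trace_face2 \<Omega>1 \<Omega>2 = bdry_trace (\<Omega>1 \<times> \<Omega>2) (vol \<Omega>1 \<Otimes>\<^sub>M surf \<Omega>2)"

definition RSL_eigenfunction ::
  "'a::euclidean_space set \<Rightarrow> 'b::euclidean_space set \<Rightarrow> ('a \<Rightarrow> real) \<Rightarrow> ('b \<Rightarrow> real) \<Rightarrow>
    real \<Rightarrow> real \<Rightarrow> ('a \<times> 'b \<Rightarrow> real) \<Rightarrow> bool" where
  "RSL_eigenfunction \<Omega>1 \<Omega>2 b1 b2 lam del u \<longleftrightarrow>
     u \<in> H1 (\<Omega>1 \<times> \<Omega>2) \<and> nonzero_on (\<Omega>1 \<times> \<Omega>2) u \<and>
     (\<forall>h\<in>H1 (\<Omega>1 \<times> \<Omega>2).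
        grad_form (\<Omega>1 \<times> \<Omega>2) u h +
        (LINT y|vol \<Omega>2. LINT x|surf \<Omega>1.
           b1 x * trace_face1 \<Omega>1 \<Omega>2 u (x, y) * trace_face1 \<Omega>1 \<Omega>2 h (x, y)) =
        lam * (LINT z|vol (\<Omega>1 \<times> \<Omega>2). u z * h z) +
        del * (LINT x|vol \<Omega>1. LINT y|surf \<Omega>2.
           b2 y * trace_face2 \<Omega>1 \<Omega>2 u (x, y) * trace_face2 \<Omega>1 \<Omega>2 h (x, y)))"

definition tensor :: "('a \<Rightarrow> real) \<Rightarrow> ('b \<Rightarrow> real) \<Rightarrow> 'a \<times> 'b \<Rightarrow> real" where
  "tensor f g = (\<lambda>(x, y). f x * g y)"

end

theory Submission
  imports Defs
begin

text \<open>
  The eigenfunctions arise by separation of variables. Let \<open>g\<close> be a Robin eigenfunction on \<open>\<Omega>1\<close>, let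
  \<open>s\<close> be a Steklov eigenfunction on \<open>\<Omega>2\<close>, and for \<open>h\<close> in \<open>H\<^sup>1(\<Omega>1 \<times> \<Omega>2)\<close> put
  \<open>H(x) = \<integral> s(y) h(x, y) dy\<close> and \<open>K(y) = \<integral> g(x) h(x, y) dx\<close>. These are \<open>H\<^sup>1\<close> functions on the factors,
  and their weak gradients are obtained by differentiating under the integral
  (\<open>H1_pair_partial_integral\<close>). By Fubini's theorem the gradient form of \<open>g \<otimes> s\<close> and \<open>h\<close> is the
  gradient form of \<open>g\<close> and \<open>H\<close> plus that of \<open>s\<close> and \<open>K\<close> (\<open>grad_form_tensor\<close>). The Robin equation
  tested with \<open>H\<close> and the Steklov equation tested with \<open>K\<close> turn this into the equation for
  \<open>g \<otimes> s\<close>, as soon as the boundary integral of \<open>g\<close> and \<open>H\<close> is that of \<open>g \<otimes> s\<close> and \<open>h\<close> over the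
  corresponding face, and likewise for \<open>s\<close> and \<open>K\<close> (\<open>face_integral_tensor\<close>).

  The last point needs traces of arbitrary \<open>H\<^sup>1\<close> functions on the faces of the product, and traces
  are defined by approximation with Lipschitz functions. They are unique because integration over
  one variable commutes with taking traces in the other (\<open>has_trace_partial_integral\<close>), which reduces
  the question to the factors. They exist because every \<open>h\<close> is a limit in \<open>H\<^sup>1\<close> of finite sums of tensor
  products of \<open>H\<^sup>1\<close> functions (\<open>tensor_series\<close>): on such sums the trace is explicit, and the trace
  inequality of a factor, applied in each slice, bounds it by the \<open>H\<^sup>1\<close> norm
  (\<open>tensor_trace_bound\<close>). The trace inequality of a factor is a consequence of the compactness of its
  trace map (\<open>trace_bounded\<close>).

  The sums of tensor products are the partial sums of the expansion of \<open>h\<close> in the Robin eigenfunctions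
  of \<open>\<Omega>1\<close>. After scaling, the eigenfunctions are an orthonormal basis of \<open>L\<^sup>2\<close>: the eigendata make them
  complete in \<open>H\<^sup>1\<close> (\<open>eigen_expansion\<close>), which contains the test functions. Hence the expansions of \<open>h\<close>
  and of its gradient in the other variable converge. The gradient in the expanded variable is
  controlled by Bessel's inequality for the energy form (\<open>coeff_energy_bounded\<close>).

  Weak gradients and traces are defined by choice among representatives. What makes the choices
  harmless is the fundamental lemma of the calculus of variations (\<open>test_functions_separate\<close>),
  proved here from explicit smooth bump functions.
\<close>

section \<open>Semi-inner products on spaces of functions\<close>

text \<open>Functions are representatives of classes modulo almost-everywhere equality, so the spaces below
  carry only semi-inner products and are not instances of the inner product classes. Both the
  \<open>L\<^sup>2\<close> product and the weighted energy form on \<open>H\<^sup>1\<close> are instances of this locale.\<close>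

locale semi_inner_functions =
  fixes V :: "('x \<Rightarrow> 'c::real_vector) set" and B :: "('x \<Rightarrow> 'c) \<Rightarrow> ('x \<Rightarrow> 'c) \<Rightarrow> real"
  assumes zero_closed: "(\<lambda>_. 0) \<in> V"
    and add_closed: "f \<in> V \<Longrightarrow> g \<in> V \<Longrightarrow> (\<lambda>x. f x + g x) \<in> V"
    and scale_closed: "f \<in> V \<Longrightarrow> (\<lambda>x. c *\<^sub>R f x) \<in> V"
    and sym: "B f g = B g f"
    and add_left: "f \<in> V \<Longrightarrow> g \<in> V \<Longrightarrow> h \<in> V \<Longrightarrow> B (\<lambda>x. f x + g x) h = B f h + B g h"
    and scale_left: "f \<in> V \<Longrightarrow> h \<in> V \<Longrightarrow> B (\<lambda>x. c *\<^sub>R f x) h = c * B f h"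
    and nonneg: "f \<in> V \<Longrightarrow> 0 \<le> B f f"
begin

definition nrm :: "('x \<Rightarrow> 'c) \<Rightarrow> real" where
  "nrm f = sqrt (B f f)"

lemma add_right: "f \<in> V \<Longrightarrow> g \<in> V \<Longrightarrow> h \<in> V \<Longrightarrow> B h (\<lambda>x. f x + g x) = B h f + B h g"
  using add_left sym by metis

lemma scale_right: "f \<in> V \<Longrightarrow> h \<in> V \<Longrightarrow> B h (\<lambda>x. c *\<^sub>R f x) = c * B h f"
  using scale_left sym by metis

lemma minus_closed: "f \<in> V \<Longrightarrow> (\<lambda>x. - f x) \<in> V"
  using scale_closed[of f "-1"] by simp

lemma diff_closed: "f \<in> V \<Longrightarrow> g \<in> V \<Longrightarrow> (\<lambda>x. f x - g x) \<in> V"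
  using add_closed[of f "\<lambda>x. - g x"] minus_closed[of g] by simp

lemma diff_left: "f \<in> V \<Longrightarrow> g \<in> V \<Longrightarrow> h \<in> V \<Longrightarrow> B (\<lambda>x. f x - g x) h = B f h - B g h"
  using add_left[of f "\<lambda>x. (-1) *\<^sub>R g x" h] scale_left[of g h "-1"] scale_closed[of g "-1"] by simp

lemma diff_right: "f \<in> V \<Longrightarrow> g \<in> V \<Longrightarrow> h \<in> V \<Longrightarrow> B h (\<lambda>x. f x - g x) = B h f - B h g"
  using diff_left sym by metis

lemma sum_closed: "(\<And>i. i \<in> A \<Longrightarrow> f i \<in> V) \<Longrightarrow> (\<lambda>x. \<Sum>i\<in>A. f i x) \<in> V"
  by (induction A rule: infinite_finite_induct) (auto simp: zero_closed intro!: add_closed)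

lemma zero_left: "h \<in> V \<Longrightarrow> B (\<lambda>_. 0) h = 0"
  using scale_left[of h h 0] by simp

lemma sum_left:
  "(\<And>i. i \<in> A \<Longrightarrow> f i \<in> V) \<Longrightarrow> h \<in> V \<Longrightarrow> B (\<lambda>x. \<Sum>i\<in>A. f i x) h = (\<Sum>i\<in>A. B (f i) h)"
  by (induction A rule: infinite_finite_induct) (auto simp: zero_left add_left sum_closed)

lemma sum_right:
  "(\<And>i. i \<in> A \<Longrightarrow> f i \<in> V) \<Longrightarrow> h \<in> V \<Longrightarrow> B h (\<lambda>x. \<Sum>i\<in>A. f i x) = (\<Sum>i\<in>A. B h (f i))"
  using sum_left[of A f h] by (simp add: sym[of h])

lemma Cauchy_Schwarz:
  assumes "f \<in> V" "g \<in> V"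
  shows "(B f g)\<^sup>2 \<le> B f f * B g g"
proof -
  have q: "0 \<le> B f f - 2 * t * B f g + t\<^sup>2 * B g g" for t
  proof -
    have "B (\<lambda>x. f x - t *\<^sub>R g x) (\<lambda>x. f x - t *\<^sub>R g x) = B f f - 2 * t * B f g + t\<^sup>2 * B g g"
      using assms by (simp add: diff_left diff_right scale_closed diff_closed scale_left scale_right
          sym[of g f] power2_eq_square algebra_simps)
    with nonneg[OF diff_closed[OF assms(1) scale_closed[OF assms(2), of t]]] show ?thesis by simp
  qed
  show ?thesis
  proof (cases "B g g = 0")
    case True
    have "B f g = 0"
    proof (rule ccontr)
      assume "B f g \<noteq> 0"
      \<comment> \<open>the quadratic function is affine here and negative for this \<open>t\<close>\<close>
      then show False using q[of "(B f f + 1) / (2 * B f g)"] True by simp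
    qed
    then show ?thesis using True by simp
  next
    case False
    then have pos: "B g g > 0" using nonneg[OF assms(2)] by simp
    \<comment> \<open>\<open>t = B f g / B g g\<close> minimises the quadratic function\<close>
    have "0 \<le> B f f - (B f g)\<^sup>2 / B g g"
      using q[of "B f g / B g g"] pos by (simp add: power2_eq_square field_simps)
    then show ?thesis using pos by (simp add: field_simps)
  qed
qed

lemma nrm_nonneg: "f \<in> V \<Longrightarrow> 0 \<le> nrm f"
  by (simp add: nrm_def nonneg)

lemma abs_le_nrm: "f \<in> V \<Longrightarrow> g \<in> V \<Longrightarrow> \<bar>B f g\<bar> \<le> nrm f * nrm g"
  using real_sqrt_le_mono[OF Cauchy_Schwarz[of f g]] by (simp add: nrm_def real_sqrt_mult)

lemma nrm_scale: "f \<in> V \<Longrightarrow> nrm (\<lambda>x. c *\<^sub>R f x) = \<bar>c\<bar> * nrm f"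
  by (simp add: nrm_def scale_left scale_right scale_closed real_sqrt_mult flip: mult.assoc)

lemma nrm_triangle:
  assumes "f \<in> V" "g \<in> V"
  shows "nrm (\<lambda>x. f x + g x) \<le> nrm f + nrm g"
proof -
  have "B (\<lambda>x. f x + g x) (\<lambda>x. f x + g x) = B f f + 2 * B f g + B g g"
    using assms by (simp add: add_left add_right add_closed sym[of g f])
  also have "\<dots> \<le> (nrm f)\<^sup>2 + 2 * (nrm f * nrm g) + (nrm g)\<^sup>2"
    using abs_le_nrm[OF assms] assms by (simp add: nrm_def nonneg)
  also have "\<dots> = (nrm f + nrm g)\<^sup>2"
    by (simp add: power2_eq_square algebra_simps)
  finally show ?thesis
    using nrm_nonneg assms by (metis add_nonneg_nonneg nrm_def real_le_lsqrt)
qed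

lemma nrm_diff_triangle:
  assumes "f \<in> V" "g \<in> V" "h \<in> V"
  shows "nrm (\<lambda>x. f x - h x) \<le> nrm (\<lambda>x. f x - g x) + nrm (\<lambda>x. g x - h x)"
  using nrm_triangle[of "\<lambda>x. f x - g x" "\<lambda>x. g x - h x"] assms by (simp add: diff_closed)

lemma nrm_minus_commute:
  assumes "f \<in> V" "g \<in> V"
  shows "nrm (\<lambda>x. f x - g x) = nrm (\<lambda>x. g x - f x)"
  using nrm_scale[of "\<lambda>x. f x - g x" "-1"] assms by (simp add: diff_closed)

lemma nrm_sq: "f \<in> V \<Longrightarrow> (nrm f)\<^sup>2 = B f f"
  by (simp add: nrm_def nonneg)

lemma B_tendsto_zero_iff: "(\<lambda>n. B (f n) (f n)) \<longlonglongrightarrow> 0 \<longleftrightarrow> (\<lambda>n. nrm (f n)) \<longlonglongrightarrow> 0"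
  if "\<And>n. f n \<in> V"
proof
  assume "(\<lambda>n. B (f n) (f n)) \<longlonglongrightarrow> 0"
  then show "(\<lambda>n. nrm (f n)) \<longlonglongrightarrow> 0"
    unfolding nrm_def using tendsto_real_sqrt by fastforce
next
  assume "(\<lambda>n. nrm (f n)) \<longlonglongrightarrow> 0"
  from tendsto_power[OF this, of 2] show "(\<lambda>n. B (f n) (f n)) \<longlonglongrightarrow> 0"
    using nrm_sq[OF that] by simp
qed

lemma B_tendsto_left:
  assumes "\<And>n. f n \<in> V" "g \<in> V" "h \<in> V" "(\<lambda>n. nrm (\<lambda>x. f n x - g x)) \<longlonglongrightarrow> 0"
  shows "(\<lambda>n. B (f n) h) \<longlonglongrightarrow> B g h"
proof -
  have "(\<lambda>n. B (f n) h - B g h) \<longlonglongrightarrow> 0"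
  proof (rule Lim_null_comparison)
    show "\<forall>\<^sub>F n in sequentially. norm (B (f n) h - B g h) \<le> nrm (\<lambda>x. f n x - g x) * nrm h"
      using abs_le_nrm[OF diff_closed[OF assms(1,2)] assms(3)] assms
      by (simp add: diff_left)
    show "(\<lambda>n. nrm (\<lambda>x. f n x - g x) * nrm h) \<longlonglongrightarrow> 0"
      using tendsto_mult_left_zero[OF assms(4)] .
  qed
  then show ?thesis using Lim_null by blast
qed

definition orthonormal :: "'i set \<Rightarrow> ('i \<Rightarrow> 'x \<Rightarrow> 'c) \<Rightarrow> bool" where
  "orthonormal A e \<longleftrightarrow>
     (\<forall>i\<in>A. e i \<in> V) \<and> (\<forall>i\<in>A. \<forall>j\<in>A. B (e i) (e j) = (if i = j then 1 else 0))"

text \<open>The remainder after subtracting the orthogonal projection onto the span of \<open>e\<close> is orthogonal to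
  each \<open>e i\<close>; Pythagoras then gives its square norm.\<close>

lemma Bessel_identity:
  assumes "orthonormal A e" "finite A" "f \<in> V"
  defines "r \<equiv> \<lambda>x. f x - (\<Sum>i\<in>A. B f (e i) *\<^sub>R e i x)"
  shows "r \<in> V" "i \<in> A \<Longrightarrow> B r (e i) = 0" "B r r = B f f - (\<Sum>i\<in>A. (B f (e i))\<^sup>2)"
proof -
  let ?s = "\<lambda>x. \<Sum>i\<in>A. B f (e i) *\<^sub>R e i x"
  have eV: "\<And>i. i \<in> A \<Longrightarrow> e i \<in> V" and
    ee: "\<And>i j. i \<in> A \<Longrightarrow> j \<in> A \<Longrightarrow> B (e i) (e j) = (if i = j then 1 else 0)"
    using assms(1) by (auto simp: orthonormal_def)
  have sV: "?s \<in> V" using eV by (intro sum_closed scale_closed)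
  show rV: "r \<in> V" unfolding r_def using assms(3) sV by (intro diff_closed)
  have se: "B ?s (e i) = B f (e i)" if "i \<in> A" for i
  proof -
    have "B ?s (e i) = (\<Sum>j\<in>A. B f (e j) * B (e j) (e i))"
      using that eV by (simp add: sum_left scale_closed scale_left)
    also have "\<dots> = (\<Sum>j\<in>A. if j = i then B f (e i) else 0)"
      using that by (intro sum.cong) (auto simp: ee)
    finally show ?thesis using that assms(2) by simp
  qed
  show re: "B r (e i) = 0" if "i \<in> A" for i
    unfolding r_def using that se assms(3) sV eV by (simp add: diff_left)
  have "B r ?s = 0"
    using rV eV re by (simp add: sum_right scale_closed scale_right)
  then have "B r r = B r f"
    using rV assms(3) sV unfolding r_def by (simp add: diff_right)
  also have "\<dots> = B f f - B ?s f"
    unfolding r_def using assms(3) sV by (simp add: diff_left)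
  also have "B ?s f = (\<Sum>i\<in>A. (B f (e i))\<^sup>2)"
    using eV assms(3) by (simp add: sum_left scale_closed scale_left sym[of f] power2_eq_square)
  finally show "B r r = B f f - (\<Sum>i\<in>A. (B f (e i))\<^sup>2)" .
qed

lemma Bessel:
  assumes "orthonormal A e" "finite A" "f \<in> V"
  shows "(\<Sum>i\<in>A. (B f (e i))\<^sup>2) \<le> B f f"
  using Bessel_identity(3)[OF assms] nonneg[OF Bessel_identity(1)[OF assms]] by simp

text \<open>Parseval's identity for finitely many functions with respect to an orthonormal basis of their
  span. Functions that add nothing modulo null functions contribute no basis element, so the
  number of basis elements may be smaller than the number of functions.\<close>

lemma Gram_Schmidt:
  assumes "finite A" "\<And>i. i \<in> A \<Longrightarrow> f i \<in> V"
  shows "\<exists>n (e :: nat \<Rightarrow> 'x \<Rightarrow> 'c). orthonormal {..<n} e \<and>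
    (\<forall>i\<in>A. B (f i) (f i) = (\<Sum>k<n. (B (f i) (e k))\<^sup>2))"
  using assms
proof (induction A rule: finite_induct)
  case empty
  show ?case by (intro exI[of _ 0]) (auto simp: orthonormal_def)
next
  case (insert a A)
  obtain n and e :: "nat \<Rightarrow> 'x \<Rightarrow> 'c" where o: "orthonormal {..<n} e"
    and eq: "\<forall>i\<in>A. B (f i) (f i) = (\<Sum>k<n. (B (f i) (e k))\<^sup>2)"
    using insert by auto
  have eV: "\<And>k. k < n \<Longrightarrow> e k \<in> V" and
    ee: "\<And>k l. k < n \<Longrightarrow> l < n \<Longrightarrow> B (e k) (e l) = (if k = l then 1 else 0)"
    using o by (auto simp: orthonormal_def)
  have fV: "f a \<in> V" using insert by simp
  define r where "r = (\<lambda>x. f a x - (\<Sum>k<n. B (f a) (e k) *\<^sub>R e k x))"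
  note r = Bessel_identity[OF o finite_lessThan fV, folded r_def]
  show ?case
  proof (cases "B r r = 0")
    case True
    then show ?thesis using o eq r(3) by auto
  next
    case False
    then have pos: "0 < nrm r" "nrm r \<noteq> 0" using nonneg[OF r(1)] by (auto simp: nrm_def)
    define e' where "e' = e(n := \<lambda>x. (1 / nrm r) *\<^sub>R r x)"
    have e'n: "e' n = (\<lambda>x. (1 / nrm r) *\<^sub>R r x)" and e'k: "k < n \<Longrightarrow> e' k = e k" for k
      by (auto simp: e'_def)
    have nV: "e' n \<in> V" unfolding e'n using r(1) by (rule scale_closed)
    have rr: "B r r = nrm r * nrm r" using nrm_sq[OF r(1)] by (simp add: power2_eq_square)
    have nn: "B (e' n) (e' n) = 1"
      unfolding e'n using r(1) pos by (simp add: scale_left scale_right scale_closed rr)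
    have nk: "B (e' n) (e' k) = 0" "B (e' k) (e' n) = 0" if "k < n" for k
      using that r(1,2) eV[OF that] sym by (auto simp: e'k e'n scale_left scale_right)
    have o': "orthonormal {..<Suc n} e'"
      unfolding orthonormal_def using nV nn nk eV ee by (auto simp: less_Suc_eq e'k)
    \<comment> \<open>For the old functions Parseval holds already without the new element, whose coefficient
      is therefore zero by Bessel's inequality.\<close>
    have A: "B (f i) (f i) = (\<Sum>k<Suc n. (B (f i) (e' k))\<^sup>2)" if i: "i \<in> A" for i
    proof -
      have iV: "f i \<in> V" using i insert by simp
      have "(\<Sum>k<Suc n. (B (f i) (e' k))\<^sup>2) \<le> B (f i) (f i)"
        using Bessel[OF o' _ iV] by simp
      moreover have "(\<Sum>k<Suc n. (B (f i) (e' k))\<^sup>2) = B (f i) (f i) + (B (f i) (e' n))\<^sup>2"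
        using eq i by (simp add: e'k)
      ultimately show ?thesis by simp
    qed
    have "B r (f a) = B r r"
    proof -
      have "B r r = B r (f a) - B r (\<lambda>x. \<Sum>k<n. B (f a) (e k) *\<^sub>R e k x)"
        unfolding r_def
        by (rule diff_right) (use fV eV r(1) in \<open>auto simp: r_def intro!: sum_closed scale_closed\<close>)
      also have "B r (\<lambda>x. \<Sum>k<n. B (f a) (e k) *\<^sub>R e k x) = 0"
      proof -
        have "B r (\<lambda>x. \<Sum>k<n. B (f a) (e k) *\<^sub>R e k x) = (\<Sum>k<n. B r (\<lambda>x. B (f a) (e k) *\<^sub>R e k x))"
          using eV r(1) by (intro sum_right scale_closed) auto
        also have "\<dots> = 0"
          using eV r(1,2) by (intro sum.neutral) (auto simp: scale_right)
        finally show ?thesis .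
      qed
      finally show ?thesis by simp
    qed
    then have "B (f a) (e' n) = nrm r"
      unfolding e'n sym[of "f a" "\<lambda>x. (1 / nrm r) *\<^sub>R r x"]
      using fV r(1) pos by (simp add: scale_left rr)
    then have "B (f a) (f a) = (\<Sum>k<Suc n. (B (f a) (e' k))\<^sup>2)"
      using r(3) rr by (simp add: e'k power2_eq_square)
    with A o' show ?thesis by blast
  qed
qed

end

section \<open>Square-integrable functions\<close>

text \<open>Partial sums of an orthogonal series satisfy the hypothesis when \<open>d m n\<close> is the distance of the
  partial sums and \<open>q\<close> the sequence of square norms of the terms.\<close>

lemma Cauchy_if_summable_bound:
  fixes q :: "nat \<Rightarrow> real" and d :: "nat \<Rightarrow> nat \<Rightarrow> real"
  assumes q: "summable q" and C: "C \<ge> 0" and q0: "\<And>j. q j \<ge> 0"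
    and bound: "\<And>m n. n \<le> m \<Longrightarrow> (d m n)\<^sup>2 \<le> C * sum q {n..<m}"
    and sym: "\<And>m n. d m n = d n m" and e: "e > 0"
  shows "\<exists>K. \<forall>m\<ge>K. \<forall>n\<ge>K. d m n < e"
proof -
  have "e\<^sup>2 / (C + 1) > 0" using e C by simp
  then obtain K where K: "\<And>m n. m \<ge> K \<Longrightarrow> norm (sum q {m..<n}) < e\<^sup>2 / (C + 1)"
    using q[unfolded summable_Cauchy, rule_format, of "e\<^sup>2 / (C + 1)"] by blast
  have half: "d m n < e" if "n \<ge> K" "n \<le> m" for m n
  proof -
    have "(d m n)\<^sup>2 \<le> C * sum q {n..<m}" by (rule bound[OF that(2)])
    also have "\<dots> \<le> (C + 1) * sum q {n..<m}" by (intro mult_right_mono sum_nonneg q0) simp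
    also have "\<dots> < e\<^sup>2" using K[OF that(1), of m] C sum_nonneg[of "{n..<m}" q, OF q0] by (simp add: field_simps)
    finally show ?thesis using e by (simp add: power_less_imp_less_base)
  qed
  have "d m n < e" if "m \<ge> K" "n \<ge> K" for m n
    using half[of n m] half[of m n] sym[of m n] that by (cases "n \<le> m") auto
  then show ?thesis by blast
qed

text \<open>The measurable sets over which \<open>F\<close> integrates to zero form a Dynkin system.\<close>

lemma AE_zero_if_integral_zero_on_generator:
  fixes F :: "'x \<Rightarrow> real"
  assumes F: "integrable M F"
    and G: "Int_stable G" "G \<subseteq> Pow (space M)" "sets M = sigma_sets (space M) G"
    and zero: "\<And>A. A \<in> G \<Longrightarrow> (LINT x:A|M. F x) = 0" and total: "(LINT x|M. F x) = 0"
  shows "AE x in M. F x = 0"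
proof -
  have set_int: "set_integrable M A F" if "A \<in> sets M" for A
    unfolding set_integrable_def using F that by (intro integrable_mult_indicator) auto
  have "(LINT x:A|M. F x) = 0" if A: "A \<in> sets M" for A
  proof -
    have "A \<in> sigma_sets (space M) G" using A G(3) by simp
    from G(1,2) this show ?thesis
    proof (induction rule: sigma_sets_induct_disjoint)
      case (basic A) then show ?case by (rule zero)
    next
      case empty show ?case by (simp add: set_lebesgue_integral_def)
    next
      case (compl A)
      then have A: "A \<in> sets M" using G(3) by blast
      have "(LINT x:A \<union> (space M - A)|M. F x) = (LINT x:A|M. F x) + (LINT x:space M - A|M. F x)"
        using A by (intro set_integral_Un set_int) auto
      moreover have "A \<union> (space M - A) = space M" using sets.sets_into_space[OF A] by blast
      moreover have "(LINT x:space M|M. F x) = 0"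
        using total by (simp add: set_integral_space[OF F])
      ultimately show ?case using compl by simp
    next
      case (union A)
      then have A: "range A \<subseteq> sets M" using G(3) by blast
      have "(LINT x:(\<Union>i. A i)|M. F x) = (\<Sum>i. LINT x:A i|M. F x)"
        by (rule lebesgue_integral_countable_add)
          (use A union set_int in \<open>auto simp: disjoint_family_on_def\<close>)
      then show ?case using union by simp
    qed
  qed
  then have "AE x in M. F x = (\<lambda>_. 0) x"
    by (intro density_unique_real) (use F in auto)
  then show ?thesis by simp
qed

definition L2_inner :: "'x measure \<Rightarrow> ('x \<Rightarrow> 'c::euclidean_space) \<Rightarrow> ('x \<Rightarrow> 'c) \<Rightarrow> real" where
  "L2_inner M f g = (LINT x|M. f x \<bullet> g x)"

abbreviation L2_norm :: "'x measure \<Rightarrow> ('x \<Rightarrow> 'c::euclidean_space) \<Rightarrow> real" where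
  "L2_norm M \<equiv> semi_inner_functions.nrm (L2_inner M)"

abbreviation L2_tendsto ::
  "'x measure \<Rightarrow> (nat \<Rightarrow> 'x \<Rightarrow> 'c::euclidean_space) \<Rightarrow> ('x \<Rightarrow> 'c) \<Rightarrow> bool" where
  "L2_tendsto M f g \<equiv> (\<lambda>n. L2_norm M (\<lambda>x. f n x - g x)) \<longlonglongrightarrow> 0"

lemma norm_powr_2: "norm (v :: 'c::real_inner) powr 2 = v \<bullet> v"
  by (simp add: dot_square_norm)

lemma L2_iff: "f \<in> Lp M 2 \<longleftrightarrow> f \<in> borel_measurable M \<and> integrable M (\<lambda>x. f x \<bullet> f x)"
  by (simp add: Lp_def norm_powr_2)

lemma L2_measurable [measurable_dest]: "f \<in> Lp M 2 \<Longrightarrow> f \<in> borel_measurable M"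
  by (simp add: L2_iff)

lemma abs_inner_le: "\<bar>v \<bullet> w\<bar> \<le> v \<bullet> v + w \<bullet> (w :: 'c::real_inner)"
proof -
  have "0 \<le> (v + w) \<bullet> (v + w)" "0 \<le> (v - w) \<bullet> (v - w)" "0 \<le> v \<bullet> v" "0 \<le> w \<bullet> w" by simp_all
  then show ?thesis by (simp add: inner_add inner_diff inner_commute[of w v])
qed

lemma L2_integrable_inner:
  assumes "f \<in> Lp M 2" "g \<in> Lp M 2"
  shows "integrable M (\<lambda>x. f x \<bullet> g x)"
proof (rule Bochner_Integration.integrable_bound)
  show "integrable M (\<lambda>x. f x \<bullet> f x + g x \<bullet> g x)"
    using assms by (auto simp: L2_iff)
  show "(\<lambda>x. f x \<bullet> g x) \<in> borel_measurable M"
    using assms by (auto simp: L2_iff)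
  show "AE x in M. norm (f x \<bullet> g x) \<le> norm (f x \<bullet> f x + g x \<bullet> g x)"
    by (simp add: abs_inner_le)
qed

lemma L2_scale: "f \<in> Lp M 2 \<Longrightarrow> (\<lambda>x. c *\<^sub>R f x) \<in> Lp M 2"
  by (auto simp: L2_iff)

lemma L2_add:
  assumes "f \<in> Lp M 2" "g \<in> Lp M 2"
  shows "(\<lambda>x. f x + g x) \<in> Lp M 2"
  using assms L2_integrable_inner[OF assms] L2_integrable_inner[OF assms(2,1)]
  by (auto simp: L2_iff inner_add_left inner_add_right)

interpretation L2: semi_inner_functions "Lp M 2 :: ('x \<Rightarrow> 'c::euclidean_space) set" "L2_inner M"
  for M :: "'x measure"
proof
  show "(\<lambda>_. 0) \<in> Lp M 2" by (simp add: L2_iff)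
  show "\<And>f g. f \<in> Lp M 2 \<Longrightarrow> g \<in> Lp M 2 \<Longrightarrow> (\<lambda>x. f x + g x :: 'c) \<in> Lp M 2" by (rule L2_add)
  show "\<And>f c. f \<in> Lp M 2 \<Longrightarrow> (\<lambda>x. c *\<^sub>R f x :: 'c) \<in> Lp M 2" by (rule L2_scale)
  show "\<And>f g. L2_inner M f g = (L2_inner M g f :: real)"
    by (simp add: L2_inner_def inner_commute)
  show "\<And>f g h. f \<in> Lp M 2 \<Longrightarrow> g \<in> Lp M 2 \<Longrightarrow> h \<in> Lp M 2 \<Longrightarrow>
      L2_inner M (\<lambda>x. f x + g x :: 'c) h = L2_inner M f h + L2_inner M g h"
    by (simp add: L2_inner_def inner_add_left L2_integrable_inner)
  show "\<And>f h c. f \<in> Lp M 2 \<Longrightarrow> h \<in> Lp M 2 \<Longrightarrow>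
      L2_inner M (\<lambda>x. c *\<^sub>R f x :: 'c) h = c * L2_inner M f h"
    by (simp add: L2_inner_def)
  show "\<And>f. f \<in> Lp M 2 \<Longrightarrow> 0 \<le> L2_inner M f (f :: 'x \<Rightarrow> 'c)"
    by (simp add: L2_inner_def)
qed

lemma Lp_tendsto_iff_norm: "Lp_tendsto M 2 f g \<longleftrightarrow> L2_tendsto M f g"
  if "\<And>n. f n \<in> Lp M 2" "g \<in> Lp M 2"
  using L2.B_tendsto_zero_iff[of "\<lambda>n x. f n x - g x" M] that
  by (simp add: Lp_tendsto_def norm_powr_2 L2_inner_def L2.diff_closed)

lemma L2_cong_AE:
  assumes "AE x in M. f x = f' x" "AE x in M. g x = g' x"
    and [measurable]: "f \<in> borel_measurable M" "g \<in> borel_measurable M"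
      "f' \<in> borel_measurable M" "g' \<in> borel_measurable M"
  shows "L2_inner M f g = L2_inner M f' g'"
  unfolding L2_inner_def by (rule integral_cong_AE) (use assms in auto)

lemma L2_norm_cong_AE:
  assumes "AE x in M. f x = f' x"
    and "f \<in> borel_measurable M" "f' \<in> borel_measurable M"
  shows "L2_norm M f = L2_norm M f'"
  unfolding L2.nrm_def using L2_cong_AE[OF assms(1,1,2,2,3,3)] by simp

lemma L2_AE_cong:
  assumes "f \<in> Lp M 2" "AE x in M. f x = f' x" "f' \<in> borel_measurable M"
  shows "f' \<in> Lp M 2"
proof -
  have "integrable M (\<lambda>x. f x \<bullet> f x) \<longleftrightarrow> integrable M (\<lambda>x. f' x \<bullet> f' x)"
    by (rule integrable_cong_AE) (use assms in \<open>auto simp: L2_iff\<close>)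
  with assms show ?thesis by (simp add: L2_iff)
qed

lemma L2_norm_zero_AE:
  assumes "f \<in> Lp M 2" "L2_norm M f = 0"
  shows "AE x in M. f x = 0"
proof -
  have "(LINT x|M. f x \<bullet> f x) = 0"
    using assms L2.nrm_sq[OF assms(1)] by (simp add: L2_inner_def)
  then have "AE x in M. f x \<bullet> f x = 0"
    using assms(1) by (subst (asm) integral_nonneg_eq_0_iff_AE) (auto simp: L2_iff)
  then show ?thesis by simp
qed

lemma L2_limit_unique:
  assumes "\<And>n. f n \<in> Lp M 2" "g \<in> Lp M 2" "h \<in> Lp M 2"
    and "L2_tendsto M f g" "L2_tendsto M f h"
  shows "AE x in M. g x = h x"
proof -
  have "L2_norm M (\<lambda>x. g x - h x) \<le> 0"
  proof (rule LIMSEQ_le_const)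
    show "(\<lambda>n. L2_norm M (\<lambda>x. f n x - g x) + L2_norm M (\<lambda>x. f n x - h x)) \<longlonglongrightarrow> 0"
      using tendsto_add[OF assms(4,5)] by simp
    show "\<exists>N. \<forall>n\<ge>N. L2_norm M (\<lambda>x. g x - h x)
        \<le> L2_norm M (\<lambda>x. f n x - g x) + L2_norm M (\<lambda>x. f n x - h x)"
      using L2.nrm_diff_triangle[of g M _ h] L2.nrm_minus_commute[of g M] assms by metis
  qed
  then have "L2_norm M (\<lambda>x. g x - h x) = 0"
    using L2.nrm_nonneg[OF L2.diff_closed[OF assms(2,3)]] by simp
  from L2_norm_zero_AE[OF L2.diff_closed[OF assms(2,3)] this] show ?thesis by simp
qed

lemma L2_bounded:
  fixes f :: "'x \<Rightarrow> 'c::euclidean_space"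
  assumes "finite_measure M" "f \<in> borel_measurable M" "\<And>x. x \<in> space M \<Longrightarrow> norm (f x) \<le> C"
  shows "f \<in> Lp M 2"
proof -
  interpret finite_measure M by fact
  have "integrable M (\<lambda>x. f x \<bullet> f x)"
  proof (rule integrable_const_bound[where B = "C\<^sup>2"])
    show "AE x in M. norm (f x \<bullet> f x) \<le> C\<^sup>2"
      using assms(3) by (auto simp: dot_square_norm intro!: power_mono)
    show "(\<lambda>x. f x \<bullet> f x) \<in> borel_measurable M" using assms(2) by simp
  qed
  with assms show ?thesis by (simp add: L2_iff)
qed

lemma L2_mult_bounded:
  fixes f :: "'x \<Rightarrow> 'c::euclidean_space"
  assumes "f \<in> Lp M 2" "b \<in> borel_measurable M" "AE x in M. \<bar>b x\<bar> \<le> C"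
  shows "(\<lambda>x. b x *\<^sub>R f x) \<in> Lp M 2"
proof -
  have "integrable M (\<lambda>x. (b x *\<^sub>R f x) \<bullet> (b x *\<^sub>R f x))"
  proof (rule Bochner_Integration.integrable_bound)
    show "integrable M (\<lambda>x. C\<^sup>2 * (f x \<bullet> f x))" using assms(1) by (auto simp: L2_iff)
    show "(\<lambda>x. (b x *\<^sub>R f x) \<bullet> (b x *\<^sub>R f x)) \<in> borel_measurable M"
      using assms by (auto simp: L2_iff)
    show "AE x in M. norm ((b x *\<^sub>R f x) \<bullet> (b x *\<^sub>R f x)) \<le> norm (C\<^sup>2 * (f x \<bullet> f x))"
      using assms(3)
    proof eventually_elim
      case (elim x)
      then have "(b x)\<^sup>2 \<le> C\<^sup>2" by (meson abs_le_square_iff abs_ge_self order_trans)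
      then have "(b x)\<^sup>2 * (f x \<bullet> f x) \<le> C\<^sup>2 * (f x \<bullet> f x)" by (intro mult_right_mono) auto
      then show ?case by (simp add: power2_eq_square algebra_simps abs_mult)
    qed
  qed
  moreover have "(\<lambda>x. b x *\<^sub>R f x) \<in> borel_measurable M"
    using assms by (auto simp: L2_iff)
  ultimately show ?thesis by (simp add: L2_iff)
qed

lemma L2_norm_of: "f \<in> Lp M 2 \<Longrightarrow> (\<lambda>x. norm (f x)) \<in> Lp M 2"
  by (auto simp: L2_iff dot_square_norm power2_eq_square)

lemma L2_inner_norm: "L2_inner M (\<lambda>x. norm (f x)) (\<lambda>x. norm (f x)) = L2_inner M f f"
  by (simp add: L2_inner_def dot_square_norm power2_eq_square)

lemma L2_integral_norm_le:
  fixes f :: "'x \<Rightarrow> 'c::euclidean_space"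
  assumes "finite_measure M" "f \<in> Lp M 2"
  shows "integrable M f" "(LINT x|M. norm (f x)) \<le> L2_norm M (\<lambda>_. 1::real) * L2_norm M f"
proof -
  have one: "(\<lambda>_. 1::real) \<in> Lp M 2" by (rule L2_bounded[OF assms(1), of _ 1]) auto
  note n = L2_norm_of[OF assms(2)]
  have "integrable M (\<lambda>x. norm (f x))" using L2_integrable_inner[OF one n] by simp
  then show "integrable M f" using assms(2) by (simp add: integrable_norm_iff L2_iff)
  have "(LINT x|M. norm (f x)) = L2_inner M (\<lambda>_. 1) (\<lambda>x. norm (f x))" by (simp add: L2_inner_def)
  also have "\<dots> \<le> L2_norm M (\<lambda>_. 1::real) * L2_norm M (\<lambda>x. norm (f x))"
    using L2.abs_le_nrm[OF one n] by simp
  finally show "(LINT x|M. norm (f x)) \<le> L2_norm M (\<lambda>_. 1::real) * L2_norm M f"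
    by (simp add: L2.nrm_def L2_inner_norm)
qed

text \<open>Riesz--Fischer for a finite measure. A Cauchy sequence in \<open>L\<^sup>2\<close> is Cauchy in \<open>L\<^sup>1\<close>, hence has a
  subsequence that converges almost everywhere; Fatou's lemma shows that its pointwise limit is also
  the limit in \<open>L\<^sup>2\<close>.\<close>

theorem L2_complete:
  fixes f :: "nat \<Rightarrow> 'x \<Rightarrow> 'c::euclidean_space"
  assumes fin: "finite_measure M" and f: "\<And>n. f n \<in> Lp M 2"
    and cauchy: "\<And>e. e > 0 \<Longrightarrow> \<exists>N. \<forall>m\<ge>N. \<forall>n\<ge>N. L2_norm M (\<lambda>x. f m x - f n x) < e"
  obtains g where "g \<in> Lp M 2" "L2_tendsto M f g"
proof -
  have [measurable]: "\<And>n. f n \<in> borel_measurable M" using f by (simp add: L2_iff)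
  let ?c = "L2_norm M (\<lambda>_::'x. 1::real)"
  have c: "?c \<ge> 0" by (simp add: L2.nrm_def L2_inner_def)
  have "\<exists>N. \<forall>i\<ge>N. \<forall>j\<ge>N. LINT x|M. norm (f i x - f j x) < e" if "e > 0" for e
  proof -
    have p: "e / (?c + 1) > 0" using that c by simp
    obtain N where N: "\<forall>m\<ge>N. \<forall>n\<ge>N. L2_norm M (\<lambda>x. f m x - f n x) < e / (?c + 1)"
      using cauchy[OF p] by blast
    have "LINT x|M. norm (f i x - f j x) < e" if ij: "i \<ge> N" "j \<ge> N" for i j
    proof -
      have d: "(\<lambda>x. f i x - f j x) \<in> Lp M 2" using f by (intro L2.diff_closed)
      have "(LINT x|M. norm (f i x - f j x)) \<le> ?c * L2_norm M (\<lambda>x. f i x - f j x)"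
        by (rule L2_integral_norm_le(2)[OF fin d])
      also have "\<dots> \<le> (?c + 1) * L2_norm M (\<lambda>x. f i x - f j x)"
        using L2.nrm_nonneg[OF d] by (simp add: mult_right_mono)
      also have "\<dots> < (?c + 1) * (e / (?c + 1))"
        using N ij c by (intro mult_strict_left_mono) auto
      finally show ?thesis using c by (simp add: add_eq_0_iff)
    qed
    then show ?thesis by blast
  qed
  from cauchy_L1_AE_cauchy_subseq[OF L2_integral_norm_le(1)[OF fin f] this]
  obtain r where r: "strict_mono r" "AE x in M. Cauchy (\<lambda>i. f (r i) x)" by blast
  define g where "g = (\<lambda>x. lim (\<lambda>i. f (r i) x))"
  have [measurable]: "g \<in> borel_measurable M"
    unfolding g_def by measurable
  have lim: "AE x in M. (\<lambda>i. f (r i) x) \<longlonglongrightarrow> g x"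
    using r(2) by eventually_elim (auto simp: g_def Cauchy_convergent_iff convergent_LIMSEQ_iff)
  have bound: "(\<lambda>x. f n x - g x) \<in> Lp M 2 \<and> L2_norm M (\<lambda>x. f n x - g x) \<le> e"
    if e: "e > 0" and N: "\<forall>m\<ge>N. \<forall>n\<ge>N. L2_norm M (\<lambda>x. f m x - f n x) < e" and n: "n \<ge> N" for e N n
  proof -
    have "(\<integral>\<^sup>+x. ennreal ((f n x - g x) \<bullet> (f n x - g x)) \<partial>M)
      = (\<integral>\<^sup>+x. liminf (\<lambda>k. ennreal ((f n x - f (r k) x) \<bullet> (f n x - f (r k) x))) \<partial>M)"
    proof (rule nn_integral_cong_AE)
      show "AE x in M. ennreal ((f n x - g x) \<bullet> (f n x - g x))
        = liminf (\<lambda>k. ennreal ((f n x - f (r k) x) \<bullet> (f n x - f (r k) x)))"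
        using lim
      proof eventually_elim
        case (elim x)
        have "(\<lambda>k. ennreal ((f n x - f (r k) x) \<bullet> (f n x - f (r k) x)))
          \<longlonglongrightarrow> ennreal ((f n x - g x) \<bullet> (f n x - g x))"
          by (intro tendsto_intros elim)
        from lim_imp_Liminf[OF sequentially_bot this] show ?case by simp
      qed
    qed
    also have "\<dots> \<le> liminf (\<lambda>k. \<integral>\<^sup>+x. ennreal ((f n x - f (r k) x) \<bullet> (f n x - f (r k) x)) \<partial>M)"
      by (rule nn_integral_liminf) simp
    also have "\<dots> \<le> ennreal (e\<^sup>2)"
    proof (rule Liminf_le)
      show "\<forall>\<^sub>F k in sequentially. (\<integral>\<^sup>+x. ennreal ((f n x - f (r k) x) \<bullet> (f n x - f (r k) x)) \<partial>M) \<le> ennreal (e\<^sup>2)"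
      proof (rule eventually_sequentiallyI[of N])
        fix k assume "k \<ge> N"
        then have "r k \<ge> N" using seq_suble[OF r(1), of k] by simp
        then have "L2_norm M (\<lambda>x. f n x - f (r k) x) < e" using N n by blast
        moreover have d: "(\<lambda>x. f n x - f (r k) x) \<in> Lp M 2" using f by (intro L2.diff_closed)
        ultimately have "(L2_norm M (\<lambda>x. f n x - f (r k) x))\<^sup>2 \<le> e\<^sup>2"
          using L2.nrm_nonneg[OF d] by (intro power_mono) auto
        then have "(LINT x|M. (f n x - f (r k) x) \<bullet> (f n x - f (r k) x)) \<le> e\<^sup>2"
          using L2.nrm_sq[OF d] by (simp add: L2_inner_def)
        moreover have "(\<integral>\<^sup>+x. ennreal ((f n x - f (r k) x) \<bullet> (f n x - f (r k) x)) \<partial>M)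
          = ennreal (LINT x|M. (f n x - f (r k) x) \<bullet> (f n x - f (r k) x))"
          using d by (intro nn_integral_eq_integral) (auto simp: L2_iff)
        ultimately show "(\<integral>\<^sup>+x. ennreal ((f n x - f (r k) x) \<bullet> (f n x - f (r k) x)) \<partial>M) \<le> ennreal (e\<^sup>2)"
          by (simp add: ennreal_leI)
      qed
    qed simp
    finally have le: "(\<integral>\<^sup>+x. ennreal ((f n x - g x) \<bullet> (f n x - g x)) \<partial>M) \<le> ennreal (e\<^sup>2)" .
    have int: "integrable M (\<lambda>x. (f n x - g x) \<bullet> (f n x - g x))"
      using le by (intro integrableI_nonneg) (auto intro: le_less_trans[OF _ ennreal_less_top])
    then have L: "(\<lambda>x. f n x - g x) \<in> Lp M 2" by (simp add: L2_iff)
    have "ennreal (LINT x|M. (f n x - g x) \<bullet> (f n x - g x)) \<le> ennreal (e\<^sup>2)"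
      using le int by (subst (asm) nn_integral_eq_integral) auto
    then have "L2_inner M (\<lambda>x. f n x - g x) (\<lambda>x. f n x - g x) \<le> e\<^sup>2"
      by (simp add: L2_inner_def)
    then have "L2_norm M (\<lambda>x. f n x - g x) \<le> e"
      unfolding L2.nrm_def using e by (intro real_le_lsqrt) auto
    with L show ?thesis by blast
  qed
  obtain N1 where N1: "\<forall>m\<ge>N1. \<forall>n\<ge>N1. L2_norm M (\<lambda>x. f m x - f n x) < 1"
    using cauchy[of 1] by auto
  have "(\<lambda>x. f N1 x - (f N1 x - g x)) \<in> Lp M 2"
    by (rule L2.diff_closed) (use bound[OF _ N1, of N1] f in auto)
  then have g: "g \<in> Lp M 2" by simp
  have "L2_tendsto M f g"
  proof (rule LIMSEQ_I)
    fix e :: real assume "e > 0"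
    then obtain N where N: "\<forall>m\<ge>N. \<forall>n\<ge>N. L2_norm M (\<lambda>x. f m x - f n x) < e / 2"
      using cauchy[of "e / 2"] by auto
    have "norm (L2_norm M (\<lambda>x. f n x - g x) - 0) < e" if "n \<ge> N" for n
      using bound[OF _ N that] \<open>e > 0\<close> L2.nrm_nonneg[of "\<lambda>x. f n x - g x" M] by auto
    then show "\<exists>no. \<forall>n\<ge>no. norm (L2_norm M (\<lambda>x. f n x - g x) - 0) < e" by blast
  qed
  with g that show thesis by blast
qed

section \<open>Square-integrable functions on a product\<close>

text \<open>The first factor may be vector valued, so that the definition covers both \<open>g \<otimes> s\<close> and
  \<open>\<nabla>g \<otimes> s\<close>.\<close>

definition vtensor :: "('x \<Rightarrow> 'c::real_vector) \<Rightarrow> ('y \<Rightarrow> real) \<Rightarrow> 'x \<times> 'y \<Rightarrow> 'c" where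
  "vtensor a v = (\<lambda>z. v (snd z) *\<^sub>R a (fst z))"

text \<open>Integration against \<open>s\<close> in the second variable is the adjoint of \<open>a \<mapsto> a \<otimes> s\<close>; see
  \<open>inner_partial_integral\<close>. Integration in the first variable is expressed by composing \<open>k\<close> with
  \<^const>\<open>prod.swap\<close>.\<close>

definition partial_integral :: "'y measure \<Rightarrow> ('y \<Rightarrow> real) \<Rightarrow> ('x \<times> 'y \<Rightarrow> 'c::euclidean_space) \<Rightarrow> 'x \<Rightarrow> 'c" where
  "partial_integral N s k = (\<lambda>x. LINT y|N. s y *\<^sub>R k (x, y))"

lemma tensor_eq_vtensor: "tensor a v = vtensor a v"
  by (auto simp: tensor_def vtensor_def)

locale finite_pair = M: finite_measure M + N: finite_measure N
  for M :: "'x measure" and N :: "'y measure"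
begin

sublocale pair_sigma_finite M N ..

lemma finite_MN: "finite_measure (M \<Otimes>\<^sub>M N)"
  by (rule finite_measure_pair_measure) unfold_locales

lemma swap_pair: "finite_pair N M"
  by unfold_locales

lemma integral_product:
  fixes f :: "'x \<Rightarrow> real" and g :: "'y \<Rightarrow> real"
  assumes "integrable M f" "integrable N g"
  shows "integrable (M \<Otimes>\<^sub>M N) (\<lambda>z. f (fst z) * g (snd z))"
    and "(LINT z|(M \<Otimes>\<^sub>M N). f (fst z) * g (snd z)) = (LINT x|M. f x) * (LINT y|N. g y)"
proof -
  have [measurable]: "f \<in> borel_measurable M" "g \<in> borel_measurable N" using assms by auto
  show int: "integrable (M \<Otimes>\<^sub>M N) (\<lambda>z. f (fst z) * g (snd z))"
    by (rule Fubini_integrable) (use assms in \<open>auto simp: abs_mult\<close>)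
  show "(LINT z|(M \<Otimes>\<^sub>M N). f (fst z) * g (snd z)) = (LINT x|M. f x) * (LINT y|N. g y)"
    using integral_fst'[OF int] by simp
qed

lemma vtensor_L2:
  assumes "a \<in> Lp M 2" "v \<in> Lp N 2"
  shows "vtensor a v \<in> Lp (M \<Otimes>\<^sub>M N) 2"
proof -
  have [measurable]: "a \<in> borel_measurable M" "v \<in> borel_measurable N"
    using assms by (auto simp: L2_iff)
  have "integrable (M \<Otimes>\<^sub>M N) (\<lambda>z. (a (fst z) \<bullet> a (fst z)) * (v (snd z) \<bullet> v (snd z)))"
    using assms by (intro integral_product) (auto simp: L2_iff)
  moreover have "vtensor a v \<in> borel_measurable (M \<Otimes>\<^sub>M N)"
    unfolding vtensor_def by measurable
  ultimately show ?thesis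
    by (simp add: L2_iff vtensor_def mult_ac)
qed

lemma inner_vtensor:
  assumes "a \<in> Lp M 2" "a' \<in> Lp M 2" "v \<in> Lp N 2" "v' \<in> Lp N 2"
  shows "L2_inner (M \<Otimes>\<^sub>M N) (vtensor a v) (vtensor a' v') = L2_inner M a a' * L2_inner N v v'"
  using integral_product(2)[OF L2_integrable_inner[OF assms(1,2)] L2_integrable_inner[OF assms(3,4)]]
  by (simp add: L2_inner_def vtensor_def mult_ac)

lemma norm_vtensor:
  assumes "a \<in> Lp M 2" "v \<in> Lp N 2"
  shows "L2_norm (M \<Otimes>\<^sub>M N) (vtensor a v) = L2_norm M a * L2_norm N v"
  using inner_vtensor[OF assms(1,1,2,2)] by (simp add: L2.nrm_def real_sqrt_mult)

text \<open>From \<open>a\<^sub>n \<otimes> v\<^sub>n - a' \<otimes> v' = (a\<^sub>n - a') \<otimes> (v\<^sub>n - v') + (a\<^sub>n - a') \<otimes> v' + a' \<otimes> (v\<^sub>n - v')\<close> and the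
  multiplicativity of the norm on tensors.\<close>

lemma vtensor_tendsto:
  assumes a: "\<And>n. a n \<in> Lp M 2" "a' \<in> Lp M 2" "L2_tendsto M a a'"
    and v: "\<And>n. v n \<in> Lp N 2" "v' \<in> Lp N 2" "L2_tendsto N v v'"
  shows "L2_tendsto (M \<Otimes>\<^sub>M N) (\<lambda>n. vtensor (a n) (v n)) (vtensor a' v')"
proof (rule Lim_null_comparison)
  note d = L2.diff_closed[OF a(1) a(2)] L2.diff_closed[OF v(1) v(2)]
  let ?p = "\<lambda>n. L2_norm M (\<lambda>x. a n x - a' x)" and ?q = "\<lambda>n. L2_norm N (\<lambda>x. v n x - v' x)"
  have "norm (L2_norm (M \<Otimes>\<^sub>M N) (\<lambda>z. vtensor (a n) (v n) z - vtensor a' v' z))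
    \<le> ?p n * ?q n + ?p n * L2_norm N v' + L2_norm M a' * ?q n" for n
  proof -
    let ?A = "vtensor (\<lambda>x. a n x - a' x) (\<lambda>y. v n y - v' y)"
    let ?B = "vtensor (\<lambda>x. a n x - a' x) v'" and ?C = "vtensor a' (\<lambda>y. v n y - v' y)"
    have L: "?A \<in> Lp (M \<Otimes>\<^sub>M N) 2" "?B \<in> Lp (M \<Otimes>\<^sub>M N) 2" "?C \<in> Lp (M \<Otimes>\<^sub>M N) 2"
      using d a v by (auto intro!: vtensor_L2)
    have eq: "(\<lambda>z. vtensor (a n) (v n) z - vtensor a' v' z) = (\<lambda>z. (?A z + ?B z) + ?C z)"
      by (auto simp: vtensor_def algebra_simps)
    have "L2_norm (M \<Otimes>\<^sub>M N) (\<lambda>z. vtensor (a n) (v n) z - vtensor a' v' z)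
      \<le> L2_norm (M \<Otimes>\<^sub>M N) ?A + L2_norm (M \<Otimes>\<^sub>M N) ?B + L2_norm (M \<Otimes>\<^sub>M N) ?C"
      unfolding eq using L2.nrm_triangle[OF L2.add_closed[OF L(1,2)] L(3)] L2.nrm_triangle[OF L(1,2)]
      by simp
    moreover have "0 \<le> L2_norm (M \<Otimes>\<^sub>M N) (\<lambda>z. vtensor (a n) (v n) z - vtensor a' v' z)"
      by (intro L2.nrm_nonneg L2.diff_closed vtensor_L2 a v)
    ultimately show ?thesis using d a v by (simp add: norm_vtensor)
  qed
  then show "\<forall>\<^sub>F n in sequentially. norm (L2_norm (M \<Otimes>\<^sub>M N) (\<lambda>z. vtensor (a n) (v n) z - vtensor a' v' z))
    \<le> ?p n * ?q n + ?p n * L2_norm N v' + L2_norm M a' * ?q n" by simp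
  have "(\<lambda>n. ?p n * ?q n + ?p n * L2_norm N v' + L2_norm M a' * ?q n)
    \<longlonglongrightarrow> 0 * 0 + 0 * L2_norm N v' + L2_norm M a' * 0"
    by (intro tendsto_intros a v)
  then show "(\<lambda>n. ?p n * ?q n + ?p n * L2_norm N v' + L2_norm M a' * ?q n) \<longlonglongrightarrow> 0" by simp
qed

lemma L2_section:
  assumes "k \<in> Lp (M \<Otimes>\<^sub>M N) 2"
  shows "AE x in M. (\<lambda>y. k (x, y)) \<in> Lp N 2"
proof -
  have [measurable]: "k \<in> borel_measurable (M \<Otimes>\<^sub>M N)" using assms by (simp add: L2_iff)
  have "AE x in M. integrable N (\<lambda>y. k (x, y) \<bullet> k (x, y))"
    using AE_integrable_fst'[of "\<lambda>z. k z \<bullet> k z"] assms by (simp add: L2_iff)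
  then show ?thesis
    using AE_space by eventually_elim (simp add: L2_iff)
qed

lemma L2_inner_sections:
  assumes "k \<in> Lp (M \<Otimes>\<^sub>M N) 2" "l \<in> Lp (M \<Otimes>\<^sub>M N) 2"
  shows "integrable M (\<lambda>x. L2_inner N (\<lambda>y. k (x, y)) (\<lambda>y. l (x, y)))"
    and "L2_inner (M \<Otimes>\<^sub>M N) k l = (LINT x|M. L2_inner N (\<lambda>y. k (x, y)) (\<lambda>y. l (x, y)))"
  using integrable_fst'[OF L2_integrable_inner[OF assms]] integral_fst'[OF L2_integrable_inner[OF assms]]
  by (simp_all add: L2_inner_def)

lemma partial_integral_measurable [measurable]:
  assumes [measurable]: "k \<in> borel_measurable (M \<Otimes>\<^sub>M N)" "s \<in> borel_measurable N"
  shows "partial_integral N s k \<in> borel_measurable M"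
  unfolding partial_integral_def by measurable

text \<open>The norm bound is the Cauchy--Schwarz inequality in almost every slice, integrated over the first
  variable.\<close>

lemma partial_integral_L2:
  fixes k :: "'x \<times> 'y \<Rightarrow> 'c::euclidean_space"
  assumes k: "k \<in> Lp (M \<Otimes>\<^sub>M N) 2" and s: "s \<in> Lp N 2"
  shows "partial_integral N s k \<in> Lp M 2"
    and "L2_norm M (partial_integral N s k) \<le> L2_norm N s * L2_norm (M \<Otimes>\<^sub>M N) k"
proof -
  have [measurable]: "k \<in> borel_measurable (M \<Otimes>\<^sub>M N)" "s \<in> borel_measurable N"
    using k s by (simp_all add: L2_iff)
  let ?p = "partial_integral N s k"
  let ?q = "\<lambda>x. L2_inner N (\<lambda>y. k (x, y)) (\<lambda>y. k (x, y))"
  note q = L2_inner_sections[OF k k]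
  have le: "AE x in M. ?p x \<bullet> ?p x \<le> L2_inner N s s * ?q x"
    using L2_section[OF k]
  proof eventually_elim
    case (elim x)
    note n = L2_norm_of[OF s] L2_norm_of[OF elim]
    have "norm (?p x) \<le> (LINT y|N. norm (s y *\<^sub>R k (x, y)))"
      unfolding partial_integral_def by (rule integral_norm_bound)
    also have "\<dots> = L2_inner N (\<lambda>y. norm (s y)) (\<lambda>y. norm (k (x, y)))"
      by (simp add: L2_inner_def)
    finally have "(norm (?p x))\<^sup>2 \<le> (L2_inner N (\<lambda>y. norm (s y)) (\<lambda>y. norm (k (x, y))))\<^sup>2"
      by (intro power_mono) auto
    also have "\<dots> \<le> L2_inner N s s * ?q x"
      using L2.Cauchy_Schwarz[OF n] by (simp only: L2_inner_norm)
    finally show ?case by (simp add: dot_square_norm)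
  qed
  have int: "integrable M (\<lambda>x. ?p x \<bullet> ?p x)"
  proof (rule Bochner_Integration.integrable_bound)
    show "integrable M (\<lambda>x. L2_inner N s s * ?q x)" using q(1) by simp
    show "AE x in M. norm (?p x \<bullet> ?p x) \<le> norm (L2_inner N s s * ?q x)"
      using le by eventually_elim simp
  qed simp
  then show "?p \<in> Lp M 2" by (simp add: L2_iff)
  have "L2_inner M ?p ?p \<le> (LINT x|M. L2_inner N s s * ?q x)"
    unfolding L2_inner_def[of M] by (rule integral_mono_AE[OF int]) (use q(1) le in auto)
  also have "\<dots> = L2_inner N s s * L2_inner (M \<Otimes>\<^sub>M N) k k" using q(2) by simp
  finally show "L2_norm M ?p \<le> L2_norm N s * L2_norm (M \<Otimes>\<^sub>M N) k"
    unfolding L2.nrm_def using real_sqrt_le_mono by (fastforce simp: real_sqrt_mult)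
qed

lemma inner_partial_integral:
  fixes k :: "'x \<times> 'y \<Rightarrow> 'c::euclidean_space"
  assumes a: "a \<in> Lp M 2" and k: "k \<in> Lp (M \<Otimes>\<^sub>M N) 2" and s: "s \<in> Lp N 2"
  shows "L2_inner (M \<Otimes>\<^sub>M N) (vtensor a s) k = L2_inner M a (partial_integral N s k)"
proof -
  have [measurable]: "k \<in> borel_measurable (M \<Otimes>\<^sub>M N)" "s \<in> borel_measurable N" "a \<in> borel_measurable M"
    using k s a by (simp_all add: L2_iff)
  have "L2_inner (M \<Otimes>\<^sub>M N) (vtensor a s) k
    = (LINT x|M. L2_inner N (\<lambda>y. vtensor a s (x, y)) (\<lambda>y. k (x, y)))"
    by (rule L2_inner_sections(2)[OF vtensor_L2[OF a s] k])
  also have "\<dots> = (LINT x|M. a x \<bullet> partial_integral N s k x)"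
  proof (rule integral_cong_AE)
    show "(\<lambda>x. L2_inner N (\<lambda>y. vtensor a s (x, y)) (\<lambda>y. k (x, y))) \<in> borel_measurable M"
      using L2_inner_sections(1)[OF vtensor_L2[OF a s] k] by simp
    show "AE x in M. L2_inner N (\<lambda>y. vtensor a s (x, y)) (\<lambda>y. k (x, y)) = a x \<bullet> partial_integral N s k x"
      using L2_section[OF k]
    proof eventually_elim
      case (elim x)
      have "integrable N (\<lambda>y. norm (s y) \<bullet> norm (k (x, y)))"
        by (intro L2_integrable_inner L2_norm_of s elim)
      then have "integrable N (\<lambda>y. norm (s y *\<^sub>R k (x, y)))" by simp
      moreover have "(\<lambda>y. k (x, y)) \<in> borel_measurable N" using elim by (simp add: L2_iff)
      ultimately have "integrable N (\<lambda>y. s y *\<^sub>R k (x, y))"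
        by (subst (asm) integrable_norm_iff) auto
      from integral_inner_right[OF this, of "a x"] show ?case
        by (simp add: L2_inner_def vtensor_def partial_integral_def)
    qed
  qed simp
  finally show ?thesis by (simp add: L2_inner_def)
qed

lemma partial_integral_diff:
  fixes k :: "'x \<times> 'y \<Rightarrow> 'c::euclidean_space"
  assumes k: "k \<in> Lp (M \<Otimes>\<^sub>M N) 2" and l: "l \<in> Lp (M \<Otimes>\<^sub>M N) 2" and s: "s \<in> Lp N 2"
  shows "AE x in M. partial_integral N s (\<lambda>z. k z - l z) x
    = partial_integral N s k x - partial_integral N s l x"
proof -
  have *: "integrable N (\<lambda>y. s y *\<^sub>R f y)" if f: "f \<in> Lp N 2" for f :: "'y \<Rightarrow> 'c"
  proof -
    have "integrable N (\<lambda>y. norm (s y) \<bullet> norm (f y))"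
      by (intro L2_integrable_inner L2_norm_of s f)
    then have "integrable N (\<lambda>y. norm (s y *\<^sub>R f y))" by simp
    then show ?thesis
      using f s by (subst (asm) integrable_norm_iff) (auto simp: L2_iff)
  qed
  show ?thesis
    using L2_section[OF k] L2_section[OF l]
  proof eventually_elim
    case (elim x)
    from *[OF elim(1)] *[OF elim(2)] show ?case
      by (simp add: partial_integral_def scaleR_diff_right)
  qed
qed

lemma partial_integral_tendsto:
  fixes k :: "nat \<Rightarrow> 'x \<times> 'y \<Rightarrow> 'c::euclidean_space"
  assumes k: "\<And>n. k n \<in> Lp (M \<Otimes>\<^sub>M N) 2" and l: "l \<in> Lp (M \<Otimes>\<^sub>M N) 2" and s: "s \<in> Lp N 2"
    and lim: "L2_tendsto (M \<Otimes>\<^sub>M N) k l"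
  shows "L2_tendsto M (\<lambda>n. partial_integral N s (k n)) (partial_integral N s l)"
proof (rule Lim_null_comparison)
  note pL = partial_integral_L2(1)[OF _ s]
  have "norm (L2_norm M (\<lambda>x. partial_integral N s (k n) x - partial_integral N s l x))
    \<le> L2_norm N s * L2_norm (M \<Otimes>\<^sub>M N) (\<lambda>z. k n z - l z)" for n
  proof -
    have d: "(\<lambda>z. k n z - l z) \<in> Lp (M \<Otimes>\<^sub>M N) 2" using k l by (rule L2.diff_closed)
    note e = L2.diff_closed[OF pL[OF k[of n]] pL[OF l]]
    have "L2_norm M (\<lambda>x. partial_integral N s (k n) x - partial_integral N s l x)
      = L2_norm M (partial_integral N s (\<lambda>z. k n z - l z))"
      by (rule L2_norm_cong_AE)
        (use partial_integral_diff[OF k l s, of n] e pL[OF d] in \<open>auto simp: L2_iff elim!: eventually_mono\<close>)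
    then show ?thesis
      using partial_integral_L2(2)[OF d s] L2.nrm_nonneg[OF e] by simp
  qed
  then show "\<forall>\<^sub>F n in sequentially. norm (L2_norm M (\<lambda>x. partial_integral N s (k n) x - partial_integral N s l x))
    \<le> L2_norm N s * L2_norm (M \<Otimes>\<^sub>M N) (\<lambda>z. k n z - l z)" by simp
  show "(\<lambda>n. L2_norm N s * L2_norm (M \<Otimes>\<^sub>M N) (\<lambda>z. k n z - l z)) \<longlonglongrightarrow> 0"
    using tendsto_mult_right_zero[OF lim] .
qed

text \<open>Expansion of \<open>k\<close> in an orthonormal family of functions of the second variable only; the
  coefficients are functions of the first variable. The proof is that of the scalar identity,
  with inner products of tensors in place of products of coefficients.\<close>

lemma partial_Bessel_identity:
  fixes k :: "'x \<times> 'y \<Rightarrow> 'c::euclidean_space"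
  assumes e: "L2.orthonormal N A e" "finite A" and k: "k \<in> Lp (M \<Otimes>\<^sub>M N) 2"
  defines "r \<equiv> \<lambda>z. k z - (\<Sum>i\<in>A. vtensor (partial_integral N (e i) k) (e i) z)"
  shows "r \<in> Lp (M \<Otimes>\<^sub>M N) 2"
    and "L2_inner (M \<Otimes>\<^sub>M N) r r = L2_inner (M \<Otimes>\<^sub>M N) k k
      - (\<Sum>i\<in>A. L2_inner M (partial_integral N (e i) k) (partial_integral N (e i) k))"
proof -
  let ?p = "\<lambda>i. partial_integral N (e i) k"
  let ?t = "\<lambda>i. vtensor (?p i) (e i)"
  have eL: "\<And>i. i \<in> A \<Longrightarrow> e i \<in> Lp N 2"
    and ee: "\<And>i j. i \<in> A \<Longrightarrow> j \<in> A \<Longrightarrow> L2_inner N (e i) (e j) = (if i = j then 1 else 0)"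
    using e by (auto simp: L2.orthonormal_def)
  have pL: "\<And>i. i \<in> A \<Longrightarrow> ?p i \<in> Lp M 2" using eL k by (intro partial_integral_L2) auto
  have tL: "\<And>i. i \<in> A \<Longrightarrow> ?t i \<in> Lp (M \<Otimes>\<^sub>M N) 2" using eL pL by (intro vtensor_L2) auto
  let ?s = "\<lambda>z. \<Sum>i\<in>A. ?t i z"
  have sL: "?s \<in> Lp (M \<Otimes>\<^sub>M N) 2" using tL by (rule L2.sum_closed)
  show "r \<in> Lp (M \<Otimes>\<^sub>M N) 2" unfolding r_def using k sL by (rule L2.diff_closed)
  let ?S = "\<Sum>i\<in>A. L2_inner M (?p i) (?p i)"
  have sk: "L2_inner (M \<Otimes>\<^sub>M N) ?s k = ?S"
  proof -
    have "L2_inner (M \<Otimes>\<^sub>M N) ?s k = (\<Sum>i\<in>A. L2_inner (M \<Otimes>\<^sub>M N) (?t i) k)"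
      using tL k by (rule L2.sum_left)
    also have "\<dots> = ?S"
      using eL pL k by (intro sum.cong refl inner_partial_integral) auto
    finally show ?thesis .
  qed
  have "L2_inner (M \<Otimes>\<^sub>M N) ?s ?s = (\<Sum>i\<in>A. L2_inner (M \<Otimes>\<^sub>M N) (?t i) ?s)"
    using tL sL by (rule L2.sum_left)
  also have "\<dots> = (\<Sum>i\<in>A. \<Sum>j\<in>A. L2_inner (M \<Otimes>\<^sub>M N) (?t i) (?t j))"
    using tL by (intro sum.cong refl L2.sum_right) auto
  also have "\<dots> = (\<Sum>i\<in>A. \<Sum>j\<in>A. if j = i then L2_inner M (?p i) (?p i) else 0)"
    using eL pL by (intro sum.cong refl) (auto simp: inner_vtensor ee)
  also have "\<dots> = ?S" using e(2) by simp
  finally have ss: "L2_inner (M \<Otimes>\<^sub>M N) ?s ?s = ?S" .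
  have "L2_inner (M \<Otimes>\<^sub>M N) r r = L2_inner (M \<Otimes>\<^sub>M N) k r - L2_inner (M \<Otimes>\<^sub>M N) ?s r"
    unfolding r_def by (rule L2.diff_left[OF k sL]) (rule L2.diff_closed[OF k sL])
  also have "L2_inner (M \<Otimes>\<^sub>M N) k r = L2_inner (M \<Otimes>\<^sub>M N) k k - L2_inner (M \<Otimes>\<^sub>M N) k ?s"
    unfolding r_def by (rule L2.diff_right[OF k sL k])
  also have "L2_inner (M \<Otimes>\<^sub>M N) ?s r = L2_inner (M \<Otimes>\<^sub>M N) ?s k - L2_inner (M \<Otimes>\<^sub>M N) ?s ?s"
    unfolding r_def by (rule L2.diff_right[OF k sL sL])
  finally show "L2_inner (M \<Otimes>\<^sub>M N) r r = L2_inner (M \<Otimes>\<^sub>M N) k k - ?S"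
    using sk ss L2.sym[of "M \<Otimes>\<^sub>M N" k ?s] by simp
qed

lemma partial_Bessel:
  fixes k :: "'x \<times> 'y \<Rightarrow> 'c::euclidean_space"
  assumes e: "L2.orthonormal N A e" "finite A" and k: "k \<in> Lp (M \<Otimes>\<^sub>M N) 2"
  shows "(\<Sum>i\<in>A. L2_inner M (partial_integral N (e i) k) (partial_integral N (e i) k))
    \<le> L2_inner (M \<Otimes>\<^sub>M N) k k"
  using partial_Bessel_identity(2)[OF e k] L2.nonneg[OF partial_Bessel_identity(1)[OF e k]] by simp

text \<open>For fixed \<open>y\<close> a finite sum of tensors is a linear combination of the \<open>a i\<close>. An inequality between
  quadratic forms in the coefficients can therefore be applied in each slice and integrated; this is
  how estimates on one factor are carried over to the product.\<close>

lemma inner_sum_vtensor: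
  fixes a :: "'i \<Rightarrow> 'x \<Rightarrow> 'c::euclidean_space"
  assumes a: "\<And>i. i \<in> A \<Longrightarrow> a i \<in> Lp M 2" and v: "\<And>i. i \<in> A \<Longrightarrow> v i \<in> Lp N 2"
  shows "integrable N (\<lambda>y. L2_inner M (\<lambda>x. \<Sum>i\<in>A. v i y *\<^sub>R a i x) (\<lambda>x. \<Sum>i\<in>A. v i y *\<^sub>R a i x))"
    and "L2_inner (M \<Otimes>\<^sub>M N) (\<lambda>z. \<Sum>i\<in>A. vtensor (a i) (v i) z) (\<lambda>z. \<Sum>i\<in>A. vtensor (a i) (v i) z)
      = (LINT y|N. L2_inner M (\<lambda>x. \<Sum>i\<in>A. v i y *\<^sub>R a i x) (\<lambda>x. \<Sum>i\<in>A. v i y *\<^sub>R a i x))"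
proof -
  have eq: "L2_inner M (\<lambda>x. \<Sum>i\<in>A. v i y *\<^sub>R a i x) (\<lambda>x. \<Sum>i\<in>A. v i y *\<^sub>R a i x)
    = (\<Sum>i\<in>A. \<Sum>j\<in>A. L2_inner M (a i) (a j) * (v i y \<bullet> v j y))" for y
  proof -
    have sc: "\<And>i. i \<in> A \<Longrightarrow> (\<lambda>x. v i y *\<^sub>R a i x) \<in> Lp M 2" using a by (intro L2.scale_closed)
    have "L2_inner M (\<lambda>x. \<Sum>i\<in>A. v i y *\<^sub>R a i x) (\<lambda>x. \<Sum>i\<in>A. v i y *\<^sub>R a i x)
      = (\<Sum>i\<in>A. \<Sum>j\<in>A. L2_inner M (\<lambda>x. v i y *\<^sub>R a i x) (\<lambda>x. v j y *\<^sub>R a j x))"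
      using sc by (subst L2.sum_left) (auto intro!: sum.cong L2.sum_right L2.sum_closed)
    also have "\<dots> = (\<Sum>i\<in>A. \<Sum>j\<in>A. L2_inner M (a i) (a j) * (v i y \<bullet> v j y))"
      using a sc by (intro sum.cong refl) (simp add: L2.scale_left L2.scale_right)
    finally show ?thesis .
  qed
  have int: "integrable N (\<lambda>y. \<Sum>i\<in>A. \<Sum>j\<in>A. L2_inner M (a i) (a j) * (v i y \<bullet> v j y))"
    using v by (intro Bochner_Integration.integrable_sum integrable_mult_right L2_integrable_inner)
  then show "integrable N (\<lambda>y. L2_inner M (\<lambda>x. \<Sum>i\<in>A. v i y *\<^sub>R a i x) (\<lambda>x. \<Sum>i\<in>A. v i y *\<^sub>R a i x))"
    unfolding eq .
  have t: "\<And>i. i \<in> A \<Longrightarrow> vtensor (a i) (v i) \<in> Lp (M \<Otimes>\<^sub>M N) 2" using a v by (intro vtensor_L2)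
  have "L2_inner (M \<Otimes>\<^sub>M N) (\<lambda>z. \<Sum>i\<in>A. vtensor (a i) (v i) z) (\<lambda>z. \<Sum>i\<in>A. vtensor (a i) (v i) z)
    = (\<Sum>i\<in>A. \<Sum>j\<in>A. L2_inner (M \<Otimes>\<^sub>M N) (vtensor (a i) (v i)) (vtensor (a j) (v j)))"
    using t by (subst L2.sum_left) (auto intro!: sum.cong L2.sum_right L2.sum_closed)
  also have "\<dots> = (\<Sum>i\<in>A. \<Sum>j\<in>A. L2_inner M (a i) (a j) * (LINT y|N. v i y \<bullet> v j y))"
    using a v by (intro sum.cong refl) (simp add: inner_vtensor, simp add: L2_inner_def)
  also have "\<dots> = (LINT y|N. (\<Sum>i\<in>A. \<Sum>j\<in>A. L2_inner M (a i) (a j) * (v i y \<bullet> v j y)))"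
  proof -
    note int = integrable_mult_right[OF L2_integrable_inner[OF v v]]
    have "(\<Sum>i\<in>A. \<Sum>j\<in>A. L2_inner M (a i) (a j) * (LINT y|N. v i y \<bullet> v j y))
      = (\<Sum>i\<in>A. \<Sum>j\<in>A. LINT y|N. L2_inner M (a i) (a j) * (v i y \<bullet> v j y))"
      by simp
    also have "\<dots> = (\<Sum>i\<in>A. LINT y|N. (\<Sum>j\<in>A. L2_inner M (a i) (a j) * (v i y \<bullet> v j y)))"
      by (intro sum.cong refl Bochner_Integration.integral_sum[symmetric] int)
    also have "\<dots> = (LINT y|N. (\<Sum>i\<in>A. \<Sum>j\<in>A. L2_inner M (a i) (a j) * (v i y \<bullet> v j y)))"
      by (intro Bochner_Integration.integral_sum[symmetric] Bochner_Integration.integrable_sum int)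
    finally show ?thesis .
  qed
  finally show "L2_inner (M \<Otimes>\<^sub>M N) (\<lambda>z. \<Sum>i\<in>A. vtensor (a i) (v i) z) (\<lambda>z. \<Sum>i\<in>A. vtensor (a i) (v i) z)
      = (LINT y|N. L2_inner M (\<lambda>x. \<Sum>i\<in>A. v i y *\<^sub>R a i x) (\<lambda>x. \<Sum>i\<in>A. v i y *\<^sub>R a i x))"
    unfolding eq .
qed

lemma L2_swap:
  assumes "k \<in> Lp (M \<Otimes>\<^sub>M N) 2"
  shows "(\<lambda>z. k (prod.swap z)) \<in> Lp (N \<Otimes>\<^sub>M M) 2"
proof -
  have [measurable]: "k \<in> borel_measurable (M \<Otimes>\<^sub>M N)" using assms by (simp add: L2_iff)
  have "integrable (N \<Otimes>\<^sub>M M) (\<lambda>(x, y). k (y, x) \<bullet> k (y, x))"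
    using integrable_product_swap[of "\<lambda>z. k z \<bullet> k z"] assms by (simp add: L2_iff)
  moreover have "(\<lambda>z. k (prod.swap z)) \<in> borel_measurable (N \<Otimes>\<^sub>M M)"
    unfolding prod.swap_def by measurable
  ultimately show ?thesis by (simp add: L2_iff prod.swap_def case_prod_beta')
qed

lemma L2_inner_swap:
  assumes "k \<in> Lp (M \<Otimes>\<^sub>M N) 2" "l \<in> Lp (M \<Otimes>\<^sub>M N) 2"
  shows "L2_inner (N \<Otimes>\<^sub>M M) (\<lambda>z. k (prod.swap z)) (\<lambda>z. l (prod.swap z)) = L2_inner (M \<Otimes>\<^sub>M N) k l"
proof -
  have "(\<lambda>z. k z \<bullet> l z) \<in> borel_measurable (M \<Otimes>\<^sub>M N)"
    using L2_integrable_inner[OF assms] by simp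
  from integral_product_swap[OF this] show ?thesis
    by (simp add: L2_inner_def prod.swap_def case_prod_beta')
qed

lemma L2_norm_swap:
  assumes "k \<in> Lp (M \<Otimes>\<^sub>M N) 2"
  shows "L2_norm (N \<Otimes>\<^sub>M M) (\<lambda>z. k (prod.swap z)) = L2_norm (M \<Otimes>\<^sub>M N) k"
  using L2_inner_swap[OF assms assms] by (simp add: L2.nrm_def)

text \<open>The expansion is Cauchy because the square norms of the coefficients are summable by Bessel's
  inequality. The difference between its limit and \<open>k\<close> has vanishing coefficients, so
  completeness of the basis makes almost every slice of the difference vanish.\<close>

lemma partial_expansion_tendsto:
  fixes k :: "'x \<times> 'y \<Rightarrow> 'c::euclidean_space" and e :: "nat \<Rightarrow> 'y \<Rightarrow> real"
  assumes e: "L2.orthonormal N UNIV e"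
    and complete: "\<And>f. f \<in> Lp N 2 \<Longrightarrow> (\<And>j. L2_inner N (e j) f = 0) \<Longrightarrow> AE y in N. f y = 0"
    and k: "k \<in> Lp (M \<Otimes>\<^sub>M N) 2"
  shows "L2_tendsto (M \<Otimes>\<^sub>M N) (\<lambda>n z. \<Sum>j<n. vtensor (partial_integral N (e j) k) (e j) z) k"
proof -
  let ?p = "\<lambda>j. partial_integral N (e j) k"
  let ?Q = "\<lambda>n z. \<Sum>j<n. vtensor (?p j) (e j) z"
  let ?P = "M \<Otimes>\<^sub>M N"
  have on: "L2.orthonormal N A e" for A using e by (auto simp: L2.orthonormal_def)
  have eL: "e j \<in> Lp N 2" for j using e by (auto simp: L2.orthonormal_def)
  have ee: "L2_inner N (e i) (e j) = (if i = j then 1 else 0)" for i j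
    using e by (auto simp: L2.orthonormal_def)
  have pL: "?p j \<in> Lp M 2" for j using k eL by (rule partial_integral_L2)
  have tL: "vtensor (?p j) (e j) \<in> Lp ?P 2" for j using pL eL by (rule vtensor_L2)
  have QL: "?Q n \<in> Lp ?P 2" for n by (rule L2.sum_closed[OF tL])
  define c where "c = (\<lambda>j. L2_inner M (?p j) (?p j))"
  have c0: "c j \<ge> 0" for j unfolding c_def using pL by (rule L2.nonneg)
  have "sum c {..<n} \<le> L2_inner ?P k k" for n
    unfolding c_def by (rule partial_Bessel[OF on _ k]) simp
  then have sc: "summable c" by (rule summableI_nonneg_bounded[OF c0])
  have diff: "(L2_norm ?P (\<lambda>z. ?Q m z - ?Q n z))\<^sup>2 = sum c {n..<m}" if "n \<le> m" for m n
  proof -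
    have eq: "(\<lambda>z. ?Q m z - ?Q n z) = (\<lambda>z. \<Sum>j\<in>{n..<m}. vtensor (?p j) (e j) z)"
      using sum_diff_nat_ivl[of 0 n m] that by (auto simp: atLeast0LessThan)
    have "L2_inner ?P (\<lambda>z. \<Sum>j\<in>{n..<m}. vtensor (?p j) (e j) z) (\<lambda>z. \<Sum>j\<in>{n..<m}. vtensor (?p j) (e j) z)
      = (\<Sum>i\<in>{n..<m}. \<Sum>j\<in>{n..<m}. L2_inner ?P (vtensor (?p i) (e i)) (vtensor (?p j) (e j)))"
      using tL by (subst L2.sum_left) (auto intro!: sum.cong L2.sum_right L2.sum_closed)
    also have "\<dots> = (\<Sum>i\<in>{n..<m}. \<Sum>j\<in>{n..<m}. if j = i then c i else 0)"
      by (intro sum.cong refl) (auto simp: inner_vtensor pL eL ee c_def)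
    also have "\<dots> = sum c {n..<m}" by simp
    finally show ?thesis
      unfolding eq using L2.nrm_sq[OF L2.sum_closed[of "{n..<m}", OF tL]] by simp
  qed
  have cauchy: "\<exists>N. \<forall>m\<ge>N. \<forall>n\<ge>N. L2_norm ?P (\<lambda>z. ?Q m z - ?Q n z) < \<epsilon>" if pos: "\<epsilon> > 0" for \<epsilon>
  proof (rule Cauchy_if_summable_bound[OF sc _ c0 _ _ pos])
    show "(0::real) \<le> 1" by simp
    show "(L2_norm ?P (\<lambda>z. ?Q m z - ?Q n z))\<^sup>2 \<le> 1 * sum c {n..<m}" if "n \<le> m" for m n
      using diff[OF that] by simp
    show "L2_norm ?P (\<lambda>z. ?Q m z - ?Q n z) = L2_norm ?P (\<lambda>z. ?Q n z - ?Q m z)" for m n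
      by (rule L2.nrm_minus_commute[OF QL QL])
  qed
  obtain K where K: "K \<in> Lp ?P 2" "L2_tendsto ?P ?Q K"
    using L2_complete[OF finite_MN QL cauchy] by blast
  have p0: "AE x in M. partial_integral N (e j) K x = ?p j x" for j
  proof (rule L2_limit_unique)
    show "\<And>n. partial_integral N (e j) (?Q n) \<in> Lp M 2" by (rule partial_integral_L2(1)[OF QL eL])
    show "partial_integral N (e j) K \<in> Lp M 2" by (rule partial_integral_L2(1)[OF K(1) eL])
    show "L2_tendsto M (\<lambda>n. partial_integral N (e j) (?Q n)) (partial_integral N (e j) K)"
      by (rule partial_integral_tendsto[OF QL K(1) eL K(2)])
    have "partial_integral N (e j) (?Q n) x = ?p j x" if "n > j" for n x
    proof -
      have int: "integrable N (\<lambda>y. e j y * e i y)" for i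
        using L2_integrable_inner[OF eL eL] by simp
      have "partial_integral N (e j) (?Q n) x = (LINT y|N. (\<Sum>i<n. (e j y * e i y) *\<^sub>R ?p i x))"
        by (subst (1) partial_integral_def) (simp add: vtensor_def scaleR_sum_right)
      also have "\<dots> = (\<Sum>i<n. L2_inner N (e j) (e i) *\<^sub>R ?p i x)"
        using int by (simp add: Bochner_Integration.integral_sum L2_inner_def)
      also have "\<dots> = (\<Sum>i<n. if i = j then ?p j x else 0)"
        by (intro sum.cong) (auto simp: ee)
      finally show ?thesis using that by simp
    qed
    then have "\<forall>\<^sub>F n in sequentially. L2_norm M (\<lambda>x. partial_integral N (e j) (?Q n) x - ?p j x) = 0"
      by (intro eventually_sequentiallyI[of "Suc j"]) (simp add: L2.nrm_def L2_inner_def)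
    then show "L2_tendsto M (\<lambda>n. partial_integral N (e j) (?Q n)) (?p j)"
      by (rule tendsto_eventually)
  qed (rule pL)
  define d where "d = (\<lambda>z. K z - k z)"
  have dL: "d \<in> Lp ?P 2" unfolding d_def using K(1) k by (rule L2.diff_closed)
  have pd: "AE x in M. \<forall>j. partial_integral N (e j) d x = 0"
    unfolding AE_all_countable
  proof
    fix j show "AE x in M. partial_integral N (e j) d x = 0"
      using partial_integral_diff[OF K(1) k eL[of j]] p0[of j] by eventually_elim (simp add: d_def)
  qed
  have [measurable]: "d \<in> borel_measurable ?P" using dL by (simp add: L2_iff)
  have "AE x in M. AE y in N. d (x, y) = 0"
    using pd L2_section[OF dL]
  proof eventually_elim
    case (elim x)
    have [measurable]: "(\<lambda>y. d (x, y)) \<in> borel_measurable N" using elim by (simp add: L2_iff)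
    have "AE y in N. d (x, y) \<bullet> i = 0" if i: "i \<in> Basis" for i
    proof (rule complete)
      have "integrable N (\<lambda>y. (d (x, y) \<bullet> i) * (d (x, y) \<bullet> i))"
      proof (rule Bochner_Integration.integrable_bound)
        show "integrable N (\<lambda>y. d (x, y) \<bullet> d (x, y))" using elim by (simp add: L2_iff)
        show "AE y in N. norm ((d (x, y) \<bullet> i) * (d (x, y) \<bullet> i)) \<le> norm (d (x, y) \<bullet> d (x, y))"
        proof (rule AE_I2)
          fix y
          have "(d (x, y) \<bullet> i) * (d (x, y) \<bullet> i) \<le> (d (x, y) \<bullet> d (x, y)) * (i \<bullet> i)"
            using Cauchy_Schwarz_ineq[of "d (x, y)" i] by (simp add: power2_eq_square)
          then show "norm ((d (x, y) \<bullet> i) * (d (x, y) \<bullet> i)) \<le> norm (d (x, y) \<bullet> d (x, y))"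
            using i by (simp add: inner_Basis)
        qed
      qed measurable
      then show "(\<lambda>y. d (x, y) \<bullet> i) \<in> Lp N 2" by (simp add: L2_iff)
      fix j
      have n: "integrable N (\<lambda>y. norm (e j y) \<bullet> norm (d (x, y)))"
        by (intro L2_integrable_inner L2_norm_of eL elim)
      then have "integrable N (\<lambda>y. e j y *\<^sub>R d (x, y))"
        using eL[of j] by (subst integrable_norm_iff[symmetric]) (auto simp: L2_iff)
      from integral_inner_left[OF this, of i] elim
      show "L2_inner N (e j) (\<lambda>y. d (x, y) \<bullet> i) = 0"
        by (simp add: L2_inner_def partial_integral_def)
    qed
    then have "AE y in N. \<forall>i\<in>Basis. d (x, y) \<bullet> i = 0"
      by (intro AE_finite_allI) auto
    then show ?case
      by eventually_elim (simp add: euclidean_all_zero_iff)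
  qed
  then have dz: "AE z in ?P. d z = 0"
    by (rule AE_pair_measure[rotated]) measurable
  have "L2_norm ?P (\<lambda>z. ?Q n z - k z) = L2_norm ?P (\<lambda>z. ?Q n z - K z)" for n
    by (rule L2_norm_cong_AE)
      (use dz QL[of n] K(1) k in \<open>auto simp: d_def L2_iff elim!: eventually_mono\<close>)
  with K(2) show ?thesis by simp
qed

lemma L2_inner_sections_snd:
  assumes "k \<in> Lp (M \<Otimes>\<^sub>M N) 2" "l \<in> Lp (M \<Otimes>\<^sub>M N) 2"
  shows "L2_inner (M \<Otimes>\<^sub>M N) k l = (LINT y|N. L2_inner M (\<lambda>x. k (x, y)) (\<lambda>x. l (x, y)))"
  using integral_snd[of "\<lambda>x y. k (x, y) \<bullet> l (x, y)"] L2_integrable_inner[OF assms]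
  by (simp add: L2_inner_def case_prod_beta')

lemma inner_partial_integral_swap:
  fixes k :: "'x \<times> 'y \<Rightarrow> real"
  assumes "a \<in> Lp M 2" "k \<in> Lp (M \<Otimes>\<^sub>M N) 2" "s \<in> Lp N 2"
  shows "L2_inner N s (partial_integral M a (\<lambda>z. k (prod.swap z))) = L2_inner (M \<Otimes>\<^sub>M N) (vtensor a s) k"
proof -
  interpret Q: finite_pair N M by (rule swap_pair)
  have "L2_inner N s (partial_integral M a (\<lambda>z. k (prod.swap z)))
    = L2_inner (N \<Otimes>\<^sub>M M) (vtensor s a) (\<lambda>z. k (prod.swap z))"
    by (rule Q.inner_partial_integral[symmetric]) (use assms L2_swap in auto)
  also have "vtensor s a = (\<lambda>z. vtensor a s (prod.swap z))"
    by (auto simp: vtensor_def)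
  finally show ?thesis using L2_inner_swap[OF vtensor_L2[OF assms(1,3)] assms(2)] by simp
qed

lemma vtensor_swap_L2:
  assumes "a \<in> Lp M 2" "v \<in> Lp N 2"
  shows "(\<lambda>z. a (fst z) *\<^sub>R v (snd z)) \<in> Lp (M \<Otimes>\<^sub>M N) 2"
proof -
  interpret Q: finite_pair N M by (rule swap_pair)
  show ?thesis using Q.L2_swap[OF Q.vtensor_L2[OF assms(2,1)]] by (simp add: vtensor_def)
qed

lemma vtensor_swap_tendsto:
  assumes a: "\<And>n. a n \<in> Lp M 2" "a' \<in> Lp M 2" "L2_tendsto M a a'"
    and v: "\<And>n. v n \<in> Lp N 2" "v' \<in> Lp N 2" "L2_tendsto N v v'"
  shows "L2_tendsto (M \<Otimes>\<^sub>M N) (\<lambda>n z. a n (fst z) *\<^sub>R v n (snd z)) (\<lambda>z. a' (fst z) *\<^sub>R v' (snd z))"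
proof -
  interpret Q: finite_pair N M by (rule swap_pair)
  have "L2_norm (M \<Otimes>\<^sub>M N) (\<lambda>z. a n (fst z) *\<^sub>R v n (snd z) - a' (fst z) *\<^sub>R v' (snd z))
    = L2_norm (N \<Otimes>\<^sub>M M) (\<lambda>z. vtensor (v n) (a n) z - vtensor v' a' z)" for n
    using Q.L2_norm_swap[OF L2.diff_closed[OF Q.vtensor_L2[OF v(1) a(1)] Q.vtensor_L2[OF v(2) a(2)], of n n]]
    by (simp add: vtensor_def)
  then show ?thesis using Q.vtensor_tendsto[OF v a] by simp
qed

text \<open>The hypothesis says that \<open>d\<close> integrates to zero over all rectangles, which generate the product
  sigma-algebra.\<close>

lemma L2_zero_if_partial_integrals_zero:
  fixes d :: "'x \<times> 'y \<Rightarrow> real"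
  assumes d: "d \<in> Lp (M \<Otimes>\<^sub>M N) 2"
    and zero: "\<And>B. B \<in> sets N \<Longrightarrow> AE x in M. partial_integral N (indicator B) d x = 0"
  shows "AE z in M \<Otimes>\<^sub>M N. d z = 0"
proof -
  let ?P = "M \<Otimes>\<^sub>M N"
  have int: "integrable ?P d" by (rule L2_integral_norm_le(1)[OF finite_MN d])
  have ind: "(indicator A :: 'z \<Rightarrow> real) \<in> Lp K 2" if "finite_measure K" "A \<in> sets K" for A and K :: "'z measure"
    by (rule L2_bounded[OF that(1), of _ 1]) (use that(2) in \<open>auto simp: indicator_def\<close>)
  have rect: "(LINT z:A \<times> B|?P. d z) = 0" if A: "A \<in> sets M" and B: "B \<in> sets N" for A B
  proof -
    note iA = ind[OF M.finite_measure_axioms A] and iB = ind[OF N.finite_measure_axioms B]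
    have "(LINT z:A \<times> B|?P. d z) = L2_inner ?P (vtensor (indicator A) (indicator B)) d"
      unfolding L2_inner_def set_lebesgue_integral_def vtensor_def
      by (intro Bochner_Integration.integral_cong) (auto simp: indicator_def)
    also have "\<dots> = L2_inner M (indicator A) (partial_integral N (indicator B) d)"
      by (rule inner_partial_integral[OF iA d iB])
    also have "\<dots> = L2_inner M (indicator A) (\<lambda>_. 0 :: real)"
      by (intro L2_cong_AE zero[OF B]) (use iA partial_integral_L2(1)[OF d iB] in \<open>auto simp: L2_iff\<close>)
    finally show ?thesis by (simp add: L2_inner_def)
  qed
  show ?thesis
  proof (rule AE_zero_if_integral_zero_on_generator[OF int Int_stable_pair_measure_generator[of M N]])
    show "{a \<times> b |a b. a \<in> sets M \<and> b \<in> sets N} \<subseteq> Pow (space ?P)"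
      using sets.space_closed[of M] sets.space_closed[of N] by (auto simp: space_pair_measure)
    show "sets ?P = sigma_sets (space ?P) {a \<times> b |a b. a \<in> sets M \<and> b \<in> sets N}"
      by (simp add: sets_pair_measure space_pair_measure)
    show "(LINT z|?P. d z) = 0"
      using rect[of "space M" "space N"] set_integral_space[OF int] by (simp add: space_pair_measure)
  qed (use rect in auto)
qed

end

section \<open>Smooth functions of compact support\<close>

lemma frechet_derivative_eqI: "(f has_derivative f') (at x) \<Longrightarrow> frechet_derivative f (at x) = f'"
  using frechet_derivative_at by metis

lemma Ck_const: "Ck k (\<lambda>_. c)"
  by (induction k arbitrary: c) (auto simp: frechet_derivative_const)

lemma Ck_Suc_imp: "Ck (Suc k) f \<Longrightarrow> Ck k f"
proof (induction k arbitrary: f)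
  case 0
  then show ?case
    by (auto simp: continuous_on_eq_continuous_at intro: differentiable_imp_continuous_within)
next
  case (Suc k)
  then show ?case by (subst Ck.simps(2)) (subst (asm) (2) Ck.simps(2), auto)
qed

lemma Ck_add: "Ck k f \<Longrightarrow> Ck k g \<Longrightarrow> Ck k (\<lambda>x. f x + g x)"
proof (induction k arbitrary: f g)
  case 0 then show ?case by (auto intro: continuous_on_add)
next
  case (Suc k)
  have "frechet_derivative (\<lambda>x. f x + g x) (at x)
    = (\<lambda>h. frechet_derivative f (at x) h + frechet_derivative g (at x) h)" for x
    using Suc.prems
    by (intro frechet_derivative_eqI has_derivative_add) (auto simp: frechet_derivative_works)
  then show ?case using Suc by auto
qed

lemma Ck_mult: "Ck k f \<Longrightarrow> Ck k g \<Longrightarrow> Ck k (\<lambda>x. f x * g x)"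
proof (induction k arbitrary: f g)
  case 0 then show ?case by (auto intro: continuous_on_mult)
next
  case (Suc k)
  have "frechet_derivative (\<lambda>x. f x * g x) (at x)
    = (\<lambda>h. f x * frechet_derivative g (at x) h + frechet_derivative f (at x) h * g x)" for x
    using Suc.prems
    by (intro frechet_derivative_eqI has_derivative_mult) (auto simp: frechet_derivative_works)
  moreover have "Ck k f" "Ck k g" using Suc.prems Ck_Suc_imp by blast+
  ultimately show ?case using Suc by (auto intro!: Ck_add Suc.IH)
qed

lemma Ck_power: "Ck k f \<Longrightarrow> Ck k (\<lambda>x. f x ^ n)"
  by (induction n) (auto intro: Ck_const Ck_mult)

lemma Ck_prod: "(\<And>i. i \<in> A \<Longrightarrow> Ck k (f i)) \<Longrightarrow> Ck k (\<lambda>x. \<Prod>i\<in>A. f i x)"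
  by (induction A rule: infinite_finite_induct) (auto intro: Ck_const Ck_mult)

lemma frechet_derivative_compose_affine:
  fixes f :: "'b::euclidean_space \<Rightarrow> real" and L :: "'a::euclidean_space \<Rightarrow> 'b"
  assumes "f differentiable at (L x + c)" "bounded_linear L"
  shows "(\<lambda>x. f (L x + c)) differentiable at x"
    and "frechet_derivative (\<lambda>x. f (L x + c)) (at x) h = frechet_derivative f (at (L x + c)) (L h)"
proof -
  have "((\<lambda>x. L x + c) has_derivative L) (at x)"
    using bounded_linear.has_derivative[OF assms(2) has_derivative_ident]
    by (auto intro!: derivative_eq_intros)
  from diff_chain_at[OF this, of f] assms(1)
  have *: "((\<lambda>x. f (L x + c)) has_derivative (\<lambda>h. frechet_derivative f (at (L x + c)) (L h))) (at x)"
    by (simp add: frechet_derivative_works o_def)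
  then show "(\<lambda>x. f (L x + c)) differentiable at x" unfolding differentiable_def by blast
  show "frechet_derivative (\<lambda>x. f (L x + c)) (at x) h = frechet_derivative f (at (L x + c)) (L h)"
    using frechet_derivative_eqI[OF *] by simp
qed

text \<open>Only maps that send basis vectors to multiples of basis vectors are considered, so that each
  partial derivative of the composition is a multiple of one partial derivative of \<open>f\<close>. Slices,
  projections, coordinate swaps and translations are all of this form.\<close>

lemma Ck_compose_affine:
  fixes f :: "'b::euclidean_space \<Rightarrow> real" and L :: "'a::euclidean_space \<Rightarrow> 'b"
  assumes L: "bounded_linear L" "\<And>i. i \<in> Basis \<Longrightarrow> \<exists>r. \<exists>j\<in>Basis. L i = r *\<^sub>R j"
  shows "Ck k f \<Longrightarrow> Ck k (\<lambda>x. f (L x + c))"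
proof (induction k arbitrary: f)
  case 0
  have "continuous_on UNIV (\<lambda>x. L x + c)"
    by (intro continuous_intros linear_continuous_on L)
  then show ?case using 0 continuous_on_compose2[of UNIV f UNIV "\<lambda>x. L x + c"] by auto
next
  case (Suc k)
  have d: "f differentiable at z" for z using Suc.prems by simp
  have "Ck k (\<lambda>x. frechet_derivative (\<lambda>x. f (L x + c)) (at x) i)" if i: "i \<in> Basis" for i
  proof -
    obtain r j where rj: "j \<in> Basis" "L i = r *\<^sub>R j" using L(2)[OF i] by blast
    have "frechet_derivative (\<lambda>x. f (L x + c)) (at x) i
      = r * frechet_derivative f (at (L x + c)) j" for x
      using d[of "L x + c"] linear_frechet_derivative[OF d[of "L x + c"]]
      by (simp add: frechet_derivative_compose_affine(2)[OF d L(1)] rj linear_cmul)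
    moreover have "Ck k (\<lambda>x. frechet_derivative f (at (L x + c)) j)"
      using Suc.IH[of "\<lambda>x. frechet_derivative f (at x) j"] Suc.prems rj by simp
    ultimately show ?thesis by (simp add: Ck_mult Ck_const)
  qed
  then show ?case using frechet_derivative_compose_affine(1)[OF d L(1)] by simp
qed

text \<open>\<open>t\<^sup>-\<^sup>n exp (-1/t)\<close> for positive \<open>t\<close>. All \<open>n\<close> are treated together because the family is closed
  under differentiation up to linear combinations, which makes smoothness an easy induction.\<close>

definition flat_exp :: "nat \<Rightarrow> real \<Rightarrow> real" where
  "flat_exp n t = (if t > 0 then (1 / t) ^ n * exp (- (1 / t)) else 0)"

lemma flat_exp_tendsto_0: "flat_exp n \<midarrow>0\<rightarrow> 0"
proof -
  have "((\<lambda>t. (1 / t) ^ n / exp (1 / t)) \<longlongrightarrow> (0::real)) (at_right 0)"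
    using filterlim_compose[OF tendsto_power_div_exp_0 filterlim_inverse_at_top_right]
    by (simp add: inverse_eq_divide)
  then have "(flat_exp n \<longlongrightarrow> 0) (at_right 0)"
    by (rule Lim_transform_eventually)
      (auto simp: eventually_at_right_field flat_exp_def exp_minus divide_inverse intro!: exI[of _ 1])
  moreover have "(flat_exp n \<longlongrightarrow> 0) (at_left 0)"
    by (rule tendsto_eventually) (auto simp: eventually_at_left_field flat_exp_def intro!: exI[of _ "-1"])
  ultimately show ?thesis by (simp add: filterlim_split_at)
qed

text \<open>At the origin the difference quotient of \<open>flat_exp n\<close> is \<open>flat_exp (n + 1)\<close>, which tends to zero.\<close>

lemma flat_exp_deriv:
  "(flat_exp n has_real_derivative flat_exp (n + 2) t - real n * flat_exp (n + 1) t) (at t)"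
proof -
  consider "t < 0" | "t = 0" | "t > 0" by linarith
  then show ?thesis
  proof cases
    case 1
    have "((\<lambda>_. 0) has_real_derivative 0) (at t)" by simp
    then have "(flat_exp n has_real_derivative 0) (at t)"
      by (rule has_field_derivative_transform_within_open[of _ _ _ "{..<0}"])
        (use 1 in \<open>auto simp: flat_exp_def\<close>)
    then show ?thesis using 1 by (simp add: flat_exp_def)
  next
    case 2
    have "(flat_exp n (0 + h) - flat_exp n 0) / h = flat_exp (Suc n) h" for h
      by (simp add: flat_exp_def)
    then have "(flat_exp n has_real_derivative 0) (at 0)"
      unfolding DERIV_def using flat_exp_tendsto_0[of "Suc n"] by simp
    then show ?thesis using 2 by (simp add: flat_exp_def)
  next
    case 3
    have *: "((\<lambda>t. (1 / t) ^ n * exp (- (1 / t))) has_real_derivative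
      (1 / t) ^ (n + 2) * exp (- (1 / t)) - real n * ((1 / t) ^ (n + 1) * exp (- (1 / t)))) (at t)"
    proof (cases n)
      case 0
      then show ?thesis using 3
        by (auto intro!: derivative_eq_intros simp: field_simps power2_eq_square)
    next
      case (Suc m)
      then show ?thesis using 3
        by (auto intro!: derivative_eq_intros simp: divide_simps power2_eq_square)
          (cases m; auto simp: algebra_simps)+
    qed
    have "(flat_exp n has_real_derivative
      (1 / t) ^ (n + 2) * exp (- (1 / t)) - real n * ((1 / t) ^ (n + 1) * exp (- (1 / t)))) (at t)"
      by (rule has_field_derivative_transform_within_open[OF *, of "{0<..}"])
        (use 3 in \<open>auto simp: flat_exp_def\<close>)
    then show ?thesis using 3 by (simp add: flat_exp_def)
  qed
qed

lemma Ck_flat_exp: "Ck k (flat_exp n)"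
proof (induction k arbitrary: n)
  case 0
  show ?case using DERIV_isCont[OF flat_exp_deriv] by (simp add: continuous_at_imp_continuous_on)
next
  case (Suc k)
  have "frechet_derivative (flat_exp n) (at x)
    = (\<lambda>h. (flat_exp (n + 2) x - real n * flat_exp (n + 1) x) * h)" for x
    using flat_exp_deriv[of n x] unfolding has_field_derivative_def by (rule frechet_derivative_eqI)
  then have "Ck k (\<lambda>x. frechet_derivative (flat_exp n) (at x) 1)"
    using Ck_add[OF Suc[of "n + 2"] Ck_mult[OF Ck_const[of k "- real n"] Suc[of "n + 1"]]] by simp
  then show ?case
    using flat_exp_deriv real_differentiable_def by (auto simp: )
qed

definition box_bump :: "'a::euclidean_space \<Rightarrow> 'a \<Rightarrow> 'a \<Rightarrow> real" where
  "box_bump a b x = (\<Prod>i\<in>Basis. flat_exp 0 (x \<bullet> i - a \<bullet> i) * flat_exp 0 (b \<bullet> i - x \<bullet> i))"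

lemma Ck_box_bump: "Ck k (box_bump a b)"
proof -
  have "Ck k (\<lambda>x. flat_exp 0 (x \<bullet> i + (- (a \<bullet> i))) * flat_exp 0 ((- (x \<bullet> i)) + b \<bullet> i))"
    if "i \<in> Basis" for i :: 'a
  proof (rule Ck_mult)
    show "Ck k (\<lambda>x. flat_exp 0 (x \<bullet> i + (- (a \<bullet> i))))"
      by (rule Ck_compose_affine[OF _ _ Ck_flat_exp]) (auto intro: bounded_linear_inner_left)
    show "Ck k (\<lambda>x. flat_exp 0 ((- (x \<bullet> i)) + b \<bullet> i))"
      by (rule Ck_compose_affine[OF _ _ Ck_flat_exp])
        (auto intro: bounded_linear_inner_left bounded_linear_minus)
  qed
  from Ck_prod[of Basis k, OF this] show ?thesis
    by (simp add: box_bump_def[abs_def])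
qed

lemma box_bump_range: "0 \<le> box_bump a b x" "box_bump a b x \<le> 1" "box_bump a b x \<noteq> 0 \<longleftrightarrow> x \<in> box a b"
proof -
  have f: "0 \<le> flat_exp 0 t" "flat_exp 0 t \<le> 1" "flat_exp 0 t \<noteq> 0 \<longleftrightarrow> t > 0" for t
    by (auto simp: flat_exp_def)
  show "0 \<le> box_bump a b x" unfolding box_bump_def by (intro prod_nonneg) (simp add: f)
  show "box_bump a b x \<le> 1" unfolding box_bump_def by (intro prod_le_1) (simp add: f mult_le_one)
  have "box_bump a b x = 0 \<longleftrightarrow> (\<exists>i\<in>Basis. flat_exp 0 (x \<bullet> i - a \<bullet> i) = 0 \<or> flat_exp 0 (b \<bullet> i - x \<bullet> i) = 0)"
    unfolding box_bump_def by (simp add: prod_zero_iff)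
  then show "box_bump a b x \<noteq> 0 \<longleftrightarrow> x \<in> box a b"
    using f(3) by (auto simp: mem_box)
qed

text \<open>For \<open>0 \<le> w \<le> 1\<close> the functions \<open>1 - (1 - w)\<^sup>n\<close> increase to the indicator of \<open>{w > 0}\<close> and are
  polynomials in \<open>w\<close> without constant term. With the bump function of a box as \<open>w\<close> they are smooth,
  supported in the closed box, and approximate the indicator of the open box.\<close>

lemma box_plateau_test_function:
  assumes "cbox a b \<subseteq> \<Omega>"
  shows "(\<lambda>x. 1 - (1 - box_bump a b x) ^ n) \<in> test_functions \<Omega>"
proof -
  let ?f = "\<lambda>x. 1 - (1 - box_bump a b x) ^ n"
  have "Ck k (\<lambda>x. 1 + (-1) * (1 + (-1) * box_bump a b x) ^ n)" for k
    by (intro Ck_add Ck_mult Ck_power Ck_const Ck_box_bump)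
  then have 1: "Ck k ?f" for k by simp
  have "{x. ?f x \<noteq> 0} \<subseteq> box a b"
    using box_bump_range(3)[of a b] by fastforce
  then have 2: "closure {x. ?f x \<noteq> 0} \<subseteq> cbox a b"
    using box_subset_cbox closure_minimal[OF _ closed_cbox] by blast
  then have "compact (closure {x. ?f x \<noteq> 0})"
    by (meson bounded_cbox bounded_subset closed_closure compact_eq_bounded_closed)
  with 1 2 assms show ?thesis unfolding test_functions_def by blast
qed

lemma integral_box_zero_imp_AE:
  fixes F :: "'a::euclidean_space \<Rightarrow> real"
  assumes F: "integrable lborel F" and box: "\<And>a b. (LINT x:box a b|lborel. F x) = 0"
    and total: "(LINT x|lborel. F x) = 0"
  shows "AE x in lborel. F x = 0"
proof (rule AE_zero_if_integral_zero_on_generator[OF F])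
  show "Int_stable (range (\<lambda>(a, b). box a b :: 'a set))"
    by (auto simp: Int_stable_def box_Int_box)
  show "sets lborel = sigma_sets (space lborel) (range (\<lambda>(a, b). box a b :: 'a set))"
    by (simp add: borel_eq_box)
qed (use box total in auto)

text \<open>The fundamental lemma of the calculus of variations. Dominated convergence along the plateau
  functions shows that \<open>f\<close> integrates to zero over every open box whose closure lies in \<open>\<Omega>\<close>. The
  restriction of \<open>f\<close> to one such box then integrates to zero over all boxes, since boxes are closed
  under intersection, and hence vanishes almost everywhere; countably many boxes cover \<open>\<Omega>\<close>.\<close>

theorem test_functions_separate:
  fixes \<Omega> :: "'a::euclidean_space set" and f :: "'a \<Rightarrow> real"
  assumes "open \<Omega>" and f: "integrable (vol \<Omega>) f"
    and test: "\<And>\<phi>. \<phi> \<in> test_functions \<Omega> \<Longrightarrow> (LINT x|vol \<Omega>. f x * \<phi> x) = 0"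
  shows "AE x in vol \<Omega>. f x = 0"
proof -
  have \<Omega>: "\<Omega> \<in> sets borel" using assms(1) by simp
  define F where "F = (\<lambda>x. indicator \<Omega> x * f x)"
  have F: "integrable lborel F"
    using f \<Omega> unfolding vol_def F_def by (subst (asm) integrable_restrict_space) auto
  then have [measurable]: "F \<in> borel_measurable borel" by auto
  have Ft: "(LINT x|lborel. F x * \<phi> x) = 0" if "\<phi> \<in> test_functions \<Omega>" for \<phi>
    using test[OF that] \<Omega> unfolding vol_def F_def
    by (subst (asm) integral_restrict_space) (auto simp: mult_ac)
  have Fbox: "(LINT x:box a b|lborel. F x) = 0" if "cbox a b \<subseteq> \<Omega>" for a b
  proof -
    have "(\<lambda>n. LINT x|lborel. F x * (1 - (1 - box_bump a b x) ^ n)) \<longlonglongrightarrow> (LINT x|lborel. indicator (box a b) x * F x)"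
    proof (rule integral_dominated_convergence)
      show "integrable lborel (\<lambda>x. norm (F x))" using F by simp
      have [measurable]: "box_bump a b \<in> borel_measurable borel"
        using Ck_box_bump[of 0 a b] by (intro borel_measurable_continuous_onI) simp
      show "(\<lambda>x. F x * (1 - (1 - box_bump a b x) ^ n)) \<in> borel_measurable lborel" for n by measurable
      show "(\<lambda>x. indicator (box a b) x * F x) \<in> borel_measurable lborel" by measurable
      show "AE x in lborel. (\<lambda>n. F x * (1 - (1 - box_bump a b x) ^ n)) \<longlonglongrightarrow> indicator (box a b) x * F x"
      proof (rule AE_I2)
        fix x
        have "(\<lambda>n. 1 - (1 - box_bump a b x) ^ n) \<longlonglongrightarrow> indicator (box a b) x"
        proof (cases "x \<in> box a b")
          case True
          then have "\<bar>1 - box_bump a b x\<bar> < 1" using box_bump_range[of a b x] by auto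
          then have "(\<lambda>n. 1 - (1 - box_bump a b x) ^ n) \<longlonglongrightarrow> 1 - 0"
            by (intro tendsto_intros LIMSEQ_power_zero) simp
          then show ?thesis using True by simp
        next
          case False
          then show ?thesis using box_bump_range(3)[of a b x] by simp
        qed
        from tendsto_mult_left[OF this, of "F x"]
        show "(\<lambda>n. F x * (1 - (1 - box_bump a b x) ^ n)) \<longlonglongrightarrow> indicator (box a b) x * F x"
          by (simp add: mult_ac)
      qed
      show "AE x in lborel. norm (F x * (1 - (1 - box_bump a b x) ^ n)) \<le> norm (F x)" for n
      proof (rule AE_I2)
        fix x
        have "0 \<le> (1 - box_bump a b x) ^ n" "(1 - box_bump a b x) ^ n \<le> 1"
          using box_bump_range[of a b x] by (auto intro: power_le_one)
        then have "\<bar>1 - (1 - box_bump a b x) ^ n\<bar> \<le> 1" by auto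
        then show "norm (F x * (1 - (1 - box_bump a b x) ^ n)) \<le> norm (F x)"
          by (simp add: abs_mult mult_left_le)
      qed
    qed
    moreover have "(LINT x|lborel. F x * (1 - (1 - box_bump a b x) ^ n)) = 0" for n
      using Ft box_plateau_test_function[OF that] by blast
    ultimately show ?thesis
      using LIMSEQ_unique[OF _ tendsto_const] by (fastforce simp: set_lebesgue_integral_def)
  qed
  \<comment> \<open>cutting off to a box makes the function integrate to zero over every box of the whole space\<close>
  have cell: "AE x in lborel. x \<in> cbox p q \<longrightarrow> F x = 0" if pq: "cbox p q \<subseteq> \<Omega>" for p q
  proof -
    define F' where "F' = (\<lambda>x. indicator (box p q) x * F x)"
    have F': "integrable lborel F'"
      unfolding F'_def using F integrable_real_mult_indicator[of "box p q" lborel F] by (simp add: mult.commute)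
    have "(LINT x:box a b|lborel. F' x) = 0" for a b
    proof -
      let ?c = "\<Sum>i\<in>Basis. max (a\<bullet>i) (p\<bullet>i) *\<^sub>R i" and ?d = "\<Sum>i\<in>Basis. min (b\<bullet>i) (q\<bullet>i) *\<^sub>R i"
      have "(LINT x:box a b|lborel. F' x) = (LINT x:box a b \<inter> box p q|lborel. F x)"
        unfolding set_lebesgue_integral_def F'_def
        by (intro Bochner_Integration.integral_cong) (auto simp: indicator_def)
      also have "box a b \<inter> box p q = box ?c ?d" by (rule box_Int_box)
      also have "(LINT x:box ?c ?d|lborel. F x) = 0"
      proof (rule Fbox)
        have "cbox ?c ?d \<subseteq> cbox p q" by (auto simp: mem_box)
        then show "cbox ?c ?d \<subseteq> \<Omega>" using pq by blast
      qed
      finally show ?thesis .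
    qed
    moreover have "(LINT x|lborel. F' x) = 0"
      using Fbox[OF pq] by (simp add: F'_def set_lebesgue_integral_def)
    ultimately have "AE x in lborel. F' x = 0" by (rule integral_box_zero_imp_AE[OF F'])
    moreover have "AE x in lborel. x \<in> cbox p q \<longrightarrow> x \<in> box p q"
    proof -
      have "emeasure lborel (cbox p q - box p q) = emeasure lborel (cbox p q) - emeasure lborel (box p q)"
        by (rule emeasure_Diff) (auto simp: emeasure_lborel_box_eq box_subset_cbox)
      also have "\<dots> = 0"
        by (auto simp: emeasure_lborel_box_eq emeasure_lborel_cbox_eq)
      finally have "cbox p q - box p q \<in> null_sets lborel" by auto
      from AE_not_in[OF this] show ?thesis by eventually_elim auto
    qed
    ultimately show ?thesis by eventually_elim (auto simp: F'_def)
  qed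
  obtain \<D> :: "'a set set" where \<D>: "countable \<D>" "\<D> \<subseteq> Pow \<Omega>"
    "\<And>X. X \<in> \<D> \<Longrightarrow> \<exists>a b. X = cbox a b" "\<Union>\<D> = \<Omega>"
    using open_countable_Union_open_cbox[OF assms(1)] by metis
  have "AE x in lborel. \<forall>X\<in>\<D>. x \<in> X \<longrightarrow> F x = 0"
  proof (subst AE_ball_countable[OF \<D>(1)], intro ballI)
    fix X assume X: "X \<in> \<D>"
    with \<D> obtain a b where "X = cbox a b" "cbox a b \<subseteq> \<Omega>" by blast
    with cell show "AE x in lborel. x \<in> X \<longrightarrow> F x = 0" by simp
  qed
  then have "AE x in lborel. x \<in> \<Omega> \<longrightarrow> f x = 0"
  proof eventually_elim
    case (elim x)
    then have "x \<in> \<Omega> \<Longrightarrow> F x = 0" using \<D>(4) by blast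
    then show ?case by (simp add: F_def)
  qed
  then show ?thesis
    unfolding vol_def using \<Omega> by (subst AE_restrict_space_iff) auto
qed

section \<open>Test functions and Lebesgue measure on a region\<close>

lemma space_vol [simp]: "space (vol \<Omega>) = \<Omega>"
  by (simp add: vol_def space_restrict_space)

lemma borel_measurable_vol: "f \<in> borel_measurable borel \<Longrightarrow> f \<in> borel_measurable (vol \<Omega>)"
  unfolding vol_def by (rule measurable_restrict_space1) simp

lemma finite_measure_vol:
  assumes "bounded \<Omega>" "\<Omega> \<in> sets borel"
  shows "finite_measure (vol \<Omega>)"
proof
  have "emeasure lborel \<Omega> < \<infinity>" using assms(1) by (rule emeasure_bounded_finite)
  then show "emeasure (vol \<Omega>) (space (vol \<Omega>)) \<noteq> \<infinity>"
    using assms(2) by (simp add: vol_def emeasure_restrict_space space_restrict_space)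
qed

lemma sets_eqI_measurable_id:
  assumes "space M = space N" "(\<lambda>x. x) \<in> measurable M N" "(\<lambda>x. x) \<in> measurable N M"
  shows "sets M = sets N"
proof
  have *: "A \<in> sets M'" if "A \<in> sets N'" "space M' = space N'" "(\<lambda>x. x) \<in> measurable M' N'" for A M' N'
    using measurable_sets[OF that(3,1)] that(2) sets.sets_into_space[OF that(1)] by (simp add: Int_absorb2)
  show "sets M \<subseteq> sets N" using *[of _ M N] assms by auto
  show "sets N \<subseteq> sets M" using *[of _ N M] assms by auto
qed

lemma vol_Times:
  fixes A :: "'a::euclidean_space set" and B :: "'b::euclidean_space set"
  assumes "bounded A" "A \<in> sets borel" "bounded B" "B \<in> sets borel"
  shows "vol (A \<times> B) = vol A \<Otimes>\<^sub>M vol B"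
proof -
  interpret A: finite_measure "vol A" by (rule finite_measure_vol[OF assms(1,2)])
  interpret B: finite_measure "vol B" by (rule finite_measure_vol[OF assms(3,4)])
  have AB: "A \<times> B \<in> sets borel"
    using pair_measureI[OF assms(2,4)] by (metis borel_prod)
  have "sets (vol A \<Otimes>\<^sub>M vol B) = sets (vol (A \<times> B))"
  proof (rule sets_eqI_measurable_id)
    show "space (vol A \<Otimes>\<^sub>M vol B) = space (vol (A \<times> B))" by (simp add: space_pair_measure)
    have "fst \<in> borel_measurable (vol A \<Otimes>\<^sub>M vol B)" "snd \<in> borel_measurable (vol A \<Otimes>\<^sub>M vol B)"
      using measurable_compose[OF measurable_fst borel_measurable_vol[of "\<lambda>x. x" A]]
        measurable_compose[OF measurable_snd borel_measurable_vol[of "\<lambda>x. x" B]] by auto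
    from borel_measurable_Pair[OF this]
    show "(\<lambda>x. x) \<in> vol A \<Otimes>\<^sub>M vol B \<rightarrow>\<^sub>M vol (A \<times> B)"
      unfolding vol_def[of "A \<times> B"]
      by (intro measurable_restrict_space2) (auto simp: space_pair_measure)
    have "fst \<in> borel_measurable (vol (A \<times> B))" "snd \<in> borel_measurable (vol (A \<times> B))"
      by (intro borel_measurable_vol borel_measurable_continuous_onI continuous_intros)+
    then have "(\<lambda>x. (fst x, snd x)) \<in> vol (A \<times> B) \<rightarrow>\<^sub>M vol A \<Otimes>\<^sub>M vol B"
      unfolding vol_def[of A] vol_def[of B]
      by (intro measurable_Pair measurable_restrict_space2) auto
    then show "(\<lambda>x. x) \<in> vol (A \<times> B) \<rightarrow>\<^sub>M vol A \<Otimes>\<^sub>M vol B" by simp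
  qed
  moreover have "emeasure (vol A) a * emeasure (vol B) b = emeasure (vol (A \<times> B)) (a \<times> b)"
    if "a \<in> sets (vol A)" "b \<in> sets (vol B)" for a b
  proof -
    from that assms have ab: "a \<in> sets borel" "a \<subseteq> A" "b \<in> sets borel" "b \<subseteq> B"
      by (auto simp: vol_def sets_restrict_space_iff)
    have "emeasure (vol (A \<times> B)) (a \<times> b) = emeasure (lborel \<Otimes>\<^sub>M lborel) (a \<times> b)"
      using ab AB by (simp add: vol_def emeasure_restrict_space Sigma_mono lborel_prod)
    also have "\<dots> = emeasure lborel a * emeasure lborel b"
      using ab by (intro lborel.emeasure_pair_measure_Times) auto
    finally show ?thesis using ab assms by (simp add: vol_def emeasure_restrict_space)
  qed
  ultimately show ?thesis
    by (intro pair_measure_eqI[symmetric]) unfold_locales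
qed

lemma test_function_facts:
  assumes "\<phi> \<in> test_functions \<Omega>"
  shows "Ck k \<phi>" "continuous_on UNIV \<phi>" "\<phi> differentiable at x" "\<exists>C. \<forall>x. \<bar>\<phi> x\<bar> \<le> C"
proof -
  show C: "\<And>k. Ck k \<phi>" using assms by (simp add: test_functions_def)
  from C[of 0] show cont: "continuous_on UNIV \<phi>" by simp
  from C[of 1] show "\<phi> differentiable at x" by simp
  have "compact (\<phi> ` closure {x. \<phi> x \<noteq> 0})"
    using assms cont by (intro compact_continuous_image continuous_on_subset[OF cont])
      (auto simp: test_functions_def)
  then obtain C where C: "\<And>x. x \<in> closure {x. \<phi> x \<noteq> 0} \<Longrightarrow> \<bar>\<phi> x\<bar> \<le> C"
    using compact_imp_bounded bounded_iff by (metis imageI real_norm_def)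
  have "\<bar>\<phi> x\<bar> \<le> max C 0" for x
  proof (cases "\<phi> x = 0")
    case False
    then have "x \<in> closure {x. \<phi> x \<noteq> 0}" using closure_subset[of "{x. \<phi> x \<noteq> 0}"] by blast
    then show ?thesis using C by fastforce
  qed simp
  then show "\<exists>C. \<forall>x. \<bar>\<phi> x\<bar> \<le> C" by blast
qed

lemma test_function_outside: "\<phi> \<in> test_functions \<Omega> \<Longrightarrow> x \<notin> \<Omega> \<Longrightarrow> \<phi> x = 0"
  using closure_subset[of "{x. \<phi> x \<noteq> 0}"] by (auto simp: test_functions_def)

lemma test_functionI:
  assumes "\<And>k. Ck k \<phi>" "{x. \<phi> x \<noteq> 0} \<subseteq> K" "compact K" "K \<subseteq> \<Omega>"
  shows "\<phi> \<in> test_functions \<Omega>"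
proof -
  have "closure {x. \<phi> x \<noteq> 0} \<subseteq> K"
    using assms by (intro closure_minimal compact_imp_closed) auto
  moreover have "bounded {x. \<phi> x \<noteq> 0}"
    using assms(2) compact_imp_bounded[OF assms(3)] bounded_subset by blast
  ultimately show ?thesis using assms by (auto simp: test_functions_def)
qed

lemma test_function_partial:
  assumes "\<phi> \<in> test_functions \<Omega>" "i \<in> Basis"
  shows "(\<lambda>x. frechet_derivative \<phi> (at x) i) \<in> test_functions \<Omega>"
proof -
  let ?S = "closure {x. \<phi> x \<noteq> 0}"
  have "frechet_derivative \<phi> (at x) i = 0" if x: "x \<notin> ?S" for x
  proof -
    have "((\<lambda>_. 0) has_derivative (\<lambda>_. 0)) (at x)" by simp
    then have "(\<phi> has_derivative (\<lambda>_. 0)) (at x)"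
      by (rule has_derivative_transform_within_open[of _ _ _ _ "- ?S"])
        (use x closure_subset[of "{x. \<phi> x \<noteq> 0}"] in auto)
    then show ?thesis by (simp add: frechet_derivative_eqI)
  qed
  then have "{x. frechet_derivative \<phi> (at x) i \<noteq> 0} \<subseteq> ?S" by auto
  moreover have "compact ?S" "?S \<subseteq> \<Omega>" using assms by (auto simp: test_functions_def)
  moreover have "Ck k (\<lambda>x. frechet_derivative \<phi> (at x) i)" for k
    using test_function_facts(1)[OF assms(1), of "Suc k"] assms(2) by simp
  ultimately show ?thesis by (intro test_functionI[of _ ?S])
qed

lemma test_function_compose_affine:
  fixes L :: "'a::euclidean_space \<Rightarrow> 'b::euclidean_space"
  assumes \<phi>: "\<phi> \<in> test_functions \<Omega>" and L: "bounded_linear L"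
    and B: "\<And>i. i \<in> Basis \<Longrightarrow> \<exists>r. \<exists>j\<in>Basis. L i = r *\<^sub>R j"
    and K: "compact K" "K \<subseteq> \<Omega>'" "\<And>x. L x + c \<in> closure {z. \<phi> z \<noteq> 0} \<Longrightarrow> x \<in> K"
  shows "(\<lambda>x. \<phi> (L x + c)) \<in> test_functions \<Omega>'"
proof (rule test_functionI[OF _ _ K(1,2)])
  show "Ck k (\<lambda>x. \<phi> (L x + c))" for k
    by (rule Ck_compose_affine[OF L B test_function_facts(1)[OF \<phi>]])
  show "{x. \<phi> (L x + c) \<noteq> 0} \<subseteq> K"
    using K(3) closure_subset[of "{z. \<phi> z \<noteq> 0}"] by blast
qed

lemma Basis_Pair_cases:
  assumes "i \<in> (Basis :: ('a::euclidean_space \<times> 'b::euclidean_space) set)"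
  obtains j where "j \<in> Basis" "i = (j, 0)" | j where "j \<in> Basis" "i = (0, j)"
  using assms by (auto simp: Basis_prod_def)

lemma test_function_slice1:
  fixes \<phi> :: "'a::euclidean_space \<times> 'b::euclidean_space \<Rightarrow> real"
  assumes "\<phi> \<in> test_functions (\<Omega>1 \<times> \<Omega>2)"
  shows "(\<lambda>x. \<phi> (x, y)) \<in> test_functions \<Omega>1"
    and "frechet_derivative (\<lambda>x. \<phi> (x, y)) (at x) i = frechet_derivative \<phi> (at (x, y)) (i, 0)"
proof -
  let ?S = "closure {z. \<phi> z \<noteq> 0}"
  have L: "bounded_linear (\<lambda>x::'a. (x, 0::'b))"
    by (intro bounded_linear_Pair bounded_linear_ident bounded_linear_zero)
  have eq: "\<phi> (x, y) = \<phi> ((x, 0) + (0, y))" for x y by simp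
  have S: "compact ?S" "?S \<subseteq> \<Omega>1 \<times> \<Omega>2" using assms by (auto simp: test_functions_def)
  show "(\<lambda>x. \<phi> (x, y)) \<in> test_functions \<Omega>1"
    unfolding eq
  proof (rule test_function_compose_affine[OF assms L])
    show "compact (fst ` ?S)" using S by (intro compact_continuous_image continuous_intros)
    show "fst ` ?S \<subseteq> \<Omega>1" using S(2) by auto
    show "\<exists>r. \<exists>j\<in>Basis. (i, 0::'b) = r *\<^sub>R j" if "i \<in> Basis" for i :: 'a
      using that by (intro exI[of _ 1] bexI[of _ "(i, 0)"]) (auto simp: Basis_prod_def)
    show "x \<in> fst ` ?S" if "(x, 0) + (0, y) \<in> ?S" for x using that by (force intro: rev_image_eqI)
  qed
  show "frechet_derivative (\<lambda>x. \<phi> (x, y)) (at x) i = frechet_derivative \<phi> (at (x, y)) (i, 0)"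
    using frechet_derivative_compose_affine(2)[of \<phi> "\<lambda>x. (x, 0)" x "(0, y)", OF _ L]
      test_function_facts(3)[OF assms] by simp
qed

lemma test_function_swap:
  fixes \<phi> :: "'a::euclidean_space \<times> 'b::euclidean_space \<Rightarrow> real"
  assumes "\<phi> \<in> test_functions (\<Omega>1 \<times> \<Omega>2)"
  shows "(\<lambda>z. \<phi> (prod.swap z)) \<in> test_functions (\<Omega>2 \<times> \<Omega>1)"
    and "frechet_derivative (\<lambda>z. \<phi> (prod.swap z)) (at z) i
      = frechet_derivative \<phi> (at (prod.swap z)) (prod.swap i)"
proof -
  let ?S = "closure {z. \<phi> z \<noteq> 0}"
  have L: "bounded_linear (\<lambda>z::'b \<times> 'a. (snd z, fst z))"
    by (intro bounded_linear_Pair bounded_linear_fst bounded_linear_snd)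
  have eq: "\<phi> (prod.swap z) = \<phi> ((snd z, fst z) + 0)" for z by (simp add: prod.swap_def)
  have S: "compact ?S" "?S \<subseteq> \<Omega>1 \<times> \<Omega>2" using assms by (auto simp: test_functions_def)
  show "(\<lambda>z. \<phi> (prod.swap z)) \<in> test_functions (\<Omega>2 \<times> \<Omega>1)"
    unfolding eq
  proof (rule test_function_compose_affine[OF assms L])
    show "compact (prod.swap ` ?S)"
      using S by (intro compact_continuous_image) (auto simp: prod.swap_def intro!: continuous_intros)
    show "prod.swap ` ?S \<subseteq> \<Omega>2 \<times> \<Omega>1" using S(2) by auto
    show "\<exists>r. \<exists>j\<in>Basis. (snd i, fst i) = r *\<^sub>R j" if "i \<in> Basis" for i :: "'b \<times> 'a"
      using that by (intro exI[of _ 1] bexI[of _ "prod.swap i"]) (auto simp: Basis_prod_def)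
    show "z \<in> prod.swap ` ?S" if "(snd z, fst z) + 0 \<in> ?S" for z
      using that by (intro image_eqI[of _ _ "(snd z, fst z)"]) auto
  qed
  show "frechet_derivative (\<lambda>z. \<phi> (prod.swap z)) (at z) i
      = frechet_derivative \<phi> (at (prod.swap z)) (prod.swap i)"
    using frechet_derivative_compose_affine(2)[of \<phi> "\<lambda>z. (snd z, fst z)" z 0, OF _ L]
      test_function_facts(3)[OF assms] by (simp add: prod.swap_def)
qed

lemma test_function_tensor:
  fixes \<phi> :: "'a::euclidean_space \<Rightarrow> real" and \<psi> :: "'b::euclidean_space \<Rightarrow> real"
  assumes \<phi>: "\<phi> \<in> test_functions \<Omega>1" and \<psi>: "\<psi> \<in> test_functions \<Omega>2"
  shows "vtensor \<phi> \<psi> \<in> test_functions (\<Omega>1 \<times> \<Omega>2)"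
    and "frechet_derivative (vtensor \<phi> \<psi>) (at z) (i, 0)
      = vtensor (\<lambda>x. frechet_derivative \<phi> (at x) i) \<psi> z"
proof -
  have eq: "vtensor \<phi> \<psi> = (\<lambda>z. \<psi> (snd z + 0) * \<phi> (fst z + 0))" by (simp add: vtensor_def fun_eq_iff)
  show T: "vtensor \<phi> \<psi> \<in> test_functions (\<Omega>1 \<times> \<Omega>2)"
  proof (rule test_functionI)
    let ?K = "closure {x. \<phi> x \<noteq> 0} \<times> closure {x. \<psi> x \<noteq> 0}"
    show "compact ?K" "?K \<subseteq> \<Omega>1 \<times> \<Omega>2"
      using assms by (auto simp: test_functions_def compact_Times)
    show "{z. vtensor \<phi> \<psi> z \<noteq> 0} \<subseteq> ?K"
      using closure_subset[of "{x. \<phi> x \<noteq> 0}"] closure_subset[of "{x. \<psi> x \<noteq> 0}"]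
      by (force simp: vtensor_def)
    have b1: "\<exists>r. \<exists>j\<in>Basis. fst i = r *\<^sub>R j" and b2: "\<exists>r. \<exists>j\<in>Basis. snd i = r *\<^sub>R j"
      if "i \<in> Basis" for i :: "'a \<times> 'b"
    proof -
      obtain j1 :: 'a and j2 :: 'b where j: "j1 \<in> Basis" "j2 \<in> Basis"
        using nonempty_Basis by (metis all_not_in_conv)
      have "fst i \<in> Basis \<or> fst i = 0" "snd i \<in> Basis \<or> snd i = 0"
        using that by (auto simp: Basis_prod_def)
      then show "\<exists>r. \<exists>j\<in>Basis. fst i = r *\<^sub>R j" "\<exists>r. \<exists>j\<in>Basis. snd i = r *\<^sub>R j"
        using j by (metis scaleR_one scaleR_zero_left)+
    qed
    show "Ck k (vtensor \<phi> \<psi>)" for k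
      unfolding eq
      by (intro Ck_mult Ck_compose_affine bounded_linear_fst bounded_linear_snd b1 b2
          test_function_facts(1)[OF \<phi>] test_function_facts(1)[OF \<psi>])
  qed
  obtain x y where z: "z = (x, y)" by fastforce
  have "frechet_derivative (vtensor \<phi> \<psi>) (at z) (i, 0) = frechet_derivative (\<lambda>x. vtensor \<phi> \<psi> (x, y)) (at x) i"
    using test_function_slice1(2)[OF T] z by simp
  also have "(\<lambda>x. vtensor \<phi> \<psi> (x, y)) = (\<lambda>x. \<psi> y *\<^sub>R \<phi> x)" by (simp add: vtensor_def)
  also have "frechet_derivative (\<lambda>x. \<psi> y *\<^sub>R \<phi> x) (at x) = (\<lambda>h. \<psi> y *\<^sub>R frechet_derivative \<phi> (at x) h)"
    using test_function_facts(3)[OF \<phi>]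
    by (intro frechet_derivative_eqI has_derivative_scaleR_right) (simp add: frechet_derivative_works)
  finally show "frechet_derivative (vtensor \<phi> \<psi>) (at z) (i, 0)
      = vtensor (\<lambda>x. frechet_derivative \<phi> (at x) i) \<psi> z"
    by (simp add: vtensor_def z)
qed

lemma test_function_L2:
  fixes v :: "'c::euclidean_space"
  assumes "\<phi> \<in> test_functions \<Omega>" "finite_measure (vol \<Omega>)"
  shows "\<phi> \<in> Lp (vol \<Omega>) 2" "(\<lambda>x. \<phi> x *\<^sub>R v) \<in> Lp (vol \<Omega>) 2"
proof -
  obtain C where C: "\<And>x. \<bar>\<phi> x\<bar> \<le> C" using test_function_facts(4)[OF assms(1)] by blast
  have [measurable]: "\<phi> \<in> borel_measurable (vol \<Omega>)"
    by (intro borel_measurable_vol borel_measurable_continuous_onI test_function_facts(2)[OF assms(1)])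
  show "\<phi> \<in> Lp (vol \<Omega>) 2" by (rule L2_bounded[OF assms(2)]) (use C in auto)
  show "(\<lambda>x. \<phi> x *\<^sub>R v) \<in> Lp (vol \<Omega>) 2"
    by (rule L2_bounded[OF assms(2), of _ "C * norm v"]) (use C in \<open>auto intro: mult_right_mono\<close>)
qed

lemma test_function_times:
  assumes "\<phi> \<in> test_functions \<Omega>" "\<psi> \<in> test_functions \<Omega>"
  shows "(\<lambda>x. \<phi> x * \<psi> x) \<in> test_functions \<Omega>"
    and "frechet_derivative (\<lambda>x. \<phi> x * \<psi> x) (at x) i
      = \<phi> x * frechet_derivative \<psi> (at x) i + frechet_derivative \<phi> (at x) i * \<psi> x"
proof -
  show "(\<lambda>x. \<phi> x * \<psi> x) \<in> test_functions \<Omega>"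
  proof (rule test_functionI)
    show "Ck k (\<lambda>x. \<phi> x * \<psi> x)" for k
      by (intro Ck_mult test_function_facts(1)[OF assms(1)] test_function_facts(1)[OF assms(2)])
    show "compact (closure {x. \<phi> x \<noteq> 0})" "closure {x. \<phi> x \<noteq> 0} \<subseteq> \<Omega>"
      using assms(1) by (auto simp: test_functions_def)
    show "{x. \<phi> x * \<psi> x \<noteq> 0} \<subseteq> closure {x. \<phi> x \<noteq> 0}"
      using closure_subset[of "{x. \<phi> x \<noteq> 0}"] by auto
  qed
  have "((\<lambda>x. \<phi> x * \<psi> x) has_derivative
    (\<lambda>h. \<phi> x * frechet_derivative \<psi> (at x) h + frechet_derivative \<phi> (at x) h * \<psi> x)) (at x)"
    using test_function_facts(3)[OF assms(1), of x] test_function_facts(3)[OF assms(2), of x]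
    by (intro has_derivative_mult) (simp_all add: frechet_derivative_works)
  then show "frechet_derivative (\<lambda>x. \<phi> x * \<psi> x) (at x) i
      = \<phi> x * frechet_derivative \<psi> (at x) i + frechet_derivative \<phi> (at x) i * \<psi> x"
    by (simp add: frechet_derivative_eqI)
qed

text \<open>Integrals are invariant under translation, so the difference quotients of \<open>\<phi>\<close> in direction \<open>i\<close> all
  integrate to zero. They converge to the derivative, dominated by a constant on a ball.\<close>

lemma integral_test_function_derivative:
  fixes \<phi> :: "'a::euclidean_space \<Rightarrow> real"
  assumes \<phi>: "\<phi> \<in> test_functions \<Omega>" and i: "i \<in> Basis"
  shows "(LINT x|lborel. frechet_derivative \<phi> (at x) i) = 0"
proof -
  let ?d = "\<lambda>x. frechet_derivative \<phi> (at x) i"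
  note d = test_function_partial[OF \<phi> i]
  obtain C where C: "\<And>x. \<bar>?d x\<bar> \<le> C" using test_function_facts(4)[OF d] by blast
  have cont: "continuous_on UNIV \<phi>" by (rule test_function_facts(2)[OF \<phi>])
  have [measurable]: "\<phi> \<in> borel_measurable borel" "?d \<in> borel_measurable borel"
    by (intro borel_measurable_continuous_onI test_function_facts(2)[OF \<phi>] test_function_facts(2)[OF d])+
  have "bounded (closure {x. \<phi> x \<noteq> 0})" using \<phi> by (auto simp: test_functions_def compact_imp_bounded)
  then obtain R where R: "\<And>x. \<phi> x \<noteq> 0 \<Longrightarrow> norm x \<le> R"
    using closure_subset[of "{x. \<phi> x \<noteq> 0}"] unfolding bounded_iff by blast
  \<comment> \<open>difference quotients with step \<open>1 / (n + 1)\<close>\<close>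
  define q where "q = (\<lambda>n x. (\<phi> (x + inverse (real (Suc n)) *\<^sub>R i) - \<phi> x) * real (Suc n))"
  have line: "((\<lambda>t. \<phi> (x + t *\<^sub>R i)) has_real_derivative ?d (x + t *\<^sub>R i)) (at t)" for x t
  proof -
    have "(\<phi> has_derivative frechet_derivative \<phi> (at (x + t *\<^sub>R i))) (at (x + t *\<^sub>R i))"
      using test_function_facts(3)[OF \<phi>] by (simp add: frechet_derivative_works)
    moreover have "((\<lambda>t. x + t *\<^sub>R i) has_derivative (\<lambda>h. h *\<^sub>R i)) (at t)"
      by (auto intro!: derivative_eq_intros)
    ultimately have "((\<lambda>t. \<phi> (x + t *\<^sub>R i)) has_derivative
        (\<lambda>h. frechet_derivative \<phi> (at (x + t *\<^sub>R i)) (h *\<^sub>R i))) (at t)"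
      using diff_chain_at[of "\<lambda>t. x + t *\<^sub>R i" "\<lambda>h. h *\<^sub>R i" t \<phi>] by (simp add: o_def)
    moreover have "frechet_derivative \<phi> (at (x + t *\<^sub>R i)) (h *\<^sub>R i) = ?d (x + t *\<^sub>R i) * h" for h
      using linear_frechet_derivative[OF test_function_facts(3)[OF \<phi>]] by (simp add: linear_cmul)
    ultimately show ?thesis by (simp add: has_field_derivative_def)
  qed
  have q_lim: "(\<lambda>n. q n x) \<longlonglongrightarrow> ?d x" for x
  proof -
    have "((\<lambda>h. (\<phi> (x + h *\<^sub>R i) - \<phi> x) / h) \<longlongrightarrow> ?d x) (at 0)"
      using line[of x 0] by (simp add: DERIV_def)
    moreover have "filterlim (\<lambda>n. inverse (real (Suc n))) (at 0) sequentially"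
      using LIMSEQ_inverse_real_of_nat by (auto simp: filterlim_at)
    ultimately have "(\<lambda>n. (\<phi> (x + inverse (real (Suc n)) *\<^sub>R i) - \<phi> x) / inverse (real (Suc n))) \<longlonglongrightarrow> ?d x"
      by (rule filterlim_compose)
    then show ?thesis by (simp add: q_def divide_inverse)
  qed
  have q_bound: "\<bar>q n x\<bar> \<le> indicator (cball 0 (R + 1)) x * C" for n x
  proof -
    let ?t = "inverse (real (Suc n))"
    have t: "0 < ?t" "?t \<le> 1" by (auto simp: field_simps)
    have C0: "C \<ge> 0" using C[of 0] by simp
    show ?thesis
    proof (cases "x \<in> cball 0 (R + 1)")
      case True
      obtain z where z: "\<phi> (x + ?t *\<^sub>R i) - \<phi> (x + 0 *\<^sub>R i) = (?t - 0) * ?d (x + z *\<^sub>R i)"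
        using MVT2[OF t(1), of "\<lambda>t. \<phi> (x + t *\<^sub>R i)" "\<lambda>t. ?d (x + t *\<^sub>R i)"] line by blast
      then have "q n x = ?d (x + z *\<^sub>R i)" using t(1) by (simp add: q_def)
      then show ?thesis using C True by simp
    next
      case False
      then have "norm x > R + 1" by simp
      moreover have "norm (x + ?t *\<^sub>R i) \<ge> norm x - 1"
        using norm_diff_ineq[of x "?t *\<^sub>R i"] t i by simp
      ultimately have "\<phi> x = 0" "\<phi> (x + ?t *\<^sub>R i) = 0" using R[of x] R[of "x + ?t *\<^sub>R i"] by auto
      then show ?thesis using C0 by (simp add: q_def)
    qed
  qed
  have "integrable lborel \<phi>"
  proof -
    obtain B where B: "\<And>x. \<bar>\<phi> x\<bar> \<le> B" using test_function_facts(4)[OF \<phi>] by blast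
    show ?thesis
    proof (rule Bochner_Integration.integrable_bound)
      show "integrable lborel (\<lambda>x::'a. indicator (cball 0 R) x * B)"
        using emeasure_bounded_finite[of "cball (0::'a) R"]
        by (intro integrable_mult_left) (auto simp: integrable_indicator_iff)
      show "AE x in lborel. norm (\<phi> x) \<le> norm (indicator (cball 0 R) x * B)"
      proof (rule AE_I2)
        fix x :: 'a
        show "norm (\<phi> x) \<le> norm (indicator (cball 0 R) x * B)"
          using B[of x] R[of x] by (cases "\<phi> x = 0") (auto simp: indicator_def)
      qed
    qed simp
  qed
  then have int_shift: "integrable lborel (\<lambda>x. \<phi> (x + c))" "(LINT x|lborel. \<phi> (x + c)) = (LINT x|lborel. \<phi> x)" for c
    using integrable_distr_eq[of "(+) c" lborel borel \<phi>] integral_distr[of "(+) c" lborel borel \<phi>]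
      lborel_distr_plus[of c] by (simp_all add: add.commute)
  have "(LINT x|lborel. q n x) = 0" for n
    using int_shift[of "inverse (real (Suc n)) *\<^sub>R i"] \<open>integrable lborel \<phi>\<close> by (simp add: q_def)
  moreover have "(\<lambda>n. LINT x|lborel. q n x) \<longlonglongrightarrow> (LINT x|lborel. ?d x)"
  proof (rule integral_dominated_convergence)
    show "integrable lborel (\<lambda>x::'a. indicator (cball 0 (R + 1)) x * C)"
      using emeasure_bounded_finite[of "cball (0::'a) (R + 1)"]
      by (intro integrable_mult_left) (auto simp: integrable_indicator_iff)
    show "AE x in lborel. (\<lambda>n. q n x) \<longlonglongrightarrow> ?d x" using q_lim by simp
    show "AE x in lborel. norm (q n x) \<le> indicator (cball 0 (R + 1)) x * C" for n using q_bound by simp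
    show "q n \<in> borel_measurable lborel" for n unfolding q_def by measurable
  qed simp
  ultimately show ?thesis using LIMSEQ_unique[OF _ tendsto_const] by fastforce
qed

section \<open>Weak gradients\<close>

lemma is_weak_gradient_iff_inner:
  "is_weak_gradient \<Omega> u G \<longleftrightarrow> (\<forall>\<phi>\<in>test_functions \<Omega>. \<forall>i\<in>Basis.
     L2_inner (vol \<Omega>) u (\<lambda>x. frechet_derivative \<phi> (at x) i) = - L2_inner (vol \<Omega>) G (\<lambda>x. \<phi> x *\<^sub>R i))"
  by (simp add: is_weak_gradient_def L2_inner_def mult.commute)

text \<open>Since \<^const>\<open>wgrad\<close> picks an unspecified representative, statements about a known weak
  gradient are made for the pair of the function and that gradient.\<close>

definition H1_pair :: "'a::euclidean_space set \<Rightarrow> ('a \<Rightarrow> real) \<Rightarrow> ('a \<Rightarrow> 'a) \<Rightarrow> bool" where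
  "H1_pair \<Omega> u G \<longleftrightarrow> u \<in> Lp (vol \<Omega>) 2 \<and> G \<in> Lp (vol \<Omega>) 2 \<and> is_weak_gradient \<Omega> u G"

lemma H1_pair_D: "H1_pair \<Omega> u G \<Longrightarrow> u \<in> Lp (vol \<Omega>) 2" "H1_pair \<Omega> u G \<Longrightarrow> G \<in> Lp (vol \<Omega>) 2"
  by (simp_all add: H1_pair_def)

lemma H1_iff_pair: "u \<in> H1 \<Omega> \<longleftrightarrow> (\<exists>G. H1_pair \<Omega> u G)"
  by (auto simp: H1_def H1_pair_def)

lemma H1_pair_imp_H1: "H1_pair \<Omega> u G \<Longrightarrow> u \<in> H1 \<Omega>"
  using H1_iff_pair by blast

lemma H1_pair_wgrad: "u \<in> H1 \<Omega> \<Longrightarrow> H1_pair \<Omega> u (wgrad \<Omega> u)"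
  using someI_ex[of "\<lambda>G. G \<in> Lp (vol \<Omega>) 2 \<and> is_weak_gradient \<Omega> u G"]
  by (auto simp: H1_def H1_pair_def wgrad_def)

lemma H1_L2: "u \<in> H1 \<Omega> \<Longrightarrow> u \<in> Lp (vol \<Omega>) 2" "u \<in> H1 \<Omega> \<Longrightarrow> wgrad \<Omega> u \<in> Lp (vol \<Omega>) 2"
  using H1_pair_wgrad by (auto simp: H1_pair_def)

lemma L2_Pair:
  assumes "f \<in> Lp M 2" "g \<in> Lp M 2"
  shows "(\<lambda>x. (f x, g x)) \<in> Lp M 2"
  using assms by (auto simp: L2_iff)

lemma L2_inner_Pair:
  assumes "f \<in> Lp M 2" "g \<in> Lp M 2" "f' \<in> Lp M 2" "g' \<in> Lp M 2"
  shows "L2_inner M (\<lambda>x. (f x, g x)) (\<lambda>x. (f' x, g' x)) = L2_inner M f f' + L2_inner M g g'"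
  by (simp add: L2_inner_def L2_integrable_inner assms)

lemma L2_fst_snd:
  assumes "f \<in> Lp M 2"
  shows "(\<lambda>x. fst (f x)) \<in> Lp M 2" "(\<lambda>x. snd (f x)) \<in> Lp M 2"
proof -
  have [measurable]: "f \<in> borel_measurable M" using assms by (simp add: L2_iff)
  have m: "(\<lambda>x. fst (f x)) \<in> borel_measurable M" "(\<lambda>x. snd (f x)) \<in> borel_measurable M"
    by (auto intro!: borel_measurable_continuous_on[of fst] borel_measurable_continuous_on[of snd] continuous_intros)
  have "integrable M (\<lambda>x. fst (f x) \<bullet> fst (f x))" "integrable M (\<lambda>x. snd (f x) \<bullet> snd (f x))"
    by (rule Bochner_Integration.integrable_bound[of M "\<lambda>x. f x \<bullet> f x"];
        use assms m in \<open>simp add: L2_iff inner_prod_def\<close>)+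
  with m show "(\<lambda>x. fst (f x)) \<in> Lp M 2" "(\<lambda>x. snd (f x)) \<in> Lp M 2" by (simp_all add: L2_iff)
qed

lemma L2_norm_Pair_tendsto:
  assumes "\<And>n. f n \<in> Lp M 2" "\<And>n. g n \<in> Lp M 2"
  shows "(\<lambda>n. L2_norm M (\<lambda>x. (f n x, g n x))) \<longlonglongrightarrow> 0
    \<longleftrightarrow> (\<lambda>n. L2_norm M (f n)) \<longlonglongrightarrow> 0 \<and> (\<lambda>n. L2_norm M (g n)) \<longlonglongrightarrow> 0"
proof -
  have eq: "L2_inner M (\<lambda>x. (f n x, g n x)) (\<lambda>x. (f n x, g n x)) = L2_inner M (f n) (f n) + L2_inner M (g n) (g n)" for n
    by (rule L2_inner_Pair) (rule assms)+
  note nn = L2.nonneg[OF assms(1)] L2.nonneg[OF assms(2)]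
  have "(\<lambda>n. L2_inner M (f n) (f n) + L2_inner M (g n) (g n)) \<longlonglongrightarrow> 0 \<longleftrightarrow>
    (\<lambda>n. L2_inner M (f n) (f n)) \<longlonglongrightarrow> 0 \<and> (\<lambda>n. L2_inner M (g n) (g n)) \<longlonglongrightarrow> 0" (is "?l \<longleftrightarrow> ?r")
  proof
    assume l: ?l
    show ?r
      by (intro conjI; rule Lim_null_comparison[OF _ l]) (use nn in auto)
  next
    assume ?r then show ?l using tendsto_add_zero by blast
  qed
  moreover have "(\<lambda>n. L2_inner M (\<lambda>x. (f n x, g n x)) (\<lambda>x. (f n x, g n x))) \<longlonglongrightarrow> 0
      \<longleftrightarrow> (\<lambda>n. L2_norm M (\<lambda>x. (f n x, g n x))) \<longlonglongrightarrow> 0"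
    "(\<lambda>n. L2_inner M (f n) (f n)) \<longlonglongrightarrow> 0 \<longleftrightarrow> (\<lambda>n. L2_norm M (f n)) \<longlonglongrightarrow> 0"
    "(\<lambda>n. L2_inner M (g n) (g n)) \<longlonglongrightarrow> 0 \<longleftrightarrow> (\<lambda>n. L2_norm M (g n)) \<longlonglongrightarrow> 0"
    by (intro L2.B_tendsto_zero_iff L2_Pair assms)+
  ultimately show ?thesis unfolding eq by blast
qed

locale bounded_open =
  fixes \<Omega> :: "'a::euclidean_space set"
  assumes open_set: "open \<Omega>" and bounded_set: "bounded \<Omega>"
begin

lemma borel_set: "\<Omega> \<in> sets borel"
  using open_set by simp

lemma fin: "finite_measure (vol \<Omega>)"
  by (rule finite_measure_vol[OF bounded_set borel_set])

sublocale finite_measure "vol \<Omega>"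
  by (rule fin)

lemma test_L2:
  fixes v :: "'c::euclidean_space"
  assumes "\<phi> \<in> test_functions \<Omega>"
  shows "\<phi> \<in> Lp (vol \<Omega>) 2" "(\<lambda>x. \<phi> x *\<^sub>R v) \<in> Lp (vol \<Omega>) 2"
    "i \<in> Basis \<Longrightarrow> (\<lambda>x. frechet_derivative \<phi> (at x) i) \<in> Lp (vol \<Omega>) 2"
  using test_function_L2[OF assms fin] test_function_L2(1)[OF test_function_partial[OF assms] fin]
  by auto

lemma L2_test_zero:
  assumes "f \<in> Lp (vol \<Omega>) 2" "\<And>\<phi>. \<phi> \<in> test_functions \<Omega> \<Longrightarrow> L2_inner (vol \<Omega>) f \<phi> = 0"
  shows "AE x in vol \<Omega>. f x = 0"
  using assms L2_integral_norm_le(1)[OF fin assms(1)]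
  by (intro test_functions_separate[OF open_set]) (auto simp: L2_inner_def)

lemma H1_pair_unique:
  assumes "H1_pair \<Omega> u G" "H1_pair \<Omega> u G'"
  shows "AE x in vol \<Omega>. G x = G' x"
proof -
  note L = H1_pair_D(2)[OF assms(1)] H1_pair_D(2)[OF assms(2)]
  let ?d = "\<lambda>x. G x - G' x"
  have dL: "?d \<in> Lp (vol \<Omega>) 2" by (rule L2.diff_closed[OF L])
  have "AE x in vol \<Omega>. ?d x \<bullet> i = 0" if i: "i \<in> Basis" for i
  proof (rule test_functions_separate[OF open_set])
    show "integrable (vol \<Omega>) (\<lambda>x. ?d x \<bullet> i)"
      using L2_integral_norm_le(1)[OF fin dL] by simp
    fix \<phi> assume \<phi>: "\<phi> \<in> test_functions \<Omega>"
    have "L2_inner (vol \<Omega>) ?d (\<lambda>x. \<phi> x *\<^sub>R i) = 0"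
      using assms \<phi> i by (simp add: L2.diff_left L test_L2 H1_pair_def is_weak_gradient_iff_inner)
    then show "(LINT x|vol \<Omega>. (?d x \<bullet> i) * \<phi> x) = 0" by (simp add: L2_inner_def mult.commute)
  qed
  then have "AE x in vol \<Omega>. \<forall>i\<in>Basis. ?d x \<bullet> i = 0" by (intro AE_finite_allI) auto
  then show ?thesis by eventually_elim (metis euclidean_all_zero_iff eq_iff_diff_eq_0)
qed

lemma wgrad_AE: "H1_pair \<Omega> u G \<Longrightarrow> AE x in vol \<Omega>. wgrad \<Omega> u x = G x"
  using H1_pair_unique H1_pair_wgrad H1_pair_imp_H1 by blast

lemma H1_pair_add:
  assumes "H1_pair \<Omega> u G" "H1_pair \<Omega> v H"
  shows "H1_pair \<Omega> (\<lambda>x. u x + v x) (\<lambda>x. G x + H x)"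
  using assms by (simp add: H1_pair_def is_weak_gradient_iff_inner L2.add_closed L2.add_left test_L2)

lemma H1_pair_scale:
  assumes "H1_pair \<Omega> u G"
  shows "H1_pair \<Omega> (\<lambda>x. c * u x) (\<lambda>x. c *\<^sub>R G x)"
  using assms L2.scale_closed[of u "vol \<Omega>" c] L2.scale_left[of u "vol \<Omega>" _ c]
  by (simp add: H1_pair_def is_weak_gradient_iff_inner L2.scale_closed L2.scale_left test_L2)

lemma H1_pair_zero: "H1_pair \<Omega> (\<lambda>_. 0) (\<lambda>_. 0)"
  by (simp add: H1_pair_def is_weak_gradient_iff_inner L2.zero_closed L2.zero_left test_L2)

lemma H1_pair_diff:
  assumes "H1_pair \<Omega> u G" "H1_pair \<Omega> v H"
  shows "H1_pair \<Omega> (\<lambda>x. u x - v x) (\<lambda>x. G x - H x)"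
  using H1_pair_add[OF assms(1) H1_pair_scale[OF assms(2), of "-1"]] by simp

lemma H1_pair_sum:
  "(\<And>i. i \<in> A \<Longrightarrow> H1_pair \<Omega> (u i) (G i)) \<Longrightarrow> H1_pair \<Omega> (\<lambda>x. \<Sum>i\<in>A. u i x) (\<lambda>x. \<Sum>i\<in>A. G i x)"
  by (induction A rule: infinite_finite_induct) (auto simp: H1_pair_zero intro: H1_pair_add)

lemma H1_diff: "u \<in> H1 \<Omega> \<Longrightarrow> v \<in> H1 \<Omega> \<Longrightarrow> (\<lambda>x. u x - v x) \<in> H1 \<Omega>"
  using H1_pair_diff[OF H1_pair_wgrad H1_pair_wgrad] H1_pair_imp_H1 by blast

lemma H1_add: "u \<in> H1 \<Omega> \<Longrightarrow> v \<in> H1 \<Omega> \<Longrightarrow> (\<lambda>x. u x + v x) \<in> H1 \<Omega>"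
  using H1_pair_add[OF H1_pair_wgrad H1_pair_wgrad] H1_pair_imp_H1 by blast

lemma H1_scale: "u \<in> H1 \<Omega> \<Longrightarrow> (\<lambda>x. c * u x) \<in> H1 \<Omega>"
  using H1_pair_scale[OF H1_pair_wgrad] H1_pair_imp_H1 by blast

lemma H1_zero: "(\<lambda>_. 0) \<in> H1 \<Omega>"
  using H1_pair_zero H1_pair_imp_H1 by blast

lemma H1_sum: "(\<And>i. i \<in> A \<Longrightarrow> u i \<in> H1 \<Omega>) \<Longrightarrow> (\<lambda>x. \<Sum>i\<in>A. u i x) \<in> H1 \<Omega>"
  by (induction A rule: infinite_finite_induct) (auto simp: H1_zero intro: H1_add)

text \<open>The definition of a weak gradient pairs \<open>u\<close> and \<open>G\<close> with square-integrable functions, and such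
  pairings are continuous in \<open>L\<^sup>2\<close>. In particular, \<open>H\<^sup>1\<close> is complete.\<close>

lemma H1_pair_limit:
  assumes p: "\<And>n. H1_pair \<Omega> (u n) (G n)" and L: "v \<in> Lp (vol \<Omega>) 2" "H \<in> Lp (vol \<Omega>) 2"
    and lim: "L2_tendsto (vol \<Omega>) u v"
      "L2_tendsto (vol \<Omega>) G H"
  shows "H1_pair \<Omega> v H"
  unfolding H1_pair_def is_weak_gradient_iff_inner
proof (intro conjI ballI L)
  fix \<phi> i assume \<phi>: "\<phi> \<in> test_functions \<Omega>" and i: "i \<in> (Basis :: 'a set)"
  have 1: "(\<lambda>n. L2_inner (vol \<Omega>) (u n) (\<lambda>x. frechet_derivative \<phi> (at x) i))
    \<longlonglongrightarrow> L2_inner (vol \<Omega>) v (\<lambda>x. frechet_derivative \<phi> (at x) i)"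
    by (intro L2.B_tendsto_left lim L test_L2(3)[OF \<phi> i] H1_pair_D[OF p])
  have "(\<lambda>n. - L2_inner (vol \<Omega>) (G n) (\<lambda>x. \<phi> x *\<^sub>R i)) \<longlonglongrightarrow> - L2_inner (vol \<Omega>) H (\<lambda>x. \<phi> x *\<^sub>R i)"
    by (intro tendsto_minus L2.B_tendsto_left lim L test_L2(2)[OF \<phi>] H1_pair_D[OF p])
  moreover have "L2_inner (vol \<Omega>) (u n) (\<lambda>x. frechet_derivative \<phi> (at x) i)
      = - L2_inner (vol \<Omega>) (G n) (\<lambda>x. \<phi> x *\<^sub>R i)" for n
    using p[of n] \<phi> i by (auto simp: H1_pair_def is_weak_gradient_iff_inner)
  ultimately show "L2_inner (vol \<Omega>) v (\<lambda>x. frechet_derivative \<phi> (at x) i)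
      = - L2_inner (vol \<Omega>) H (\<lambda>x. \<phi> x *\<^sub>R i)"
    using LIMSEQ_unique[OF 1] by simp
qed

lemma H1_norm_sq:
  assumes "H1_pair \<Omega> u G"
  shows "H1_norm \<Omega> u = sqrt (L2_inner (vol \<Omega>) u u + L2_inner (vol \<Omega>) G G)"
proof -
  have "L2_inner (vol \<Omega>) (wgrad \<Omega> u) (wgrad \<Omega> u) = L2_inner (vol \<Omega>) G G"
    by (rule L2_cong_AE)
      (use wgrad_AE[OF assms] H1_L2(2)[OF H1_pair_imp_H1[OF assms]] H1_pair_D(2)[OF assms]
        in \<open>auto simp: L2_iff\<close>)
  then show ?thesis by (simp add: H1_norm_def L2_inner_def power2_eq_square)
qed

text \<open>\<open>H\<^sup>1\<close> is isometric to a closed subspace of an \<open>L\<^sup>2\<close> space through \<open>u \<mapsto> (u, \<nabla>u)\<close>, so norm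
  estimates and limits are inherited from \<open>L\<^sup>2\<close>.\<close>

lemma H1_norm_jet:
  assumes "H1_pair \<Omega> u G"
  shows "H1_norm \<Omega> u = L2_norm (vol \<Omega>) (\<lambda>x. (u x, G x))"
  unfolding H1_norm_sq[OF assms] L2.nrm_def
  using L2_inner_Pair[OF H1_pair_D(1)[OF assms] H1_pair_D(2)[OF assms] H1_pair_D(1)[OF assms] H1_pair_D(2)[OF assms]]
  by simp

lemma H1_norm_scale: "u \<in> H1 \<Omega> \<Longrightarrow> H1_norm \<Omega> (\<lambda>x. c * u x) = \<bar>c\<bar> * H1_norm \<Omega> u"
  using H1_norm_jet[OF H1_pair_scale[OF H1_pair_wgrad]] H1_norm_jet[OF H1_pair_wgrad]
    L2.nrm_scale[of "\<lambda>x. (u x, wgrad \<Omega> u x)" "vol \<Omega>" c]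
  by (simp add: L2_Pair H1_L2)

lemma H1_norm_triangle: "u \<in> H1 \<Omega> \<Longrightarrow> v \<in> H1 \<Omega> \<Longrightarrow> H1_norm \<Omega> (\<lambda>x. u x + v x) \<le> H1_norm \<Omega> u + H1_norm \<Omega> v"
  using H1_norm_jet[OF H1_pair_add[OF H1_pair_wgrad H1_pair_wgrad]] H1_norm_jet[OF H1_pair_wgrad]
    L2.nrm_triangle[of "\<lambda>x. (u x, wgrad \<Omega> u x)" "vol \<Omega>" "\<lambda>x. (v x, wgrad \<Omega> v x)"]
  by (simp add: L2_Pair H1_L2)

lemma H1_norm_nonneg: "0 \<le> H1_norm \<Omega> u"
  by (simp add: H1_norm_def)

lemma H1_tendsto_iff:
  assumes p: "\<And>n. H1_pair \<Omega> (u n) (G n)" "H1_pair \<Omega> v H"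
  shows "H1_tendsto \<Omega> u v \<longleftrightarrow> L2_tendsto (vol \<Omega>) u v
      \<and> L2_tendsto (vol \<Omega>) G H"
  unfolding H1_tendsto_def H1_norm_jet[OF H1_pair_diff[OF p]]
  by (rule L2_norm_Pair_tendsto) (intro L2.diff_closed H1_pair_D[OF p(1)] H1_pair_D[OF p(2)])+

lemma H1_tendstoD:
  assumes "\<And>n. u n \<in> H1 \<Omega>" "v \<in> H1 \<Omega>" "H1_tendsto \<Omega> u v"
  shows "L2_tendsto (vol \<Omega>) u v"
    "L2_tendsto (vol \<Omega>) (\<lambda>n. wgrad \<Omega> (u n)) (wgrad \<Omega> v)"
  using H1_tendsto_iff[OF H1_pair_wgrad H1_pair_wgrad] assms by blast+

lemma H1_complete:
  assumes p: "\<And>n. H1_pair \<Omega> (u n) (G n)"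
    and "\<And>e. e > 0 \<Longrightarrow> \<exists>N. \<forall>m\<ge>N. \<forall>n\<ge>N. L2_norm (vol \<Omega>) (\<lambda>x. u m x - u n x) < e"
    and "\<And>e. e > 0 \<Longrightarrow> \<exists>N. \<forall>m\<ge>N. \<forall>n\<ge>N. L2_norm (vol \<Omega>) (\<lambda>x. G m x - G n x) < e"
  obtains v where "v \<in> H1 \<Omega>" "H1_tendsto \<Omega> u v"
proof -
  obtain v where v: "v \<in> Lp (vol \<Omega>) 2" "L2_tendsto (vol \<Omega>) u v"
    using L2_complete[OF fin H1_pair_D(1)[OF p] assms(2)] by blast
  obtain H where H: "H \<in> Lp (vol \<Omega>) 2" "L2_tendsto (vol \<Omega>) G H"
    using L2_complete[OF fin H1_pair_D(2)[OF p] assms(3)] by blast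
  have "H1_pair \<Omega> v H" by (rule H1_pair_limit[OF p v(1) H(1) v(2) H(2)])
  note vH = this
  have "v \<in> H1 \<Omega>" by (rule H1_pair_imp_H1[OF vH])
  moreover have "H1_tendsto \<Omega> u v"
    using H1_tendsto_iff[of u G, OF p vH] v(2) H(2) by simp
  ultimately show thesis using that by blast
qed

end

text \<open>Integration by parts: the derivative of a product of test functions integrates to zero.\<close>

lemma (in bounded_open) test_function_H1:
  assumes \<phi>: "\<phi> \<in> test_functions \<Omega>"
  shows "\<phi> \<in> H1 \<Omega>"
proof (rule H1_pair_imp_H1)
  let ?G = "\<lambda>x. \<Sum>i\<in>Basis. frechet_derivative \<phi> (at x) i *\<^sub>R i"
  have GL: "?G \<in> Lp (vol \<Omega>) 2"
    by (intro L2.sum_closed test_L2(2) test_function_partial[OF \<phi>])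
  have Gi: "?G x \<bullet> i = frechet_derivative \<phi> (at x) i" if "i \<in> Basis" for x i
    using that by (simp add: inner_sum_left inner_Basis if_distrib cong: if_cong)
  have "(LINT x|vol \<Omega>. \<phi> x * frechet_derivative \<psi> (at x) i) = - (LINT x|vol \<Omega>. (?G x \<bullet> i) * \<psi> x)"
    if \<psi>: "\<psi> \<in> test_functions \<Omega>" and i: "i \<in> Basis" for \<psi> i
  proof -
    note t = test_function_times[OF \<phi> \<psi>]
    have 1: "integrable (vol \<Omega>) (\<lambda>x. \<phi> x * frechet_derivative \<psi> (at x) i)"
      "integrable (vol \<Omega>) (\<lambda>x. frechet_derivative \<phi> (at x) i * \<psi> x)"
      using L2_integrable_inner[OF test_L2(1)[OF \<phi>] test_L2(3)[OF \<psi> i]]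
        L2_integrable_inner[OF test_L2(3)[OF \<phi> i] test_L2(1)[OF \<psi>]] by simp_all
    have "(LINT x|vol \<Omega>. \<phi> x * frechet_derivative \<psi> (at x) i) + (LINT x|vol \<Omega>. frechet_derivative \<phi> (at x) i * \<psi> x)
      = (LINT x|vol \<Omega>. frechet_derivative (\<lambda>x. \<phi> x * \<psi> x) (at x) i)"
      using 1 by (simp add: t(2))
    also have "\<dots> = (LINT x|lborel. frechet_derivative (\<lambda>x. \<phi> x * \<psi> x) (at x) i)"
    proof -
      have eq: "indicator \<Omega> x *\<^sub>R frechet_derivative (\<lambda>x. \<phi> x * \<psi> x) (at x) i
        = frechet_derivative (\<lambda>x. \<phi> x * \<psi> x) (at x) i" for x
        using test_function_outside[OF test_function_partial[OF t(1) i], of x]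
        by (cases "x \<in> \<Omega>") simp_all
      then show ?thesis
        unfolding vol_def using borel_set by (subst integral_restrict_space, simp, simp only: eq)
    qed
    also have "\<dots> = 0" by (rule integral_test_function_derivative[OF t(1) i])
    finally show ?thesis using Gi[OF i] by simp
  qed
  then show "H1_pair \<Omega> \<phi> ?G"
    using GL test_L2(1)[OF \<phi>] unfolding H1_pair_def is_weak_gradient_def by blast
qed

lemma grad_form_inner: "grad_form \<Omega> u v = L2_inner (vol \<Omega>) (wgrad \<Omega> u) (wgrad \<Omega> v)"
  by (simp add: grad_form_def L2_inner_def)

lemma (in bounded_open) grad_form_pair:
  assumes "H1_pair \<Omega> u G" "H1_pair \<Omega> v H"
  shows "grad_form \<Omega> u v = L2_inner (vol \<Omega>) G H"
  unfolding grad_form_inner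
  by (rule L2_cong_AE[OF wgrad_AE[OF assms(1)] wgrad_AE[OF assms(2)]])
    (use H1_L2(2)[OF H1_pair_imp_H1[OF assms(1)]] H1_L2(2)[OF H1_pair_imp_H1[OF assms(2)]]
      H1_pair_D(2)[OF assms(1)] H1_pair_D(2)[OF assms(2)] in \<open>auto simp: L2_iff\<close>)

section \<open>Weak gradients on a product region\<close>

locale bounded_open_pair = A: bounded_open \<Omega>1 + B: bounded_open \<Omega>2
  for \<Omega>1 :: "'a::euclidean_space set" and \<Omega>2 :: "'b::euclidean_space set"
begin

lemma swap_regions: "bounded_open_pair \<Omega>2 \<Omega>1"
  by unfold_locales

sublocale finite_pair "vol \<Omega>1" "vol \<Omega>2"
  by unfold_locales

sublocale P: bounded_open "\<Omega>1 \<times> \<Omega>2"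
  by unfold_locales (simp_all add: open_Times bounded_Times A.open_set B.open_set A.bounded_set B.bounded_set)

lemma vol_prod: "vol (\<Omega>1 \<times> \<Omega>2) = vol \<Omega>1 \<Otimes>\<^sub>M vol \<Omega>2"
  by (rule vol_Times) (use A.bounded_set A.borel_set B.bounded_set B.borel_set in auto)

text \<open>A slice of a test function on the product is a test function on the first factor, so the weak
  derivative of \<open>g\<close> can be moved in each slice before integrating over the second variable.\<close>

lemma weak_derivative_tensor_fst:
  assumes g: "H1_pair \<Omega>1 g G" and s: "s \<in> Lp (vol \<Omega>2) 2"
    and \<phi>: "\<phi> \<in> test_functions (\<Omega>1 \<times> \<Omega>2)" and i: "i \<in> Basis"
  shows "L2_inner (vol (\<Omega>1 \<times> \<Omega>2)) (vtensor g s) (\<lambda>z. frechet_derivative \<phi> (at z) (i, 0))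
    = - L2_inner (vol (\<Omega>1 \<times> \<Omega>2)) (vtensor G s) (\<lambda>z. \<phi> z *\<^sub>R i)"
proof -
  note gL = H1_pair_D[OF g]
  have i0: "(i, 0) \<in> (Basis :: ('a \<times> 'b) set)" using i by (simp add: Basis_prod_def)
  note T = P.test_L2[OF \<phi>, unfolded vol_prod]
  have eq: "L2_inner (vol \<Omega>1) (\<lambda>x. vtensor g s (x, y)) (\<lambda>x. frechet_derivative \<phi> (at (x, y)) (i, 0))
    = - L2_inner (vol \<Omega>1) (\<lambda>x. vtensor G s (x, y)) (\<lambda>x. \<phi> (x, y) *\<^sub>R i)" for y
  proof -
    note sl = test_function_slice1[OF \<phi>, of y]
    note slL = A.test_L2[OF sl(1)]
    have "L2_inner (vol \<Omega>1) g (\<lambda>x. frechet_derivative \<phi> (at (x, y)) (i, 0))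
      = - L2_inner (vol \<Omega>1) G (\<lambda>x. \<phi> (x, y) *\<^sub>R i)"
      using g sl i by (auto simp: H1_pair_def is_weak_gradient_iff_inner)
    moreover have "L2_inner (vol \<Omega>1) (\<lambda>x. vtensor g s (x, y)) l = s y * L2_inner (vol \<Omega>1) g l" for l
      by (simp add: L2_inner_def vtensor_def mult.assoc)
    moreover have "L2_inner (vol \<Omega>1) (\<lambda>x. vtensor G s (x, y)) l = s y * L2_inner (vol \<Omega>1) G l" for l
      by (simp add: L2_inner_def vtensor_def)
    ultimately show ?thesis by simp
  qed
  have "L2_inner (vol \<Omega>1 \<Otimes>\<^sub>M vol \<Omega>2) (vtensor g s) (\<lambda>z. frechet_derivative \<phi> (at z) (i, 0))
    = - L2_inner (vol \<Omega>1 \<Otimes>\<^sub>M vol \<Omega>2) (vtensor G s) (\<lambda>z. \<phi> z *\<^sub>R i)"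
    using L2_inner_sections_snd[OF vtensor_L2[OF gL(1) s] T(3)[OF i0]]
      L2_inner_sections_snd[OF vtensor_L2[OF gL(2) s] T(2)[of i]]
    by (simp add: eq)
  then show ?thesis by (simp add: vol_prod)
qed

lemma H1_pair_tensor:
  assumes g: "H1_pair \<Omega>1 g G" and s: "H1_pair \<Omega>2 s S"
  shows "H1_pair (\<Omega>1 \<times> \<Omega>2) (vtensor g s) (\<lambda>z. (vtensor G s z, g (fst z) *\<^sub>R S (snd z)))"
proof -
  interpret Q: bounded_open_pair \<Omega>2 \<Omega>1 by (rule swap_regions)
  note gL = H1_pair_D[OF g] and sL = H1_pair_D[OF s]
  have L: "vtensor g s \<in> Lp (vol (\<Omega>1 \<times> \<Omega>2)) 2" "vtensor G s \<in> Lp (vol (\<Omega>1 \<times> \<Omega>2)) 2"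
    "(\<lambda>z. g (fst z) *\<^sub>R S (snd z)) \<in> Lp (vol (\<Omega>1 \<times> \<Omega>2)) 2"
    using gL sL by (auto simp: vol_prod intro: vtensor_L2 vtensor_swap_L2)
  have "L2_inner (vol (\<Omega>1 \<times> \<Omega>2)) (vtensor g s) (\<lambda>z. frechet_derivative \<phi> (at z) i)
    = - L2_inner (vol (\<Omega>1 \<times> \<Omega>2)) (\<lambda>z. (vtensor G s z, g (fst z) *\<^sub>R S (snd z))) (\<lambda>z. \<phi> z *\<^sub>R i)"
    if \<phi>: "\<phi> \<in> test_functions (\<Omega>1 \<times> \<Omega>2)" and i: "i \<in> Basis" for \<phi> i
    using i
  proof (cases rule: Basis_Pair_cases)
    case (1 j)
    then show ?thesis
      using weak_derivative_tensor_fst[OF g sL(1) \<phi> 1(1)] by (simp add: L2_inner_def)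
  next
    case (2 j)
    have j0: "(j, 0) \<in> (Basis :: ('b \<times> 'a) set)" using 2 by (simp add: Basis_prod_def)
    note sw = test_function_swap[OF \<phi>]
    have [simp]: "vtensor s g (prod.swap z) = vtensor g s z" for z by (simp add: vtensor_def)
    have [simp]: "vtensor S g (prod.swap z) = g (fst z) *\<^sub>R S (snd z)" for z by (simp add: vtensor_def)
    have e1: "L2_inner (vol (\<Omega>2 \<times> \<Omega>1)) (vtensor s g) (\<lambda>z. frechet_derivative (\<lambda>z. \<phi> (prod.swap z)) (at z) (j, 0))
      = L2_inner (vol (\<Omega>1 \<times> \<Omega>2)) (vtensor g s) (\<lambda>z. frechet_derivative \<phi> (at z) (0, j))"
      using Q.L2_inner_swap[OF Q.vtensor_L2[OF sL(1) gL(1)]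
          Q.P.test_L2(3)[OF sw(1) j0, unfolded Q.vol_prod]]
      by (simp add: vol_prod Q.vol_prod sw(2))
    have e2: "L2_inner (vol (\<Omega>2 \<times> \<Omega>1)) (vtensor S g) (\<lambda>z. \<phi> (prod.swap z) *\<^sub>R j)
      = L2_inner (vol (\<Omega>1 \<times> \<Omega>2)) (\<lambda>z. g (fst z) *\<^sub>R S (snd z)) (\<lambda>z. \<phi> z *\<^sub>R j)"
      using Q.L2_inner_swap[OF Q.vtensor_L2[OF sL(2) gL(1)]
          Q.P.test_L2(2)[OF sw(1), of j, unfolded Q.vol_prod]]
      by (simp add: vol_prod Q.vol_prod)
    have "L2_inner (vol (\<Omega>1 \<times> \<Omega>2)) (vtensor g s) (\<lambda>z. frechet_derivative \<phi> (at z) (0, j))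
      = - L2_inner (vol (\<Omega>1 \<times> \<Omega>2)) (\<lambda>z. g (fst z) *\<^sub>R S (snd z)) (\<lambda>z. \<phi> z *\<^sub>R j)"
      using Q.weak_derivative_tensor_fst[OF s gL(1) sw(1) 2(1)] e1 e2 by simp
    then show ?thesis using 2 by (simp add: L2_inner_def)
  qed
  with L show ?thesis
    by (simp add: H1_pair_def is_weak_gradient_iff_inner L2_Pair)
qed

text \<open>Testing the weak gradient of \<open>h\<close> with \<open>\<phi> \<otimes> \<psi>\<close> gives the claim when \<open>s\<close> is a test function
  \<open>\<psi>\<close>. To pass to an arbitrary square-integrable \<open>s\<close>, the difference of the two sides is written as
  the inner product of \<open>\<psi>\<close> with a fixed function of the second variable; this function is orthogonal
  to all test functions and therefore vanishes.\<close>

lemma H1_pair_partial_integral: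
  assumes h: "H1_pair (\<Omega>1 \<times> \<Omega>2) h H" and s: "s \<in> Lp (vol \<Omega>2) 2"
  shows "H1_pair \<Omega>1 (partial_integral (vol \<Omega>2) s h) (partial_integral (vol \<Omega>2) s (\<lambda>z. fst (H z)))"
proof -
  note hL = H1_pair_D[OF h, unfolded vol_prod]
  note fL = L2_fst_snd(1)[OF hL(2)]
  let ?V = "vol \<Omega>1 \<Otimes>\<^sub>M vol \<Omega>2"
  have "L2_inner (vol \<Omega>1) (partial_integral (vol \<Omega>2) s h) (\<lambda>x. frechet_derivative \<phi> (at x) i)
    = - L2_inner (vol \<Omega>1) (partial_integral (vol \<Omega>2) s (\<lambda>z. fst (H z))) (\<lambda>x. \<phi> x *\<^sub>R i)"
    if \<phi>: "\<phi> \<in> test_functions \<Omega>1" and i: "i \<in> Basis" for \<phi> i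
  proof -
    let ?d = "\<lambda>x. frechet_derivative \<phi> (at x) i"
    let ?k = "\<lambda>z. fst (H z) \<bullet> i"
    have i0: "(i, 0) \<in> (Basis :: ('a \<times> 'b) set)" using i by (simp add: Basis_prod_def)
    note T = A.test_L2(1,2)[OF \<phi>] A.test_L2(3)[OF \<phi> i]
    have kL: "?k \<in> Lp ?V 2"
    proof -
      have "integrable ?V (\<lambda>z. ?k z * ?k z)"
      proof (rule Bochner_Integration.integrable_bound)
        show "integrable ?V (\<lambda>z. fst (H z) \<bullet> fst (H z))" using fL by (simp add: L2_iff)
        show "AE z in ?V. norm (?k z * ?k z) \<le> norm (fst (H z) \<bullet> fst (H z))"
        proof (rule AE_I2)
          fix z show "norm (?k z * ?k z) \<le> norm (fst (H z) \<bullet> fst (H z))"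
            using Cauchy_Schwarz_ineq[of "fst (H z)" i] i by (simp add: power2_eq_square inner_Basis)
        qed
      qed (use fL in \<open>auto simp: L2_iff\<close>)
      then show ?thesis using fL by (auto simp: L2_iff)
    qed
    \<comment> \<open>The inner product of \<open>?p\<close> with \<open>\<psi>\<close> is the difference between the two sides of the
      defining equation of the weak gradient of \<open>h\<close>, tested with \<open>\<phi> \<otimes> \<psi>\<close>.\<close>
    let ?p = "\<lambda>y. partial_integral (vol \<Omega>1) ?d (\<lambda>z. h (prod.swap z)) y
        + partial_integral (vol \<Omega>1) \<phi> (\<lambda>z. ?k (prod.swap z)) y"
    interpret Q: bounded_open_pair \<Omega>2 \<Omega>1 by (rule swap_regions)
    have pL: "partial_integral (vol \<Omega>1) ?d (\<lambda>z. h (prod.swap z)) \<in> Lp (vol \<Omega>2) 2"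
      "partial_integral (vol \<Omega>1) \<phi> (\<lambda>z. ?k (prod.swap z)) \<in> Lp (vol \<Omega>2) 2"
      by (rule Q.partial_integral_L2(1)[OF L2_swap[OF hL(1)] T(3)],
          rule Q.partial_integral_L2(1)[OF L2_swap[OF kL] T(1)])
    have p: "L2_inner (vol \<Omega>2) \<psi> ?p = L2_inner ?V (vtensor ?d \<psi>) h + L2_inner ?V (vtensor \<phi> \<psi>) ?k"
      if "\<psi> \<in> Lp (vol \<Omega>2) 2" for \<psi>
      using L2.add_right[OF pL that] inner_partial_integral_swap[OF T(3) hL(1) that]
        inner_partial_integral_swap[OF T(1) kL that] by simp
    have vi: "L2_inner ?V (vtensor \<phi> \<psi>) ?k = L2_inner ?V (vtensor (\<lambda>x. \<phi> x *\<^sub>R i) \<psi>) (\<lambda>z. fst (H z))" for \<psi>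
      by (simp add: L2_inner_def vtensor_def inner_commute)
    have "AE y in vol \<Omega>2. ?p y = 0"
    proof (rule B.L2_test_zero[OF L2.add_closed[OF pL]])
      fix \<psi> assume \<psi>: "\<psi> \<in> test_functions \<Omega>2"
      note ten = test_function_tensor[OF \<phi> \<psi>]
      have "L2_inner ?V h (vtensor ?d \<psi>) = - L2_inner ?V H (\<lambda>z. vtensor \<phi> \<psi> z *\<^sub>R (i, 0))"
      proof -
        have d: "(\<lambda>z. frechet_derivative (vtensor \<phi> \<psi>) (at z) (i, 0)) = vtensor ?d \<psi>"
          by (rule ext) (rule ten(2))
        have "L2_inner (vol (\<Omega>1 \<times> \<Omega>2)) h (\<lambda>z. frechet_derivative (vtensor \<phi> \<psi>) (at z) (i, 0))
          = - L2_inner (vol (\<Omega>1 \<times> \<Omega>2)) H (\<lambda>z. vtensor \<phi> \<psi> z *\<^sub>R (i, 0))"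
          using h ten(1) i0 unfolding H1_pair_def is_weak_gradient_iff_inner by blast
        then show ?thesis unfolding d vol_prod .
      qed
      also have "L2_inner ?V H (\<lambda>z. vtensor \<phi> \<psi> z *\<^sub>R (i, 0)) = L2_inner ?V (vtensor \<phi> \<psi>) ?k"
        by (simp add: L2_inner_def inner_prod_def)
      finally have "L2_inner (vol \<Omega>2) \<psi> ?p = 0"
        using p[OF B.test_L2(1)[OF \<psi>]] L2.sym[of ?V h] by simp
      then show "L2_inner (vol \<Omega>2) ?p \<psi> = 0" by (simp only: L2.sym[of _ ?p])
    qed
    then have "L2_inner (vol \<Omega>2) s ?p = L2_inner (vol \<Omega>2) s (\<lambda>_. 0)"
      by (intro L2_cong_AE) (use s L2.add_closed[OF pL] in \<open>auto simp: L2_iff\<close>)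
    then have "L2_inner ?V (vtensor ?d s) h + L2_inner ?V (vtensor (\<lambda>x. \<phi> x *\<^sub>R i) s) (\<lambda>z. fst (H z)) = 0"
      using p[OF s] vi by (simp add: L2_inner_def)
    then show ?thesis
      using inner_partial_integral[OF T(3) hL(1) s] inner_partial_integral[OF T(2) fL s, of i]
        L2.sym[of "vol \<Omega>1" ?d] L2.sym[of "vol \<Omega>1" "\<lambda>x. \<phi> x *\<^sub>R i"] by simp
  qed
  then show ?thesis
    using partial_integral_L2(1)[OF hL(1) s] partial_integral_L2(1)[OF fL s]
    by (simp add: H1_pair_def is_weak_gradient_iff_inner)
qed

lemma H1_pair_swap:
  assumes h: "H1_pair (\<Omega>1 \<times> \<Omega>2) h H"
  shows "H1_pair (\<Omega>2 \<times> \<Omega>1) (\<lambda>z. h (prod.swap z)) (\<lambda>z. prod.swap (H (prod.swap z)))"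
proof -
  interpret Q: bounded_open_pair \<Omega>2 \<Omega>1 by (rule swap_regions)
  note hL = H1_pair_D[OF h, unfolded vol_prod]
  have sw: "(\<lambda>z. prod.swap (H z)) \<in> Lp (vol \<Omega>1 \<Otimes>\<^sub>M vol \<Omega>2) 2"
    using L2_Pair[OF L2_fst_snd(2)[OF hL(2)] L2_fst_snd(1)[OF hL(2)]] by (simp add: prod.swap_def)
  have L: "(\<lambda>z. h (prod.swap z)) \<in> Lp (vol (\<Omega>2 \<times> \<Omega>1)) 2"
    "(\<lambda>z. prod.swap (H (prod.swap z))) \<in> Lp (vol (\<Omega>2 \<times> \<Omega>1)) 2"
    using L2_swap[OF hL(1)] L2_swap[OF sw] by (simp_all add: Q.vol_prod)
  have "L2_inner (vol (\<Omega>2 \<times> \<Omega>1)) (\<lambda>z. h (prod.swap z)) (\<lambda>z. frechet_derivative \<phi> (at z) i)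
    = - L2_inner (vol (\<Omega>2 \<times> \<Omega>1)) (\<lambda>z. prod.swap (H (prod.swap z))) (\<lambda>z. \<phi> z *\<^sub>R i)"
    if \<phi>: "\<phi> \<in> test_functions (\<Omega>2 \<times> \<Omega>1)" and i: "i \<in> Basis" for \<phi> i
  proof -
    note ts = test_function_swap[OF \<phi>]
    have i': "prod.swap i \<in> Basis" using i by (auto simp: Basis_prod_def)
    have "L2_inner (vol (\<Omega>1 \<times> \<Omega>2)) h (\<lambda>z. frechet_derivative (\<lambda>z. \<phi> (prod.swap z)) (at z) (prod.swap i))
      = - L2_inner (vol (\<Omega>1 \<times> \<Omega>2)) H (\<lambda>z. \<phi> (prod.swap z) *\<^sub>R prod.swap i)"
      using h ts(1) i' by (auto simp: H1_pair_def is_weak_gradient_iff_inner)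
    moreover have "L2_inner (vol (\<Omega>1 \<times> \<Omega>2)) h (\<lambda>z. frechet_derivative (\<lambda>z. \<phi> (prod.swap z)) (at z) (prod.swap i))
      = L2_inner (vol (\<Omega>2 \<times> \<Omega>1)) (\<lambda>z. h (prod.swap z)) (\<lambda>z. frechet_derivative \<phi> (at z) i)"
      using L2_inner_swap[OF hL(1) P.test_L2(3)[OF ts(1) i', unfolded vol_prod]]
      by (simp add: vol_prod Q.vol_prod ts(2))
    moreover have "L2_inner (vol (\<Omega>1 \<times> \<Omega>2)) H (\<lambda>z. \<phi> (prod.swap z) *\<^sub>R prod.swap i)
      = L2_inner (vol (\<Omega>2 \<times> \<Omega>1)) (\<lambda>z. prod.swap (H (prod.swap z))) (\<lambda>z. \<phi> z *\<^sub>R i)"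
    proof -
      have "L2_inner (vol \<Omega>1 \<Otimes>\<^sub>M vol \<Omega>2) H (\<lambda>z. \<phi> (prod.swap z) *\<^sub>R prod.swap i)
        = L2_inner (vol \<Omega>2 \<Otimes>\<^sub>M vol \<Omega>1) (\<lambda>z. H (prod.swap z)) (\<lambda>z. \<phi> z *\<^sub>R prod.swap i)"
        using L2_inner_swap[OF hL(2) P.test_L2(2)[OF ts(1), of "prod.swap i", unfolded vol_prod]] by simp
      then show ?thesis
        by (simp add: vol_prod Q.vol_prod L2_inner_def inner_prod_def add.commute)
    qed
    ultimately show ?thesis by simp
  qed
  with L show ?thesis by (simp add: H1_pair_def is_weak_gradient_iff_inner)
qed

lemma H1_swap: "h \<in> H1 (\<Omega>1 \<times> \<Omega>2) \<Longrightarrow> (\<lambda>z. h (prod.swap z)) \<in> H1 (\<Omega>2 \<times> \<Omega>1)"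
  by (rule H1_pair_imp_H1[OF H1_pair_swap[OF H1_pair_wgrad]])

lemma H1_tensor: "g \<in> H1 \<Omega>1 \<Longrightarrow> s \<in> H1 \<Omega>2 \<Longrightarrow> vtensor g s \<in> H1 (\<Omega>1 \<times> \<Omega>2)"
  by (rule H1_pair_imp_H1[OF H1_pair_tensor[OF H1_pair_wgrad H1_pair_wgrad]])

lemma H1_partial_integral:
  "h \<in> H1 (\<Omega>1 \<times> \<Omega>2) \<Longrightarrow> s \<in> Lp (vol \<Omega>2) 2 \<Longrightarrow> partial_integral (vol \<Omega>2) s h \<in> H1 \<Omega>1"
  by (rule H1_pair_imp_H1[OF H1_pair_partial_integral[OF H1_pair_wgrad]])

lemma H1_norm_swap:
  assumes "h \<in> H1 (\<Omega>1 \<times> \<Omega>2)"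
  shows "H1_norm (\<Omega>2 \<times> \<Omega>1) (\<lambda>z. h (prod.swap z)) = H1_norm (\<Omega>1 \<times> \<Omega>2) h"
proof -
  interpret Q: bounded_open_pair \<Omega>2 \<Omega>1 by (rule swap_regions)
  let ?H = "wgrad (\<Omega>1 \<times> \<Omega>2) h"
  note p = H1_pair_wgrad[OF assms]
  note hL = H1_pair_D[OF p, unfolded vol_prod]
  have "L2_inner (vol \<Omega>2 \<Otimes>\<^sub>M vol \<Omega>1) (\<lambda>z. prod.swap (?H (prod.swap z))) (\<lambda>z. prod.swap (?H (prod.swap z)))
    = L2_inner (vol \<Omega>2 \<Otimes>\<^sub>M vol \<Omega>1) (\<lambda>z. ?H (prod.swap z)) (\<lambda>z. ?H (prod.swap z))"
    by (simp add: L2_inner_def inner_prod_def add.commute)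
  then show ?thesis
    unfolding Q.P.H1_norm_sq[OF H1_pair_swap[OF p]] P.H1_norm_sq[OF p] vol_prod Q.vol_prod
    using L2_inner_swap[OF hL(1) hL(1)] L2_inner_swap[OF hL(2) hL(2)] by simp
qed

lemma H1_tendsto_swap:
  assumes "\<And>n. f n \<in> H1 (\<Omega>1 \<times> \<Omega>2)" "h \<in> H1 (\<Omega>1 \<times> \<Omega>2)" "H1_tendsto (\<Omega>1 \<times> \<Omega>2) f h"
  shows "H1_tendsto (\<Omega>2 \<times> \<Omega>1) (\<lambda>n z. f n (prod.swap z)) (\<lambda>z. h (prod.swap z))"
  using assms(3) H1_norm_swap[OF P.H1_diff[OF assms(1,2)]] by (simp add: H1_tendsto_def)

lemma H1_tendsto_tensor:
  assumes g: "\<And>n. g n \<in> H1 \<Omega>1" "g' \<in> H1 \<Omega>1" "H1_tendsto \<Omega>1 g g'"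
    and s: "\<And>n. s n \<in> H1 \<Omega>2" "s' \<in> H1 \<Omega>2" "H1_tendsto \<Omega>2 s s'"
  shows "H1_tendsto (\<Omega>1 \<times> \<Omega>2) (\<lambda>n. vtensor (g n) (s n)) (vtensor g' s')"
proof -
  note gl = A.H1_tendstoD[OF g] and sl = B.H1_tendstoD[OF s]
  note gL = H1_L2[OF g(1)] H1_L2[OF g(2)] and sL = H1_L2[OF s(1)] H1_L2[OF s(2)]
  note pn = H1_pair_tensor[OF H1_pair_wgrad[OF g(1)] H1_pair_wgrad[OF s(1)]]
  note p = H1_pair_tensor[OF H1_pair_wgrad[OF g(2)] H1_pair_wgrad[OF s(2)]]
  have 1: "L2_tendsto (vol (\<Omega>1 \<times> \<Omega>2)) (\<lambda>n. vtensor (g n) (s n)) (vtensor g' s')"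
    unfolding vol_prod by (intro vtensor_tendsto gl sl gL sL)
  have a: "L2_tendsto (vol \<Omega>1 \<Otimes>\<^sub>M vol \<Omega>2) (\<lambda>n. vtensor (wgrad \<Omega>1 (g n)) (s n)) (vtensor (wgrad \<Omega>1 g') s')"
    by (intro vtensor_tendsto gl sl gL sL)
  have b: "(\<lambda>n. L2_norm (vol \<Omega>1 \<Otimes>\<^sub>M vol \<Omega>2)
      (\<lambda>z. g n (fst z) *\<^sub>R wgrad \<Omega>2 (s n) (snd z) - g' (fst z) *\<^sub>R wgrad \<Omega>2 s' (snd z))) \<longlonglongrightarrow> 0"
    by (intro vtensor_swap_tendsto gl sl gL sL)
  have aL: "(\<lambda>z. vtensor (wgrad \<Omega>1 (g n)) (s n) z - vtensor (wgrad \<Omega>1 g') s' z) \<in> Lp (vol \<Omega>1 \<Otimes>\<^sub>M vol \<Omega>2) 2" for n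
    by (intro L2.diff_closed vtensor_L2 gL sL)
  have bL: "(\<lambda>z. g n (fst z) *\<^sub>R wgrad \<Omega>2 (s n) (snd z) - g' (fst z) *\<^sub>R wgrad \<Omega>2 s' (snd z))
      \<in> Lp (vol \<Omega>1 \<Otimes>\<^sub>M vol \<Omega>2) 2" for n
    by (intro L2.diff_closed vtensor_swap_L2 gL sL)
  have "(\<lambda>n. L2_norm (vol (\<Omega>1 \<times> \<Omega>2)) (\<lambda>z. (vtensor (wgrad \<Omega>1 (g n)) (s n) z, g n (fst z) *\<^sub>R wgrad \<Omega>2 (s n) (snd z))
      - (vtensor (wgrad \<Omega>1 g') s' z, g' (fst z) *\<^sub>R wgrad \<Omega>2 s' (snd z)))) \<longlonglongrightarrow> 0"
    using L2_norm_Pair_tendsto[OF aL bL] a b by (simp add: vol_prod)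
  with 1 show ?thesis
    by (subst P.H1_tendsto_iff[OF pn p]) simp
qed

lemma H1_tendsto_partial_integral:
  assumes f: "\<And>n. f n \<in> H1 (\<Omega>1 \<times> \<Omega>2)" "h \<in> H1 (\<Omega>1 \<times> \<Omega>2)" "H1_tendsto (\<Omega>1 \<times> \<Omega>2) f h"
    and s: "s \<in> Lp (vol \<Omega>2) 2"
  shows "H1_tendsto \<Omega>1 (\<lambda>n. partial_integral (vol \<Omega>2) s (f n)) (partial_integral (vol \<Omega>2) s h)"
proof -
  note pn = H1_pair_partial_integral[OF H1_pair_wgrad[OF f(1)] s]
  note p = H1_pair_partial_integral[OF H1_pair_wgrad[OF f(2)] s]
  note l = P.H1_tendstoD[OF f, unfolded vol_prod]
  note L = H1_L2[OF f(1), unfolded vol_prod] H1_L2[OF f(2), unfolded vol_prod]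
  let ?G = "\<lambda>n. wgrad (\<Omega>1 \<times> \<Omega>2) (f n)" and ?H = "wgrad (\<Omega>1 \<times> \<Omega>2) h"
  have e: "(\<lambda>z. ?G n z - ?H z) = (\<lambda>z. (fst (?G n z) - fst (?H z), snd (?G n z) - snd (?H z)))" for n
    by (auto simp: prod_eq_iff)
  have "L2_tendsto (vol \<Omega>1 \<Otimes>\<^sub>M vol \<Omega>2) (\<lambda>n z. fst (?G n z)) (\<lambda>z. fst (?H z))"
    using l(2) unfolding e
    by (subst (asm) L2_norm_Pair_tendsto) (auto intro!: L2.diff_closed L2_fst_snd L)
  then show ?thesis
    using l(1) by (subst A.H1_tendsto_iff[OF pn p])
      (intro conjI partial_integral_tendsto L2_fst_snd L s)
qed

end

text \<open>The gradient of \<open>g \<otimes> s\<close> is \<open>(\<nabla>g \<otimes> s, g \<otimes> \<nabla>s)\<close>. In each of the two terms the factor that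
  is not differentiated is integrated against \<open>h\<close> first.\<close>

lemma (in bounded_open_pair) grad_form_tensor:
  assumes g: "g \<in> H1 \<Omega>1" and s: "s \<in> H1 \<Omega>2" and h: "h \<in> H1 (\<Omega>1 \<times> \<Omega>2)"
  shows "grad_form (\<Omega>1 \<times> \<Omega>2) (vtensor g s) h
    = grad_form \<Omega>1 g (partial_integral (vol \<Omega>2) s h)
      + grad_form \<Omega>2 s (partial_integral (vol \<Omega>1) g (\<lambda>z. h (prod.swap z)))"
proof -
  interpret Q: bounded_open_pair \<Omega>2 \<Omega>1 by (rule swap_regions)
  let ?V = "vol \<Omega>1 \<Otimes>\<^sub>M vol \<Omega>2"
  let ?H = "wgrad (\<Omega>1 \<times> \<Omega>2) h" and ?G = "wgrad \<Omega>1 g" and ?S = "wgrad \<Omega>2 s"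
  note pg = H1_pair_wgrad[OF g] and ps = H1_pair_wgrad[OF s] and ph = H1_pair_wgrad[OF h]
  note gL = H1_pair_D[OF pg] and sL = H1_pair_D[OF ps] and hL = H1_pair_D[OF ph, unfolded vol_prod]
  note fL = L2_fst_snd[OF hL(2)]
  note vL = vtensor_L2[OF gL(2) sL(1)] vtensor_swap_L2[OF gL(1) sL(2)]
  have "grad_form (\<Omega>1 \<times> \<Omega>2) (vtensor g s) h
    = L2_inner ?V (\<lambda>z. (vtensor ?G s z, g (fst z) *\<^sub>R ?S (snd z))) (\<lambda>z. (fst (?H z), snd (?H z)))"
    using P.grad_form_pair[OF H1_pair_tensor[OF pg ps] ph] by (simp add: vol_prod)
  also have "\<dots> = L2_inner ?V (vtensor ?G s) (\<lambda>z. fst (?H z)) + L2_inner ?V (\<lambda>z. g (fst z) *\<^sub>R ?S (snd z)) (\<lambda>z. snd (?H z))"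
    by (rule L2_inner_Pair[OF vL fL])
  also have "L2_inner ?V (vtensor ?G s) (\<lambda>z. fst (?H z)) = grad_form \<Omega>1 g (partial_integral (vol \<Omega>2) s h)"
    unfolding A.grad_form_pair[OF pg H1_pair_partial_integral[OF ph sL(1)]]
    by (rule inner_partial_integral[OF gL(2) fL(1) sL(1)])
  also have "L2_inner ?V (\<lambda>z. g (fst z) *\<^sub>R ?S (snd z)) (\<lambda>z. snd (?H z))
    = grad_form \<Omega>2 s (partial_integral (vol \<Omega>1) g (\<lambda>z. h (prod.swap z)))"
  proof -
    have "L2_inner ?V (\<lambda>z. g (fst z) *\<^sub>R ?S (snd z)) (\<lambda>z. snd (?H z))
      = L2_inner (vol \<Omega>2 \<Otimes>\<^sub>M vol \<Omega>1) (vtensor ?S g) (\<lambda>z. snd (?H (prod.swap z)))"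
      using L2_inner_swap[OF vL(2) fL(2)] by (simp add: vtensor_def)
    also have "\<dots> = L2_inner (vol \<Omega>2) ?S (partial_integral (vol \<Omega>1) g (\<lambda>z. snd (?H (prod.swap z))))"
      by (rule Q.inner_partial_integral[OF sL(2) L2_swap[OF fL(2)] gL(1)])
    also have "\<dots> = grad_form \<Omega>2 s (partial_integral (vol \<Omega>1) g (\<lambda>z. h (prod.swap z)))"
      using B.grad_form_pair[OF ps Q.H1_pair_partial_integral[OF H1_pair_swap[OF ph] gL(1)]] by simp
    finally show ?thesis .
  qed
  finally show ?thesis .
qed

lemma (in bounded_open_pair) nonzero_on_tensor:
  assumes g: "g \<in> Lp (vol \<Omega>1) 2" "nonzero_on \<Omega>1 g" and s: "nonzero_on \<Omega>2 s"
  shows "nonzero_on (\<Omega>1 \<times> \<Omega>2) (vtensor g s)"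
  unfolding nonzero_on_def
proof
  assume "AE z in vol (\<Omega>1 \<times> \<Omega>2). vtensor g s z = 0"
  then have "AE x in vol \<Omega>1. AE y in vol \<Omega>2. vtensor g s (x, y) = 0"
    unfolding vol_prod by (rule AE_pair)
  then have "AE x in vol \<Omega>1. g x = 0"
  proof eventually_elim
    case (elim x)
    show ?case
    proof (rule ccontr)
      assume "g x \<noteq> 0"
      with elim have "AE y in vol \<Omega>2. s y = 0" by (simp add: vtensor_def)
      with s show False by (simp add: nonzero_on_def)
    qed
  qed
  with g(2) show False by (simp add: nonzero_on_def)
qed

section \<open>Traces\<close>

text \<open>A measure on which traces are taken: on the boundary of a region, or on one face of a product. That
  it lives on the closure makes functions that are Lipschitz on the closure square integrable.\<close>

locale trace_measure = bounded_open \<Omega> + M: finite_measure M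
  for \<Omega> :: "'a::euclidean_space set" and M :: "'a measure" +
  assumes id_measurable: "(\<lambda>x. x) \<in> measurable M borel"
    and space_closure: "space M \<subseteq> closure \<Omega>"
begin

lemma lipschitz_L2:
  assumes "L-lipschitz_on (closure \<Omega>) (\<phi> :: 'a \<Rightarrow> real)"
  shows "\<phi> \<in> Lp M 2"
proof -
  have cont: "continuous_on (closure \<Omega>) \<phi>" using assms by (rule lipschitz_on_continuous_on)
  have "compact (closure \<Omega>)" using bounded_set by simp
  then have "bounded (\<phi> ` closure \<Omega>)" using compact_continuous_image[OF cont] compact_imp_bounded by blast
  then obtain C where C: "\<And>x. x \<in> closure \<Omega> \<Longrightarrow> norm (\<phi> x) \<le> C" by (auto simp: bounded_iff)
  have "(\<lambda>x. indicator (closure \<Omega>) x *\<^sub>R \<phi> x) \<in> borel_measurable borel"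
    using cont by (intro borel_measurable_continuous_on_indicator) auto
  from measurable_compose[OF id_measurable this]
  have "(\<lambda>x. indicator (closure \<Omega>) x *\<^sub>R \<phi> x) \<in> borel_measurable M" .
  then have "\<phi> \<in> borel_measurable M"
    by (rule measurable_cong[THEN iffD1, rotated]) (use space_closure in \<open>auto simp: indicator_def\<close>)
  then show ?thesis using C space_closure by (intro L2_bounded M.finite_measure_axioms) auto
qed

lemma has_trace_obtain:
  assumes "has_trace \<Omega> M u t"
  obtains \<phi> where "\<And>n. \<phi> n \<in> H1 \<Omega>" "\<And>n. \<exists>L. L-lipschitz_on (closure \<Omega>) (\<phi> n)"
    "\<And>n. \<phi> n \<in> Lp M 2" "H1_tendsto \<Omega> \<phi> u" "L2_tendsto M \<phi> t"
proof -
  obtain \<phi> where \<phi>: "\<And>n. \<phi> n \<in> H1 \<Omega>" "\<And>n. \<exists>L. L-lipschitz_on (closure \<Omega>) (\<phi> n)"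
    "H1_tendsto \<Omega> \<phi> u" "Lp_tendsto M 2 \<phi> t" and t: "t \<in> Lp M 2"
    using assms unfolding has_trace_def by blast
  have L: "\<And>n. \<phi> n \<in> Lp M 2" using \<phi>(2) lipschitz_L2 by blast
  with that[OF \<phi>(1,2) L \<phi>(3)] \<phi>(4) t show thesis by (simp add: Lp_tendsto_iff_norm)
qed

lemma has_traceI:
  assumes "t \<in> Lp M 2" "\<And>n. \<phi> n \<in> H1 \<Omega>" "\<And>n. \<exists>L. L-lipschitz_on (closure \<Omega>) (\<phi> n)"
    "H1_tendsto \<Omega> \<phi> u" "L2_tendsto M \<phi> t"
  shows "has_trace \<Omega> M u t"
proof -
  have L: "\<And>n. \<phi> n \<in> Lp M 2" using assms(3) lipschitz_L2 by blast
  then have "Lp_tendsto M 2 \<phi> t" using assms(1,5) by (simp add: Lp_tendsto_iff_norm)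
  with assms show ?thesis unfolding has_trace_def by blast
qed

lemma has_trace_L2: "has_trace \<Omega> M u t \<Longrightarrow> t \<in> Lp M 2"
  by (simp add: has_trace_def)

text \<open>The graph of the trace relation is closed: the approximating Lipschitz functions are chosen
  diagonally.\<close>

lemma has_trace_limit:
  assumes u: "\<And>n. u n \<in> H1 \<Omega>" "v \<in> H1 \<Omega>" "H1_tendsto \<Omega> u v"
    and tr: "\<And>n. has_trace \<Omega> M (u n) (t n)"
    and s: "s \<in> Lp M 2" "L2_tendsto M t s"
  shows "has_trace \<Omega> M v s"
proof -
  note tL = has_trace_L2[OF tr]
  have "\<exists>\<psi>. \<psi> \<in> H1 \<Omega> \<and> (\<exists>L. L-lipschitz_on (closure \<Omega>) \<psi>) \<and> \<psi> \<in> Lp M 2 \<and>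
    H1_norm \<Omega> (\<lambda>x. \<psi> x - u n x) < inverse (Suc n) \<and> L2_norm M (\<lambda>x. \<psi> x - t n x) < inverse (Suc n)" for n
  proof -
    obtain \<phi> where \<phi>: "\<And>n. \<phi> n \<in> H1 \<Omega>" "\<And>n. \<exists>L. L-lipschitz_on (closure \<Omega>) (\<phi> n)"
      "\<And>n. \<phi> n \<in> Lp M 2" "H1_tendsto \<Omega> \<phi> (u n)" "L2_tendsto M \<phi> (t n)"
      using has_trace_obtain[OF tr] by blast
    have pos: "0 < inverse (real (Suc n))" by simp
    have "\<forall>\<^sub>F k in sequentially. H1_norm \<Omega> (\<lambda>x. \<phi> k x - u n x) < inverse (Suc n)"
      using order_tendstoD(2)[OF \<phi>(4)[unfolded H1_tendsto_def] pos] .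
    moreover have "\<forall>\<^sub>F k in sequentially. L2_norm M (\<lambda>x. \<phi> k x - t n x) < inverse (Suc n)"
      using order_tendstoD(2)[OF \<phi>(5) pos] .
    ultimately have "\<forall>\<^sub>F k in sequentially. H1_norm \<Omega> (\<lambda>x. \<phi> k x - u n x) < inverse (Suc n)
      \<and> L2_norm M (\<lambda>x. \<phi> k x - t n x) < inverse (Suc n)"
      by (rule eventually_conj)
    then obtain k where "H1_norm \<Omega> (\<lambda>x. \<phi> k x - u n x) < inverse (Suc n)"
      "L2_norm M (\<lambda>x. \<phi> k x - t n x) < inverse (Suc n)"
      using eventually_happens'[OF sequentially_bot] by blast
    then show ?thesis by (intro exI[of _ "\<phi> k"] conjI \<phi>(1,2,3))
  qed
  then have "\<forall>n. \<exists>\<psi>. \<psi> \<in> H1 \<Omega> \<and> (\<exists>L. L-lipschitz_on (closure \<Omega>) \<psi>) \<and> \<psi> \<in> Lp M 2 \<and>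
    H1_norm \<Omega> (\<lambda>x. \<psi> x - u n x) < inverse (Suc n) \<and> L2_norm M (\<lambda>x. \<psi> x - t n x) < inverse (Suc n)"
    by (rule allI)
  from choice[OF this] obtain \<psi> where \<psi>:
    "\<And>n. \<psi> n \<in> H1 \<Omega>" "\<And>n. \<exists>L. L-lipschitz_on (closure \<Omega>) (\<psi> n)" "\<And>n. \<psi> n \<in> Lp M 2"
    "\<And>n. H1_norm \<Omega> (\<lambda>x. \<psi> n x - u n x) < inverse (Suc n)"
    "\<And>n. L2_norm M (\<lambda>x. \<psi> n x - t n x) < inverse (Suc n)"
    by auto
  have "H1_tendsto \<Omega> \<psi> v"
    unfolding H1_tendsto_def
  proof (rule Lim_null_comparison)
    show "\<forall>\<^sub>F n in sequentially. norm (H1_norm \<Omega> (\<lambda>x. \<psi> n x - v x))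
      \<le> inverse (Suc n) + H1_norm \<Omega> (\<lambda>x. u n x - v x)"
    proof (intro always_eventually allI)
      fix n
      have "H1_norm \<Omega> (\<lambda>x. \<psi> n x - v x) \<le> H1_norm \<Omega> (\<lambda>x. \<psi> n x - u n x) + H1_norm \<Omega> (\<lambda>x. u n x - v x)"
        using H1_norm_triangle[OF H1_diff[OF \<psi>(1) u(1)] H1_diff[OF u(1,2)], of n n n] by simp
      then show "norm (H1_norm \<Omega> (\<lambda>x. \<psi> n x - v x)) \<le> inverse (Suc n) + H1_norm \<Omega> (\<lambda>x. u n x - v x)"
        using \<psi>(4)[of n] by (simp add: H1_norm_nonneg)
    qed
    show "(\<lambda>n. inverse (Suc n) + H1_norm \<Omega> (\<lambda>x. u n x - v x)) \<longlonglongrightarrow> 0"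
      using tendsto_add[OF LIMSEQ_inverse_real_of_nat u(3)[unfolded H1_tendsto_def]] by simp
  qed
  moreover have "L2_tendsto M \<psi> s"
  proof (rule Lim_null_comparison)
    show "\<forall>\<^sub>F n in sequentially. norm (L2_norm M (\<lambda>x. \<psi> n x - s x))
      \<le> inverse (Suc n) + L2_norm M (\<lambda>x. t n x - s x)"
    proof (intro always_eventually allI)
      fix n
      show "norm (L2_norm M (\<lambda>x. \<psi> n x - s x)) \<le> inverse (Suc n) + L2_norm M (\<lambda>x. t n x - s x)"
        using L2.nrm_diff_triangle[OF \<psi>(3) tL s(1), of n n] \<psi>(5)[of n]
          L2.nrm_nonneg[OF L2.diff_closed[OF \<psi>(3) s(1)], of n] by simp
    qed
    show "(\<lambda>n. inverse (Suc n) + L2_norm M (\<lambda>x. t n x - s x)) \<longlonglongrightarrow> 0"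
      using tendsto_add[OF LIMSEQ_inverse_real_of_nat s(2)] by simp
  qed
  ultimately show ?thesis by (rule has_traceI[where \<phi> = \<psi>, OF s(1) \<psi>(1,2)])
qed

lemma has_trace_add:
  assumes u: "u \<in> H1 \<Omega>" "has_trace \<Omega> M u t" and v: "v \<in> H1 \<Omega>" "has_trace \<Omega> M v s"
  shows "has_trace \<Omega> M (\<lambda>x. u x + v x) (\<lambda>x. t x + s x)"
proof -
  obtain \<phi> where \<phi>: "\<And>n. \<phi> n \<in> H1 \<Omega>" "\<And>n. \<exists>L. L-lipschitz_on (closure \<Omega>) (\<phi> n)"
    "\<And>n. \<phi> n \<in> Lp M 2" "H1_tendsto \<Omega> \<phi> u" "L2_tendsto M \<phi> t"
    using has_trace_obtain[OF u(2)] by blast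
  obtain \<psi> where \<psi>: "\<And>n. \<psi> n \<in> H1 \<Omega>" "\<And>n. \<exists>L. L-lipschitz_on (closure \<Omega>) (\<psi> n)"
    "\<And>n. \<psi> n \<in> Lp M 2" "H1_tendsto \<Omega> \<psi> v" "L2_tendsto M \<psi> s"
    using has_trace_obtain[OF v(2)] by blast
  note ts = has_trace_L2[OF u(2)] has_trace_L2[OF v(2)]
  show ?thesis
  proof (rule has_traceI[where \<phi> = "\<lambda>n x. \<phi> n x + \<psi> n x"])
    show "\<exists>L. L-lipschitz_on (closure \<Omega>) (\<lambda>x. \<phi> n x + \<psi> n x)" for n
      using \<phi>(2)[of n] \<psi>(2)[of n] lipschitz_on_add by blast
    show "H1_tendsto \<Omega> (\<lambda>n x. \<phi> n x + \<psi> n x) (\<lambda>x. u x + v x)"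
      unfolding H1_tendsto_def
    proof (rule Lim_null_comparison)
      show "\<forall>\<^sub>F n in sequentially. norm (H1_norm \<Omega> (\<lambda>x. \<phi> n x + \<psi> n x - (u x + v x)))
        \<le> H1_norm \<Omega> (\<lambda>x. \<phi> n x - u x) + H1_norm \<Omega> (\<lambda>x. \<psi> n x - v x)"
      proof (intro always_eventually allI)
        fix n
        show "norm (H1_norm \<Omega> (\<lambda>x. \<phi> n x + \<psi> n x - (u x + v x)))
          \<le> H1_norm \<Omega> (\<lambda>x. \<phi> n x - u x) + H1_norm \<Omega> (\<lambda>x. \<psi> n x - v x)"
          using H1_norm_triangle[OF H1_diff[OF \<phi>(1) u(1)] H1_diff[OF \<psi>(1) v(1)], of n n]
          by (simp add: H1_norm_nonneg algebra_simps)
      qed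
      show "(\<lambda>n. H1_norm \<Omega> (\<lambda>x. \<phi> n x - u x) + H1_norm \<Omega> (\<lambda>x. \<psi> n x - v x)) \<longlonglongrightarrow> 0"
        using tendsto_add[OF \<phi>(4)[unfolded H1_tendsto_def] \<psi>(4)[unfolded H1_tendsto_def]] by simp
    qed
    show "L2_tendsto M (\<lambda>n x. \<phi> n x + \<psi> n x) (\<lambda>x. t x + s x)"
    proof (rule Lim_null_comparison)
      show "\<forall>\<^sub>F n in sequentially. norm (L2_norm M (\<lambda>x. \<phi> n x + \<psi> n x - (t x + s x)))
        \<le> L2_norm M (\<lambda>x. \<phi> n x - t x) + L2_norm M (\<lambda>x. \<psi> n x - s x)"
      proof (intro always_eventually allI)
        fix n
        have e: "(\<lambda>x. \<phi> n x + \<psi> n x - (t x + s x)) = (\<lambda>x. (\<phi> n x - t x) + (\<psi> n x - s x))" by auto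
        note d = L2.diff_closed[OF \<phi>(3) ts(1), of n] L2.diff_closed[OF \<psi>(3) ts(2), of n]
        show "norm (L2_norm M (\<lambda>x. \<phi> n x + \<psi> n x - (t x + s x)))
          \<le> L2_norm M (\<lambda>x. \<phi> n x - t x) + L2_norm M (\<lambda>x. \<psi> n x - s x)"
          unfolding e using L2.nrm_triangle[OF d] L2.nrm_nonneg[OF L2.add_closed[OF d]] by simp
      qed
      show "(\<lambda>n. L2_norm M (\<lambda>x. \<phi> n x - t x) + L2_norm M (\<lambda>x. \<psi> n x - s x)) \<longlonglongrightarrow> 0"
        using tendsto_add[OF \<phi>(5) \<psi>(5)] by simp
    qed
  qed (intro L2.add_closed ts H1_add \<phi> \<psi>)+
qed

lemma has_trace_scale:
  assumes u: "u \<in> H1 \<Omega>" "has_trace \<Omega> M u t"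
  shows "has_trace \<Omega> M (\<lambda>x. c * u x) (\<lambda>x. c * t x)"
proof -
  obtain \<phi> where \<phi>: "\<And>n. \<phi> n \<in> H1 \<Omega>" "\<And>n. \<exists>L. L-lipschitz_on (closure \<Omega>) (\<phi> n)"
    "\<And>n. \<phi> n \<in> Lp M 2" "H1_tendsto \<Omega> \<phi> u" "L2_tendsto M \<phi> t"
    using has_trace_obtain[OF u(2)] by blast
  note tL = has_trace_L2[OF u(2)]
  show ?thesis
  proof (rule has_traceI[where \<phi> = "\<lambda>n x. c * \<phi> n x"])
    show "(\<lambda>x. c * t x) \<in> Lp M 2" using L2.scale_closed[OF tL, of c] by simp
    show "\<exists>L. L-lipschitz_on (closure \<Omega>) (\<lambda>x. c * \<phi> n x)" for n
      using \<phi>(2)[of n] lipschitz_on_cmult_real by blast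
    show "(\<lambda>x. c * \<phi> n x) \<in> H1 \<Omega>" for n by (rule H1_scale[OF \<phi>(1)])
    have "H1_norm \<Omega> (\<lambda>x. c * \<phi> n x - c * u x) = \<bar>c\<bar> * H1_norm \<Omega> (\<lambda>x. \<phi> n x - u x)" for n
      using H1_norm_scale[OF H1_diff[OF \<phi>(1) u(1)], of c n] by (simp add: algebra_simps)
    then show "H1_tendsto \<Omega> (\<lambda>n x. c * \<phi> n x) (\<lambda>x. c * u x)"
      using tendsto_mult_right_zero[OF \<phi>(4)[unfolded H1_tendsto_def], of "\<bar>c\<bar>"] by (simp add: H1_tendsto_def)
    have "L2_norm M (\<lambda>x. c * \<phi> n x - c * t x) = \<bar>c\<bar> * L2_norm M (\<lambda>x. \<phi> n x - t x)" for n
      using L2.nrm_scale[OF L2.diff_closed[OF \<phi>(3) tL], of c n] by (simp add: algebra_simps)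
    then show "L2_tendsto M (\<lambda>n x. c * \<phi> n x) (\<lambda>x. c * t x)"
      using tendsto_mult_right_zero[OF \<phi>(5), of "\<bar>c\<bar>"] by simp
  qed
qed

lemma has_trace_zero: "has_trace \<Omega> M (\<lambda>_. 0) (\<lambda>_. 0)"
  by (rule has_traceI[where \<phi> = "\<lambda>_ _. 0"])
    (auto simp: L2.zero_closed H1_zero H1_tendsto_def L2.nrm_def L2_inner_def
      H1_norm_sq[OF H1_pair_zero] intro: lipschitz_on_constant)

lemma has_trace_sum:
  assumes "\<And>i. i \<in> A \<Longrightarrow> u i \<in> H1 \<Omega>" "\<And>i. i \<in> A \<Longrightarrow> has_trace \<Omega> M (u i) (t i)"
  shows "has_trace \<Omega> M (\<lambda>x. \<Sum>i\<in>A. u i x) (\<lambda>x. \<Sum>i\<in>A. t i x)"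
  using assms
  by (induction A rule: infinite_finite_induct) (auto simp: has_trace_zero intro!: has_trace_add H1_sum)

end

lemma sets_hausdorff_measure [simp]: "sets (hausdorff_measure n) = sets borel"
  and space_hausdorff_measure [simp]: "space (hausdorff_measure n) = UNIV"
  by (simp_all add: hausdorff_measure_def sets.sigma_sets_eq[of borel, simplified])

locale trace_region = bounded_open \<Omega> for \<Omega> :: "'a::euclidean_space set" +
  assumes B2: "cond_B2 \<Omega>"
begin

lemma B1: "cond_B1 \<Omega>"
  using B2[unfolded cond_B2_def] by (rule conjunct1)

lemma trace_exists_unique:
  assumes "u \<in> H1 \<Omega>"
  shows "\<exists>t. has_trace \<Omega> (surf \<Omega>) u t \<and>
    (\<forall>t'. has_trace \<Omega> (surf \<Omega>) u t' \<longrightarrow> (AE x in surf \<Omega>. t' x = t x))"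
  by (rule bspec[OF B2[unfolded cond_B2_def, THEN conjunct2, THEN conjunct2, THEN conjunct2, THEN conjunct1] assms])

lemma compact_trace: "compact_H1_map \<Omega> (surf \<Omega>) 2 (tr \<Omega>)"
  by (rule B2[unfolded cond_B2_def, THEN conjunct2, THEN conjunct2, THEN conjunct2, THEN conjunct2])

lemma bdry_borel: "bdry \<Omega> \<in> sets borel"
  using borel_set by (simp add: bdry_def)

lemma space_surf: "space (surf \<Omega>) = bdry \<Omega>"
  by (simp add: surf_def space_restrict_space)

lemma id_measurable_surf: "(\<lambda>x. x) \<in> measurable (surf \<Omega>) borel"
  unfolding surf_def by (rule measurable_restrict_space1) (simp add: measurable_def)

lemma finite_surf: "finite_measure (surf \<Omega>)"
proof
  let ?H = "hausdorff_measure (DIM('a) - 1) :: 'a measure"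
  obtain \<S> where \<S>: "finite \<S>" "\<Union>\<S> = bdry \<Omega>"
    "\<forall>S\<in>\<S>. closed_lipschitz_surface S \<and> emeasure ?H S < \<infinity>"
    using B1[unfolded cond_B1_def] by blast
  have "S \<in> sets borel" if "S \<in> \<S>" for S
  proof -
    have "compact S" using \<S>(3) that unfolding closed_lipschitz_surface_def by blast
    then show ?thesis by (intro borel_closed compact_imp_closed)
  qed
  then have "emeasure ?H (\<Union>S\<in>\<S>. S) \<le> (\<Sum>S\<in>\<S>. emeasure ?H S)"
    using \<S>(1) by (intro emeasure_subadditive_finite) auto
  also have "\<dots> < \<infinity>" using \<S>(1,3) by (simp add: ennreal_sum_less_top)
  finally have "emeasure ?H (bdry \<Omega>) < \<infinity>" using \<S>(2) by simp
  then show "emeasure (surf \<Omega>) (space (surf \<Omega>)) \<noteq> \<infinity>"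
    using bdry_borel by (simp add: surf_def emeasure_restrict_space space_restrict_space)
qed

sublocale S: trace_measure \<Omega> "surf \<Omega>"
  by (intro trace_measure.intro finite_surf bounded_open_axioms trace_measure_axioms.intro id_measurable_surf)
    (auto simp: space_surf bdry_def)

lemma tr_has_trace:
  assumes "u \<in> H1 \<Omega>"
  shows "has_trace \<Omega> (surf \<Omega>) u (tr \<Omega> u)"
proof -
  obtain t where "has_trace \<Omega> (surf \<Omega>) u t" using trace_exists_unique[OF assms] by (elim exE conjE)
  then show ?thesis unfolding bdry_trace_def by (rule someI[of "has_trace \<Omega> (surf \<Omega>) u"])
qed

lemma tr_L2: "u \<in> H1 \<Omega> \<Longrightarrow> tr \<Omega> u \<in> Lp (surf \<Omega>) 2"
  by (rule S.has_trace_L2[OF tr_has_trace])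

lemma tr_unique:
  assumes "u \<in> H1 \<Omega>" "has_trace \<Omega> (surf \<Omega>) u t"
  shows "AE x in surf \<Omega>. tr \<Omega> u x = t x"
proof -
  obtain t0 where t0: "\<forall>t'. has_trace \<Omega> (surf \<Omega>) u t' \<longrightarrow> (AE x in surf \<Omega>. t' x = t0 x)"
    using trace_exists_unique[OF assms(1)] by (elim exE conjE)
  from t0[rule_format, OF assms(2)] t0[rule_format, OF tr_has_trace[OF assms(1)]] show ?thesis by eventually_elim simp
qed

lemma tr_scale: "u \<in> H1 \<Omega> \<Longrightarrow> AE x in surf \<Omega>. tr \<Omega> (\<lambda>x. c * u x) x = c * tr \<Omega> u x"
  by (intro tr_unique S.has_trace_scale tr_has_trace H1_scale)

lemma tr_norm_scale:
  assumes "u \<in> H1 \<Omega>"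
  shows "L2_norm (surf \<Omega>) (tr \<Omega> (\<lambda>x. c * u x)) = \<bar>c\<bar> * L2_norm (surf \<Omega>) (tr \<Omega> u)"
proof -
  have "L2_norm (surf \<Omega>) (tr \<Omega> (\<lambda>x. c * u x)) = L2_norm (surf \<Omega>) (\<lambda>x. c *\<^sub>R tr \<Omega> u x)"
    by (rule L2_norm_cong_AE)
      (use tr_scale[OF assms, of c] tr_L2[OF H1_scale[OF assms]] tr_L2[OF assms] in \<open>auto simp: L2_iff\<close>)
  then show ?thesis using L2.nrm_scale[OF tr_L2[OF assms], of c] by simp
qed

lemma tr_add: "u \<in> H1 \<Omega> \<Longrightarrow> v \<in> H1 \<Omega> \<Longrightarrow> AE x in surf \<Omega>. tr \<Omega> (\<lambda>x. u x + v x) x = tr \<Omega> u x + tr \<Omega> v x"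
  by (intro tr_unique S.has_trace_add tr_has_trace H1_add)

lemma tr_lincomb:
  assumes "\<And>i. i \<in> A \<Longrightarrow> u i \<in> H1 \<Omega>"
  shows "AE x in surf \<Omega>. tr \<Omega> (\<lambda>x. \<Sum>i\<in>A. c i * u i x) x = (\<Sum>i\<in>A. c i * tr \<Omega> (u i) x)"
  using assms by (intro tr_unique S.has_trace_sum S.has_trace_scale tr_has_trace H1_sum H1_scale)

text \<open>A compact linear map is bounded. If it were not, there would be functions of norm at most 1 whose
  traces have norm \<open>n\<close>, and no subsequence of these traces could converge.\<close>

theorem trace_bounded:
  obtains C where "C \<ge> 0" "\<And>u. u \<in> H1 \<Omega> \<Longrightarrow> L2_norm (surf \<Omega>) (tr \<Omega> u) \<le> C * H1_norm \<Omega> u"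
proof (rule ccontr)
  let ?N = "L2_norm (surf \<Omega>)"
  assume "\<not> thesis"
  with that have "\<exists>u\<in>H1 \<Omega>. ?N (tr \<Omega> u) > real n * H1_norm \<Omega> u" for n
    by (meson not_le of_nat_0_le_iff)
  then obtain u where u: "\<And>n. u n \<in> H1 \<Omega>" "\<And>n. ?N (tr \<Omega> (u n)) > real n * H1_norm \<Omega> (u n)" by metis
  have pos: "?N (tr \<Omega> (u n)) > 0" for n
    using u(2)[of n] H1_norm_nonneg[of "u n"] by (meson le_less_trans mult_nonneg_nonneg of_nat_0_le_iff)
  \<comment> \<open>scaled so that the trace has norm \<open>n\<close>, while the \<open>H\<^sup>1\<close> norm is at most 1\<close>
  define v where "v = (\<lambda>n x. (real n / ?N (tr \<Omega> (u n))) * u n x)"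
  have v: "v n \<in> H1 \<Omega>" for n unfolding v_def by (rule H1_scale[OF u(1)])
  have "H1_norm \<Omega> (v n) = real n / ?N (tr \<Omega> (u n)) * H1_norm \<Omega> (u n)" for n
    unfolding v_def H1_norm_scale[OF u(1)] using pos[of n] by simp
  then have "H1_norm \<Omega> (v n) \<le> 1" for n
    using u(2)[of n] pos[of n] by (simp add: field_simps)
  then have "bounded (range (\<lambda>n. H1_norm \<Omega> (v n)))"
    by (auto simp: bounded_iff H1_norm_nonneg intro!: exI[of _ 1])
  then obtain r w where r: "strict_mono (r :: nat \<Rightarrow> nat)" "w \<in> Lp (surf \<Omega>) 2"
    "Lp_tendsto (surf \<Omega>) 2 (\<lambda>n. tr \<Omega> (v (r n))) w"
    using compact_trace[unfolded compact_H1_map_def, THEN conjunct2, rule_format, of v] v by blast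
  have "(\<lambda>n. ?N (\<lambda>x. tr \<Omega> (v (r n)) x - w x)) \<longlonglongrightarrow> 0"
    using r(3) by (simp add: Lp_tendsto_iff_norm tr_L2[OF v] r(2))
  then have "\<forall>\<^sub>F n in sequentially. ?N (\<lambda>x. tr \<Omega> (v (r n)) x - w x) < 1"
    using order_tendstoD(2) zero_less_one by blast
  then obtain n0 where n0: "\<And>n. n \<ge> n0 \<Longrightarrow> ?N (\<lambda>x. tr \<Omega> (v (r n)) x - w x) < 1"
    by (auto simp: eventually_sequentially)
  obtain n1 :: nat where n1: "real n1 > 1 + ?N w" using reals_Archimedean2 by blast
  define n where "n = max n0 n1"
  have nv: "?N (tr \<Omega> (v k)) = real k" for k
  proof -
    have "?N (tr \<Omega> (v k)) = \<bar>real k / ?N (tr \<Omega> (u k))\<bar> * ?N (tr \<Omega> (u k))"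
      unfolding v_def by (rule tr_norm_scale[OF u(1)])
    then show ?thesis using pos[of k] by simp
  qed
  have "real (r n) \<le> ?N (\<lambda>x. tr \<Omega> (v (r n)) x - w x) + ?N w"
    using L2.nrm_triangle[OF L2.diff_closed[OF tr_L2[OF v] r(2)] r(2), of "r n"] nv by simp
  also have "\<dots> < 1 + ?N w" using n0[of n] by (simp add: n_def)
  also have "\<dots> < real n" using n1 by (simp add: n_def)
  finally show False using seq_suble[OF r(1), of n] by simp
qed

end

section \<open>Traces on the faces of a product region\<close>

lemma lipschitz_vtensor:
  fixes \<phi> :: "'a::euclidean_space \<Rightarrow> real" and \<psi> :: "'b::euclidean_space \<Rightarrow> real"
  assumes K: "compact K1" "compact K2"
    and \<phi>: "L1-lipschitz_on K1 \<phi>" and \<psi>: "L2-lipschitz_on K2 \<psi>"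
  shows "\<exists>L. L-lipschitz_on (K1 \<times> K2) (vtensor \<phi> \<psi>)"
proof -
  obtain B1 where B1: "B1 \<ge> 0" "\<And>x. x \<in> K1 \<Longrightarrow> \<bar>\<phi> x\<bar> \<le> B1"
    using compact_imp_bounded[OF compact_continuous_image[OF lipschitz_on_continuous_on[OF \<phi>] K(1)]]
    unfolding bounded_iff by (metis abs_ge_zero imageI linorder_linear order_trans real_norm_def)
  obtain B2 where B2: "B2 \<ge> 0" "\<And>x. x \<in> K2 \<Longrightarrow> \<bar>\<psi> x\<bar> \<le> B2"
    using compact_imp_bounded[OF compact_continuous_image[OF lipschitz_on_continuous_on[OF \<psi>] K(2)]]
    unfolding bounded_iff by (metis abs_ge_zero imageI linorder_linear order_trans real_norm_def)
  note L = lipschitz_on_nonneg[OF \<phi>] lipschitz_on_nonneg[OF \<psi>]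
  have "(B2 * L1 + B1 * L2)-lipschitz_on (K1 \<times> K2) (vtensor \<phi> \<psi>)"
  proof (rule lipschitz_onI)
    fix z w assume "z \<in> K1 \<times> K2" "w \<in> K1 \<times> K2"
    then obtain x y x' y' where z: "z = (x, y)" "w = (x', y')" "x \<in> K1" "x' \<in> K1" "y \<in> K2" "y' \<in> K2"
      by auto
    have d: "dist x x' \<le> dist z w" "dist y y' \<le> dist z w"
      using dist_fst_le[of z w] dist_snd_le[of z w] z by auto
    have 1: "\<bar>\<phi> x - \<phi> x'\<bar> \<le> L1 * dist z w" "\<bar>\<psi> y - \<psi> y'\<bar> \<le> L2 * dist z w"
      using lipschitz_onD[OF \<phi> z(3,4)] lipschitz_onD[OF \<psi> z(5,6)] mult_left_mono[OF d(1) L(1)]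
        mult_left_mono[OF d(2) L(2)] by (auto simp: dist_real_def)
    have "vtensor \<phi> \<psi> z - vtensor \<phi> \<psi> w = \<psi> y * (\<phi> x - \<phi> x') + \<phi> x' * (\<psi> y - \<psi> y')"
      by (simp add: vtensor_def z algebra_simps)
    then have "\<bar>vtensor \<phi> \<psi> z - vtensor \<phi> \<psi> w\<bar> \<le> \<bar>\<psi> y\<bar> * \<bar>\<phi> x - \<phi> x'\<bar> + \<bar>\<phi> x'\<bar> * \<bar>\<psi> y - \<psi> y'\<bar>"
      by (metis abs_mult abs_triangle_ineq)
    also have "\<dots> \<le> B2 * (L1 * dist z w) + B1 * (L2 * dist z w)"
      using B1 B2 1 z by (intro add_mono mult_mono) auto
    finally show "dist (vtensor \<phi> \<psi> z) (vtensor \<phi> \<psi> w) \<le> (B2 * L1 + B1 * L2) * dist z w"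
      by (simp add: dist_real_def algebra_simps)
  qed (use B1 B2 L in auto)
  then show ?thesis by blast
qed

lemma (in bounded_open) trace_measure_vol: "trace_measure \<Omega> (vol \<Omega>)"
  by (intro trace_measure.intro fin bounded_open_axioms trace_measure_axioms.intro borel_measurable_vol)
    (auto intro: closure_subset[THEN subsetD])

lemma trace_measure_pair:
  assumes "trace_measure \<Omega>1 M" "trace_measure \<Omega>2 N"
  shows "trace_measure (\<Omega>1 \<times> \<Omega>2) (M \<Otimes>\<^sub>M N)"
proof -
  interpret A: trace_measure \<Omega>1 M by fact
  interpret B: trace_measure \<Omega>2 N by fact
  interpret bounded_open_pair \<Omega>1 \<Omega>2 by unfold_locales
  interpret F: finite_pair M N by unfold_locales
  have "fst \<in> borel_measurable (M \<Otimes>\<^sub>M N)" "snd \<in> borel_measurable (M \<Otimes>\<^sub>M N)"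
    using measurable_compose[OF measurable_fst A.id_measurable] measurable_compose[OF measurable_snd B.id_measurable]
    by auto
  from borel_measurable_Pair[OF this]
  have "(\<lambda>z. z) \<in> borel_measurable (M \<Otimes>\<^sub>M N)" by simp
  moreover have "space (M \<Otimes>\<^sub>M N) \<subseteq> closure (\<Omega>1 \<times> \<Omega>2)"
    using A.space_closure B.space_closure by (auto simp: space_pair_measure closure_Times)
  ultimately show ?thesis
    by (intro trace_measure.intro F.finite_MN P.bounded_open_axioms trace_measure_axioms.intro)
qed

text \<open>Exchanging the variables reduces statements about the face \<open>\<Omega>1 \<times> \<partial>\<Omega>2\<close> to the face where
  the boundary variable comes first.\<close>

lemma has_trace_swap:
  assumes M: "trace_measure \<Omega>1 M" and N: "trace_measure \<Omega>2 N"
    and h: "h \<in> H1 (\<Omega>1 \<times> \<Omega>2)" "has_trace (\<Omega>1 \<times> \<Omega>2) (M \<Otimes>\<^sub>M N) h t"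
  shows "has_trace (\<Omega>2 \<times> \<Omega>1) (N \<Otimes>\<^sub>M M) (\<lambda>z. h (prod.swap z)) (\<lambda>z. t (prod.swap z))"
proof -
  interpret A: trace_measure \<Omega>1 M by fact
  interpret B: trace_measure \<Omega>2 N by fact
  interpret bounded_open_pair \<Omega>1 \<Omega>2 by unfold_locales
  interpret F: finite_pair M N by unfold_locales
  interpret T: trace_measure "\<Omega>1 \<times> \<Omega>2" "M \<Otimes>\<^sub>M N" by (rule trace_measure_pair[OF M N])
  interpret T': trace_measure "\<Omega>2 \<times> \<Omega>1" "N \<Otimes>\<^sub>M M" by (rule trace_measure_pair[OF N M])
  obtain \<phi> where \<phi>: "\<And>n. \<phi> n \<in> H1 (\<Omega>1 \<times> \<Omega>2)" "\<And>n. \<exists>L. L-lipschitz_on (closure (\<Omega>1 \<times> \<Omega>2)) (\<phi> n)"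
    "\<And>n. \<phi> n \<in> Lp (M \<Otimes>\<^sub>M N) 2" "H1_tendsto (\<Omega>1 \<times> \<Omega>2) \<phi> h"
    "L2_tendsto (M \<Otimes>\<^sub>M N) \<phi> t"
    using T.has_trace_obtain[OF h(2)] by blast
  note tL = T.has_trace_L2[OF h(2)]
  show ?thesis
  proof (rule T'.has_traceI[where \<phi> = "\<lambda>n z. \<phi> n (prod.swap z)"])
    show "(\<lambda>z. t (prod.swap z)) \<in> Lp (N \<Otimes>\<^sub>M M) 2" by (rule F.L2_swap[OF tL])
    show "(\<lambda>z. \<phi> n (prod.swap z)) \<in> H1 (\<Omega>2 \<times> \<Omega>1)" for n by (rule H1_swap[OF \<phi>(1)])
    show "H1_tendsto (\<Omega>2 \<times> \<Omega>1) (\<lambda>n z. \<phi> n (prod.swap z)) (\<lambda>z. h (prod.swap z))"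
      by (rule H1_tendsto_swap[OF \<phi>(1) h(1) \<phi>(4)])
    show "L2_tendsto (N \<Otimes>\<^sub>M M) (\<lambda>n z. \<phi> n (prod.swap z)) (\<lambda>z. t (prod.swap z))"
      using F.L2_norm_swap[OF L2.diff_closed[OF \<phi>(3) tL]] \<phi>(5) by simp
    fix n
    obtain L where L: "L-lipschitz_on (closure (\<Omega>1 \<times> \<Omega>2)) (\<phi> n)" using \<phi>(2) by blast
    have "L-lipschitz_on (closure (\<Omega>2 \<times> \<Omega>1)) (\<lambda>z. \<phi> n (prod.swap z))"
    proof (rule lipschitz_onI)
      fix z w assume "z \<in> closure (\<Omega>2 \<times> \<Omega>1)" "w \<in> closure (\<Omega>2 \<times> \<Omega>1)"
      then have "prod.swap z \<in> closure (\<Omega>1 \<times> \<Omega>2)" "prod.swap w \<in> closure (\<Omega>1 \<times> \<Omega>2)"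
        by (auto simp: closure_Times)
      from lipschitz_onD[OF L this]
      show "dist (\<phi> n (prod.swap z)) (\<phi> n (prod.swap w)) \<le> L * dist z w"
        by (simp add: dist_prod_def add.commute)
    qed (rule lipschitz_on_nonneg[OF L])
    then show "\<exists>L. L-lipschitz_on (closure (\<Omega>2 \<times> \<Omega>1)) (\<lambda>z. \<phi> n (prod.swap z))" by blast
  qed
qed

text \<open>The approximations are required to be the partial sums of one series, so that differences of
  approximations are again finite sums of tensors.\<close>

definition H1_tensor_series ::
  "'a::euclidean_space set \<Rightarrow> 'b::euclidean_space set \<Rightarrow> ('a \<times> 'b \<Rightarrow> real) \<Rightarrow> bool" where
  "H1_tensor_series \<Omega>1 \<Omega>2 h \<longleftrightarrow> (\<exists>a b. (\<forall>i. a i \<in> H1 \<Omega>1) \<and> (\<forall>i. b i \<in> H1 \<Omega>2) \<and>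
     H1_tendsto (\<Omega>1 \<times> \<Omega>2) (\<lambda>n z. \<Sum>i<n. vtensor (a i) (b i) z) h)"

lemma (in bounded_open_pair) H1_tensor_series_swap:
  assumes "h \<in> H1 (\<Omega>1 \<times> \<Omega>2)" "H1_tensor_series \<Omega>1 \<Omega>2 h"
  shows "H1_tensor_series \<Omega>2 \<Omega>1 (\<lambda>z. h (prod.swap z))"
proof -
  obtain a b where ab: "\<And>i. a i \<in> H1 \<Omega>1" "\<And>i. b i \<in> H1 \<Omega>2"
    and l: "H1_tendsto (\<Omega>1 \<times> \<Omega>2) (\<lambda>n z. \<Sum>i<n::nat. vtensor (a i) (b i) z) h"
    using assms(2) unfolding H1_tensor_series_def by blast
  have "(\<lambda>z. \<Sum>i<n. vtensor (a i) (b i) z) \<in> H1 (\<Omega>1 \<times> \<Omega>2)" for n :: nat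
    by (intro P.H1_sum H1_tensor ab)
  from H1_tendsto_swap[OF this assms(1) l]
  have "H1_tendsto (\<Omega>2 \<times> \<Omega>1) (\<lambda>n z. \<Sum>i<n. vtensor (b i) (a i) z) (\<lambda>z. h (prod.swap z))"
    by (simp add: vtensor_def mult.commute)
  with ab show ?thesis unfolding H1_tensor_series_def by blast
qed

locale trace_pair = X: trace_region \<Omega>1 + Y: trace_region \<Omega>2
  for \<Omega>1 :: "'a::euclidean_space set" and \<Omega>2 :: "'b::euclidean_space set"
begin

sublocale bounded_open_pair \<Omega>1 \<Omega>2
  by unfold_locales

sublocale F: finite_pair "surf \<Omega>1" "vol \<Omega>2"
  by unfold_locales

sublocale T: trace_measure "\<Omega>1 \<times> \<Omega>2" "surf \<Omega>1 \<Otimes>\<^sub>M vol \<Omega>2"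
  by (rule trace_measure_pair[OF X.S.trace_measure_axioms Y.trace_measure_vol])

text \<open>Tensor products of approximating Lipschitz functions of the factors approximate the tensor
  product. The second factor enters through its values in the interior only, but must be approximated
  by Lipschitz functions too; these come from its own trace.\<close>

lemma has_trace_tensor:
  assumes g: "g \<in> H1 \<Omega>1" "has_trace \<Omega>1 (surf \<Omega>1) g t" and v: "v \<in> H1 \<Omega>2"
  shows "has_trace (\<Omega>1 \<times> \<Omega>2) (surf \<Omega>1 \<Otimes>\<^sub>M vol \<Omega>2) (vtensor g v) (vtensor t v)"
proof -
  obtain \<phi> where \<phi>: "\<And>n. \<phi> n \<in> H1 \<Omega>1" "\<And>n. \<exists>L. L-lipschitz_on (closure \<Omega>1) (\<phi> n)"
    "\<And>n. \<phi> n \<in> Lp (surf \<Omega>1) 2" "H1_tendsto \<Omega>1 \<phi> g" "L2_tendsto (surf \<Omega>1) \<phi> t"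
    using X.S.has_trace_obtain[OF g(2)] by blast
  obtain \<psi> where \<psi>: "\<And>n. \<psi> n \<in> H1 \<Omega>2" "\<And>n. \<exists>L. L-lipschitz_on (closure \<Omega>2) (\<psi> n)"
    "\<And>n. \<psi> n \<in> Lp (surf \<Omega>2) 2" "H1_tendsto \<Omega>2 \<psi> v"
    "L2_tendsto (surf \<Omega>2) \<psi> (tr \<Omega>2 v)"
    using Y.S.has_trace_obtain[OF Y.tr_has_trace[OF v]] by blast
  note tL = X.S.has_trace_L2[OF g(2)]
  show ?thesis
  proof (rule T.has_traceI[where \<phi> = "\<lambda>n. vtensor (\<phi> n) (\<psi> n)"])
    show "vtensor t v \<in> Lp (surf \<Omega>1 \<Otimes>\<^sub>M vol \<Omega>2) 2" by (rule F.vtensor_L2[OF tL H1_L2(1)[OF v]])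
    show "vtensor (\<phi> n) (\<psi> n) \<in> H1 (\<Omega>1 \<times> \<Omega>2)" for n by (rule H1_tensor[OF \<phi>(1) \<psi>(1)])
    show "\<exists>L. L-lipschitz_on (closure (\<Omega>1 \<times> \<Omega>2)) (vtensor (\<phi> n) (\<psi> n))" for n
    proof -
      obtain L1 L2 where "L1-lipschitz_on (closure \<Omega>1) (\<phi> n)" "L2-lipschitz_on (closure \<Omega>2) (\<psi> n)"
        using \<phi>(2) \<psi>(2) by blast
      then show ?thesis
        unfolding closure_Times using X.bounded_set Y.bounded_set by (intro lipschitz_vtensor) auto
    qed
    show "H1_tendsto (\<Omega>1 \<times> \<Omega>2) (\<lambda>n. vtensor (\<phi> n) (\<psi> n)) (vtensor g v)"
      by (rule H1_tendsto_tensor[OF \<phi>(1) g(1) \<phi>(4) \<psi>(1) v \<psi>(4)])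
    show "L2_tendsto (surf \<Omega>1 \<Otimes>\<^sub>M vol \<Omega>2) (\<lambda>n. vtensor (\<phi> n) (\<psi> n)) (vtensor t v)"
      by (rule F.vtensor_tendsto[OF \<phi>(3) tL \<phi>(5) H1_L2(1)[OF \<psi>(1)] H1_L2(1)[OF v] Y.H1_tendstoD(1)[OF \<psi>(1) v \<psi>(4)]])
  qed
qed

lemma lipschitz_partial_integral:
  fixes \<phi> :: "'a \<times> 'b \<Rightarrow> real"
  assumes L: "L-lipschitz_on (closure (\<Omega>1 \<times> \<Omega>2)) \<phi>" and s: "s \<in> Lp (vol \<Omega>2) 2"
  shows "(L * (LINT y|vol \<Omega>2. \<bar>s y\<bar>))-lipschitz_on (closure \<Omega>1) (partial_integral (vol \<Omega>2) s \<phi>)"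
proof (rule lipschitz_onI)
  interpret V: trace_measure \<Omega>2 "vol \<Omega>2" by (rule Y.trace_measure_vol)
  have si: "integrable (vol \<Omega>2) s" by (rule L2_integral_norm_le(1)[OF Y.fin s])
  have sl: "integrable (vol \<Omega>2) (\<lambda>y. s y * \<phi> (x, y))" if x: "x \<in> closure \<Omega>1" for x
  proof -
    have "L-lipschitz_on (closure \<Omega>2) (\<lambda>y. \<phi> (x, y))"
    proof (rule lipschitz_onI)
      fix y y' assume "y \<in> closure \<Omega>2" "y' \<in> closure \<Omega>2"
      then show "dist (\<phi> (x, y)) (\<phi> (x, y')) \<le> L * dist y y'"
        using lipschitz_onD[OF L, of "(x, y)" "(x, y')"] x by (simp add: closure_Times dist_prod_def)
    qed (rule lipschitz_on_nonneg[OF L])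
    from L2_integrable_inner[OF s V.lipschitz_L2[OF this]] show ?thesis by simp
  qed
  show "0 \<le> L * (LINT y|vol \<Omega>2. \<bar>s y\<bar>)" using lipschitz_on_nonneg[OF L] by simp
  fix x x' assume x: "x \<in> closure \<Omega>1" "x' \<in> closure \<Omega>1"
  have "dist (partial_integral (vol \<Omega>2) s \<phi> x) (partial_integral (vol \<Omega>2) s \<phi> x')
    = norm (LINT y|vol \<Omega>2. s y * (\<phi> (x, y) - \<phi> (x', y)))"
    using sl[OF x(1)] sl[OF x(2)] by (simp add: partial_integral_def dist_real_def right_diff_distrib)
  also have "\<dots> \<le> (LINT y|vol \<Omega>2. norm (s y * (\<phi> (x, y) - \<phi> (x', y))))"
    by (rule integral_norm_bound)
  also have "\<dots> \<le> (LINT y|vol \<Omega>2. \<bar>s y\<bar> * (L * dist x x'))"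
  proof (rule integral_mono)
    have "integrable (vol \<Omega>2) (\<lambda>y. s y * (\<phi> (x, y) - \<phi> (x', y)))"
      using sl[OF x(1)] sl[OF x(2)] by (simp add: right_diff_distrib)
    then show "integrable (vol \<Omega>2) (\<lambda>y. norm (s y * (\<phi> (x, y) - \<phi> (x', y))))" by (rule integrable_norm)
    show "integrable (vol \<Omega>2) (\<lambda>y. \<bar>s y\<bar> * (L * dist x x'))" using si by simp
    fix y assume "y \<in> space (vol \<Omega>2)"
    then have "y \<in> closure \<Omega>2" using closure_subset[of \<Omega>2] by auto
    then have "\<bar>\<phi> (x, y) - \<phi> (x', y)\<bar> \<le> L * dist x x'"
      using lipschitz_onD[OF L, of "(x, y)" "(x', y)"] x by (simp add: closure_Times dist_prod_def dist_real_def)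
    then show "norm (s y * (\<phi> (x, y) - \<phi> (x', y))) \<le> \<bar>s y\<bar> * (L * dist x x')"
      by (simp add: abs_mult mult_left_mono)
  qed
  also have "\<dots> = L * (LINT y|vol \<Omega>2. \<bar>s y\<bar>) * dist x x'" by simp
  finally show "dist (partial_integral (vol \<Omega>2) s \<phi> x) (partial_integral (vol \<Omega>2) s \<phi> x')
    \<le> L * (LINT y|vol \<Omega>2. \<bar>s y\<bar>) * dist x x'" .
qed

text \<open>Taking the trace in the first variable commutes with integrating over the second one, because
  integration preserves the Lipschitz property and is continuous both for the \<open>H\<^sup>1\<close> norm and for
  the \<open>L\<^sup>2\<close> norm on the face.\<close>

lemma has_trace_partial_integral:
  assumes h: "h \<in> H1 (\<Omega>1 \<times> \<Omega>2)" "has_trace (\<Omega>1 \<times> \<Omega>2) (surf \<Omega>1 \<Otimes>\<^sub>M vol \<Omega>2) h t"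
    and s: "s \<in> Lp (vol \<Omega>2) 2"
  shows "has_trace \<Omega>1 (surf \<Omega>1) (partial_integral (vol \<Omega>2) s h) (partial_integral (vol \<Omega>2) s t)"
proof -
  obtain \<phi> where \<phi>: "\<And>n. \<phi> n \<in> H1 (\<Omega>1 \<times> \<Omega>2)" "\<And>n. \<exists>L. L-lipschitz_on (closure (\<Omega>1 \<times> \<Omega>2)) (\<phi> n)"
    "\<And>n. \<phi> n \<in> Lp (surf \<Omega>1 \<Otimes>\<^sub>M vol \<Omega>2) 2" "H1_tendsto (\<Omega>1 \<times> \<Omega>2) \<phi> h"
    "L2_tendsto (surf \<Omega>1 \<Otimes>\<^sub>M vol \<Omega>2) \<phi> t"
    using T.has_trace_obtain[OF h(2)] by blast
  note tL = T.has_trace_L2[OF h(2)]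
  show ?thesis
  proof (rule X.S.has_traceI[where \<phi> = "\<lambda>n. partial_integral (vol \<Omega>2) s (\<phi> n)"])
    show "partial_integral (vol \<Omega>2) s t \<in> Lp (surf \<Omega>1) 2" by (rule F.partial_integral_L2(1)[OF tL s])
    show "partial_integral (vol \<Omega>2) s (\<phi> n) \<in> H1 \<Omega>1" for n by (rule H1_partial_integral[OF \<phi>(1) s])
    show "\<exists>L. L-lipschitz_on (closure \<Omega>1) (partial_integral (vol \<Omega>2) s (\<phi> n))" for n
    proof -
      obtain L where "L-lipschitz_on (closure (\<Omega>1 \<times> \<Omega>2)) (\<phi> n)" using \<phi>(2) by blast
      from lipschitz_partial_integral[OF this s] show ?thesis by (rule exI)
    qed
    show "H1_tendsto \<Omega>1 (\<lambda>n. partial_integral (vol \<Omega>2) s (\<phi> n)) (partial_integral (vol \<Omega>2) s h)"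
      by (rule H1_tendsto_partial_integral[OF \<phi>(1) h(1) \<phi>(4) s])
    show "L2_tendsto (surf \<Omega>1) (\<lambda>n. partial_integral (vol \<Omega>2) s (\<phi> n)) (partial_integral (vol \<Omega>2) s t)"
      by (rule F.partial_integral_tendsto[OF \<phi>(3) tL s \<phi>(5)])
  qed
qed

text \<open>The partial integrals of a trace of \<open>h\<close> are traces of partial integrals of \<open>h\<close>, and those are
  unique on the first factor.\<close>

lemma face_trace_unique:
  assumes h: "h \<in> H1 (\<Omega>1 \<times> \<Omega>2)"
    and t: "has_trace (\<Omega>1 \<times> \<Omega>2) (surf \<Omega>1 \<Otimes>\<^sub>M vol \<Omega>2) h t"
    and t': "has_trace (\<Omega>1 \<times> \<Omega>2) (surf \<Omega>1 \<Otimes>\<^sub>M vol \<Omega>2) h t'"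
  shows "AE z in surf \<Omega>1 \<Otimes>\<^sub>M vol \<Omega>2. t z = t' z"
proof -
  note tL = T.has_trace_L2[OF t] T.has_trace_L2[OF t']
  have "AE z in surf \<Omega>1 \<Otimes>\<^sub>M vol \<Omega>2. t z - t' z = 0"
  proof (rule F.L2_zero_if_partial_integrals_zero)
    show "(\<lambda>z. t z - t' z) \<in> Lp (surf \<Omega>1 \<Otimes>\<^sub>M vol \<Omega>2) 2" by (rule L2.diff_closed[OF tL])
    fix B assume B: "B \<in> sets (vol \<Omega>2)"
    have iB: "(indicator B :: 'b \<Rightarrow> real) \<in> Lp (vol \<Omega>2) 2"
      by (rule L2_bounded[OF Y.fin, of _ 1]) (use B in \<open>auto simp: indicator_def\<close>)
    have H: "partial_integral (vol \<Omega>2) (indicator B) h \<in> H1 \<Omega>1" by (rule H1_partial_integral[OF h iB])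
    show "AE x in surf \<Omega>1. partial_integral (vol \<Omega>2) (indicator B) (\<lambda>z. t z - t' z) x = 0"
      using X.tr_unique[OF H has_trace_partial_integral[OF h t iB]]
        X.tr_unique[OF H has_trace_partial_integral[OF h t' iB]]
        F.partial_integral_diff[OF tL iB]
      by eventually_elim simp
  qed
  then show ?thesis by eventually_elim simp
qed

text \<open>The trace inequality of the first factor, applied in each slice. It involves the full
  \<open>H\<^sup>1\<close> norm of the slice but no derivative in the second variable.\<close>

lemma tensor_trace_bound:
  assumes C: "C \<ge> 0" "\<And>u. u \<in> H1 \<Omega>1 \<Longrightarrow> L2_norm (surf \<Omega>1) (tr \<Omega>1 u) \<le> C * H1_norm \<Omega>1 u"
    and a: "\<And>i. i \<in> A \<Longrightarrow> a i \<in> H1 \<Omega>1" and b: "\<And>i. i \<in> A \<Longrightarrow> b i \<in> H1 \<Omega>2"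
  shows "L2_norm (surf \<Omega>1 \<Otimes>\<^sub>M vol \<Omega>2) (\<lambda>z. \<Sum>i\<in>A. vtensor (tr \<Omega>1 (a i)) (b i) z)
    \<le> C * H1_norm (\<Omega>1 \<times> \<Omega>2) (\<lambda>z. \<Sum>i\<in>A. vtensor (a i) (b i) z)"
proof -
  let ?t = "\<lambda>z. \<Sum>i\<in>A. vtensor (tr \<Omega>1 (a i)) (b i) z"
  let ?F = "\<lambda>z. \<Sum>i\<in>A. vtensor (a i) (b i) z"
  let ?j = "\<lambda>i x. (a i x, wgrad \<Omega>1 (a i) x)"
  let ?J = "\<lambda>z. \<Sum>i\<in>A. vtensor (?j i) (b i) z"
  have trL: "\<And>i. i \<in> A \<Longrightarrow> tr \<Omega>1 (a i) \<in> Lp (surf \<Omega>1) 2" using a by (intro X.tr_L2)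
  have jL: "\<And>i. i \<in> A \<Longrightarrow> ?j i \<in> Lp (vol \<Omega>1) 2" using a by (intro L2_Pair H1_L2)
  have bL: "\<And>i. i \<in> A \<Longrightarrow> b i \<in> Lp (vol \<Omega>2) 2" using b by (intro H1_L2)
  let ?T = "\<lambda>y. L2_inner (surf \<Omega>1) (\<lambda>x. \<Sum>i\<in>A. b i y *\<^sub>R tr \<Omega>1 (a i) x) (\<lambda>x. \<Sum>i\<in>A. b i y *\<^sub>R tr \<Omega>1 (a i) x)"
  let ?K = "\<lambda>y. L2_inner (vol \<Omega>1) (\<lambda>x. \<Sum>i\<in>A. b i y *\<^sub>R ?j i x) (\<lambda>x. \<Sum>i\<in>A. b i y *\<^sub>R ?j i x)"
  have It: "integrable (vol \<Omega>2) ?T" "L2_inner (surf \<Omega>1 \<Otimes>\<^sub>M vol \<Omega>2) ?t ?t = (LINT y|vol \<Omega>2. ?T y)"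
    by (rule F.inner_sum_vtensor[OF trL bL]; assumption)+
  have Ij: "integrable (vol \<Omega>2) ?K" "L2_inner (vol \<Omega>1 \<Otimes>\<^sub>M vol \<Omega>2) ?J ?J = (LINT y|vol \<Omega>2. ?K y)"
    by (rule inner_sum_vtensor[OF jL bL]; assumption)+
  have le: "?T y \<le> C\<^sup>2 * ?K y" for y
  proof -
    let ?u = "\<lambda>x. \<Sum>i\<in>A. b i y * a i x"
    have uH: "?u \<in> H1 \<Omega>1" using a by (intro X.H1_sum X.H1_scale)
    have p: "H1_pair \<Omega>1 ?u (\<lambda>x. \<Sum>i\<in>A. b i y *\<^sub>R wgrad \<Omega>1 (a i) x)"
      using a by (intro X.H1_pair_sum X.H1_pair_scale H1_pair_wgrad)
    have sL: "(\<lambda>x. \<Sum>i\<in>A. b i y *\<^sub>R tr \<Omega>1 (a i) x) \<in> Lp (surf \<Omega>1) 2"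
      using trL by (intro L2.sum_closed L2.scale_closed)
    have "L2_inner (surf \<Omega>1) (\<lambda>x. \<Sum>i\<in>A. b i y *\<^sub>R tr \<Omega>1 (a i) x) (\<lambda>x. \<Sum>i\<in>A. b i y *\<^sub>R tr \<Omega>1 (a i) x)
      = L2_inner (surf \<Omega>1) (tr \<Omega>1 ?u) (tr \<Omega>1 ?u)"
    proof -
      have "AE x in surf \<Omega>1. (\<Sum>i\<in>A. b i y *\<^sub>R tr \<Omega>1 (a i) x) = tr \<Omega>1 ?u x"
        using X.tr_lincomb[OF a, of A "\<lambda>i. i" "\<lambda>i. b i y"] by (auto elim!: eventually_mono)
      then show ?thesis
        using L2_measurable[OF sL] L2_measurable[OF X.tr_L2[OF uH]] by (intro L2_cong_AE)
    qed
    also have "\<dots> = (L2_norm (surf \<Omega>1) (tr \<Omega>1 ?u))\<^sup>2" using L2.nrm_sq[OF X.tr_L2[OF uH]] by simp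
    also have "\<dots> \<le> (C * H1_norm \<Omega>1 ?u)\<^sup>2"
      using C(2)[OF uH] L2.nrm_nonneg[OF X.tr_L2[OF uH]] by (intro power_mono)
    also have "\<dots> = C\<^sup>2 * L2_inner (vol \<Omega>1) (\<lambda>x. (?u x, \<Sum>i\<in>A. b i y *\<^sub>R wgrad \<Omega>1 (a i) x))
        (\<lambda>x. (?u x, \<Sum>i\<in>A. b i y *\<^sub>R wgrad \<Omega>1 (a i) x))"
      unfolding X.H1_norm_jet[OF p] power_mult_distrib
      using L2.nrm_sq[OF L2_Pair[OF H1_pair_D(1)[OF p] H1_pair_D(2)[OF p]]] by simp
    also have "(\<lambda>x. (?u x, \<Sum>i\<in>A. b i y *\<^sub>R wgrad \<Omega>1 (a i) x)) = (\<lambda>x. \<Sum>i\<in>A. b i y *\<^sub>R ?j i x)"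
      by (simp add: sum_prod)
    finally show ?thesis .
  qed
  have "L2_inner (surf \<Omega>1 \<Otimes>\<^sub>M vol \<Omega>2) ?t ?t \<le> C\<^sup>2 * L2_inner (vol \<Omega>1 \<Otimes>\<^sub>M vol \<Omega>2) ?J ?J"
  proof -
    have "(LINT y|vol \<Omega>2. ?T y) \<le> (LINT y|vol \<Omega>2. C\<^sup>2 * ?K y)"
      by (rule integral_mono[OF It(1) integrable_mult_right[OF Ij(1)] le])
    then show ?thesis unfolding Ij(2) It(2) by simp
  qed
  also have "L2_inner (vol \<Omega>1 \<Otimes>\<^sub>M vol \<Omega>2) ?J ?J \<le> (H1_norm (\<Omega>1 \<times> \<Omega>2) ?F)\<^sup>2"
  proof -
    let ?G = "\<lambda>z. \<Sum>i\<in>A. vtensor (wgrad \<Omega>1 (a i)) (b i) z"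
    let ?H = "\<lambda>z. \<Sum>i\<in>A. a i (fst z) *\<^sub>R wgrad \<Omega>2 (b i) (snd z)"
    have gL: "?G \<in> Lp (vol \<Omega>1 \<Otimes>\<^sub>M vol \<Omega>2) 2" "?H \<in> Lp (vol \<Omega>1 \<Otimes>\<^sub>M vol \<Omega>2) 2"
      "?F \<in> Lp (vol \<Omega>1 \<Otimes>\<^sub>M vol \<Omega>2) 2"
      using a b by (auto intro!: L2.sum_closed vtensor_L2 vtensor_swap_L2 H1_L2)
    have "H1_pair (\<Omega>1 \<times> \<Omega>2) ?F (\<lambda>z. \<Sum>i\<in>A. (vtensor (wgrad \<Omega>1 (a i)) (b i) z, a i (fst z) *\<^sub>R wgrad \<Omega>2 (b i) (snd z)))"
      using a b by (intro P.H1_pair_sum H1_pair_tensor H1_pair_wgrad)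
    then have p: "H1_pair (\<Omega>1 \<times> \<Omega>2) ?F (\<lambda>z. (?G z, ?H z))" by (simp add: sum_prod)
    have "?J = (\<lambda>z. (?F z, ?G z))" by (simp add: vtensor_def sum_prod)
    then have "L2_inner (vol \<Omega>1 \<Otimes>\<^sub>M vol \<Omega>2) ?J ?J
      = L2_inner (vol \<Omega>1 \<Otimes>\<^sub>M vol \<Omega>2) ?F ?F + L2_inner (vol \<Omega>1 \<Otimes>\<^sub>M vol \<Omega>2) ?G ?G"
      using L2_inner_Pair[OF gL(3,1,3,1)] by simp
    also have "\<dots> \<le> L2_inner (vol \<Omega>1 \<Otimes>\<^sub>M vol \<Omega>2) ?F ?F
      + (L2_inner (vol \<Omega>1 \<Otimes>\<^sub>M vol \<Omega>2) ?G ?G + L2_inner (vol \<Omega>1 \<Otimes>\<^sub>M vol \<Omega>2) ?H ?H)"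
      using L2.nonneg[OF gL(2)] by simp
    also have "\<dots> = (H1_norm (\<Omega>1 \<times> \<Omega>2) ?F)\<^sup>2"
      unfolding P.H1_norm_sq[OF p] vol_prod L2_inner_Pair[OF gL(1,2,1,2)]
      using L2.nonneg[OF gL(1)] L2.nonneg[OF gL(2)] L2.nonneg[OF gL(3)] by simp
    finally show ?thesis .
  qed
  finally have "L2_inner (surf \<Omega>1 \<Otimes>\<^sub>M vol \<Omega>2) ?t ?t \<le> (C * H1_norm (\<Omega>1 \<times> \<Omega>2) ?F)\<^sup>2"
    by (simp add: power_mult_distrib mult_left_mono)
  then show ?thesis
    unfolding L2.nrm_def using C(1) by (intro real_le_lsqrt) (auto simp: P.H1_norm_nonneg)
qed

text \<open>The traces of the partial sums of a tensor series are explicit. By the trace inequality they form a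
  Cauchy sequence, and its limit is a trace of \<open>h\<close>.\<close>

lemma face_trace_exists:
  assumes h: "h \<in> H1 (\<Omega>1 \<times> \<Omega>2)" and series: "H1_tensor_series \<Omega>1 \<Omega>2 h"
  obtains t where "has_trace (\<Omega>1 \<times> \<Omega>2) (surf \<Omega>1 \<Otimes>\<^sub>M vol \<Omega>2) h t"
proof -
  obtain C where C: "C \<ge> 0" "\<And>u. u \<in> H1 \<Omega>1 \<Longrightarrow> L2_norm (surf \<Omega>1) (tr \<Omega>1 u) \<le> C * H1_norm \<Omega>1 u"
    using X.trace_bounded by blast
  obtain a b where ab: "\<And>i. a i \<in> H1 \<Omega>1" "\<And>i. b i \<in> H1 \<Omega>2"
    and l: "H1_tendsto (\<Omega>1 \<times> \<Omega>2) (\<lambda>n z. \<Sum>i<n::nat. vtensor (a i) (b i) z) h"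
    using series unfolding H1_tensor_series_def by blast
  define u where "u = (\<lambda>(n::nat) z. \<Sum>i<n. vtensor (a i) (b i) z)"
  define t where "t = (\<lambda>(n::nat) z. \<Sum>i<n. vtensor (tr \<Omega>1 (a i)) (b i) z)"
  let ?N = "L2_norm (surf \<Omega>1 \<Otimes>\<^sub>M vol \<Omega>2)" and ?H = "H1_norm (\<Omega>1 \<times> \<Omega>2)"
  have l: "(\<lambda>n. ?H (\<lambda>z. u n z - h z)) \<longlonglongrightarrow> 0" using l by (simp add: H1_tendsto_def u_def)
  have u: "u n \<in> H1 (\<Omega>1 \<times> \<Omega>2)" for n unfolding u_def by (intro P.H1_sum H1_tensor ab)
  have ut: "has_trace (\<Omega>1 \<times> \<Omega>2) (surf \<Omega>1 \<Otimes>\<^sub>M vol \<Omega>2) (u n) (t n)" for n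
    unfolding u_def t_def by (intro T.has_trace_sum H1_tensor has_trace_tensor X.tr_has_trace ab)
  note tL = T.has_trace_L2[OF ut]
  have le: "?N (\<lambda>z. t m z - t n z) \<le> C * ?H (\<lambda>z. u m z - u n z)" if "n \<le> m" for m n
  proof -
    have "(\<lambda>z. t m z - t n z) = (\<lambda>z. \<Sum>i\<in>{n..<m}. vtensor (tr \<Omega>1 (a i)) (b i) z)"
      "(\<lambda>z. u m z - u n z) = (\<lambda>z. \<Sum>i\<in>{n..<m}. vtensor (a i) (b i) z)"
      using sum_diff_nat_ivl[of 0 n m] that by (auto simp: t_def u_def atLeast0LessThan)
    then show ?thesis using tensor_trace_bound[OF C, of "{n..<m}" a b] ab by simp
  qed
  have cauchy: "\<exists>K. \<forall>m\<ge>K. \<forall>n\<ge>K. ?N (\<lambda>z. t m z - t n z) < e" if "e > 0" for e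
  proof -
    have pos: "e / (2 * (C + 1)) > 0" using that C(1) by simp
    have "\<forall>\<^sub>F n in sequentially. ?H (\<lambda>z. u n z - h z) < e / (2 * (C + 1))"
      by (rule order_tendstoD(2)[OF l pos])
    then obtain K where K: "\<And>n. n \<ge> K \<Longrightarrow> ?H (\<lambda>z. u n z - h z) < e / (2 * (C + 1))"
      by (auto simp: eventually_sequentially)
    have half: "?N (\<lambda>z. t m z - t n z) < e" if mn: "n \<ge> K" "n \<le> m" for m n
    proof -
      have eq: "(\<lambda>z. u m z - u n z) = (\<lambda>z. (u m z - h z) + (- 1) * (u n z - h z))" by auto
      have "?H (\<lambda>z. u m z - u n z) \<le> ?H (\<lambda>z. u m z - h z) + ?H (\<lambda>z. u n z - h z)"
        unfolding eq using P.H1_norm_triangle[OF P.H1_diff[OF u h] P.H1_scale[OF P.H1_diff[OF u h]], of m "-1" n]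
          P.H1_norm_scale[OF P.H1_diff[OF u h], of "-1" n] by simp
      also have "\<dots> < e / (C + 1)"
        using K[of m] K[of n] mn C(1) by (simp add: field_simps)
      finally have "(C + 1) * ?H (\<lambda>z. u m z - u n z) < e"
        using C(1) by (simp add: field_simps)
      moreover have "C * ?H (\<lambda>z. u m z - u n z) \<le> (C + 1) * ?H (\<lambda>z. u m z - u n z)"
        by (intro mult_right_mono P.H1_norm_nonneg) simp
      ultimately show ?thesis using le[OF mn(2)] by simp
    qed
    have "?N (\<lambda>z. t m z - t n z) < e" if "m \<ge> K" "n \<ge> K" for m n
      using half[of n m] half[of m n] that L2.nrm_minus_commute[OF tL tL, of m n] by (cases "n \<le> m") auto
    then show ?thesis by blast
  qed
  obtain s where s: "s \<in> Lp (surf \<Omega>1 \<Otimes>\<^sub>M vol \<Omega>2) 2" "(\<lambda>n. ?N (\<lambda>z. t n z - s z)) \<longlonglongrightarrow> 0"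
    using L2_complete[OF F.finite_MN tL cauchy] by blast
  have "has_trace (\<Omega>1 \<times> \<Omega>2) (surf \<Omega>1 \<Otimes>\<^sub>M vol \<Omega>2) h s"
    by (rule T.has_trace_limit[OF u h _ ut s]) (simp add: H1_tendsto_def l)
  then show thesis by (rule that)
qed

text \<open>The trace of \<open>g \<otimes> s\<close> on the face is the trace of \<open>g\<close> times \<open>s\<close>, and integrating the trace of
  \<open>h\<close> against \<open>s\<close> gives the trace of the partial integral of \<open>h\<close>.\<close>

theorem face_integral_tensor:
  assumes b: "b \<in> borel_measurable (surf \<Omega>1)" "AE x in surf \<Omega>1. \<bar>b x\<bar> \<le> K"
    and g: "g \<in> H1 \<Omega>1" and s: "s \<in> H1 \<Omega>2" and h: "h \<in> H1 (\<Omega>1 \<times> \<Omega>2)"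
    and tu: "has_trace (\<Omega>1 \<times> \<Omega>2) (surf \<Omega>1 \<Otimes>\<^sub>M vol \<Omega>2) (vtensor g s) tu"
    and th: "has_trace (\<Omega>1 \<times> \<Omega>2) (surf \<Omega>1 \<Otimes>\<^sub>M vol \<Omega>2) h th"
  shows "(LINT y|vol \<Omega>2. LINT x|surf \<Omega>1. b x * tu (x, y) * th (x, y))
    = bdry_form \<Omega>1 b g (partial_integral (vol \<Omega>2) s h)"
proof -
  let ?M = "surf \<Omega>1 \<Otimes>\<^sub>M vol \<Omega>2"
  let ?H = "partial_integral (vol \<Omega>2) s h"
  note sL = H1_L2(1)[OF s] and thL = T.has_trace_L2[OF th] and tuL = T.has_trace_L2[OF tu]
  have H: "?H \<in> H1 \<Omega>1" by (rule H1_partial_integral[OF h sL])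
  have bg: "(\<lambda>x. b x * tr \<Omega>1 g x) \<in> Lp (surf \<Omega>1) 2"
    using L2_mult_bounded[OF X.tr_L2[OF g] b] by simp
  note vL = F.vtensor_L2[OF bg sL]
  have eqAE: "AE z in ?M. b (fst z) * tu z = vtensor (\<lambda>x. b x * tr \<Omega>1 g x) s z"
    using face_trace_unique[OF H1_tensor[OF g s] tu has_trace_tensor[OF g X.tr_has_trace[OF g] s]]
    by eventually_elim (simp add: vtensor_def)
  have btu_meas: "(\<lambda>z. b (fst z) * tu z) \<in> borel_measurable ?M"
    using measurable_compose[OF measurable_fst b(1)] L2_measurable[OF tuL] by (rule borel_measurable_times)
  have btuL: "(\<lambda>z. b (fst z) * tu z) \<in> Lp ?M 2"
    by (rule L2_AE_cong[OF vL]) (use eqAE btu_meas in \<open>auto elim!: eventually_mono\<close>)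
  have "(LINT y|vol \<Omega>2. LINT x|surf \<Omega>1. b x * tu (x, y) * th (x, y))
    = L2_inner ?M (\<lambda>z. b (fst z) * tu z) th"
    using F.L2_inner_sections_snd[OF btuL thL] by (simp add: L2_inner_def)
  also have "\<dots> = L2_inner ?M (vtensor (\<lambda>x. b x * tr \<Omega>1 g x) s) th"
    by (rule L2_cong_AE[OF eqAE]) (use btu_meas L2_measurable[OF vL] L2_measurable[OF thL] in auto)
  also have "\<dots> = L2_inner (surf \<Omega>1) (\<lambda>x. b x * tr \<Omega>1 g x) (partial_integral (vol \<Omega>2) s th)"
    by (rule F.inner_partial_integral[OF bg thL sL])
  also have "\<dots> = L2_inner (surf \<Omega>1) (\<lambda>x. b x * tr \<Omega>1 g x) (tr \<Omega>1 ?H)"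
  proof (rule L2_cong_AE)
    show "AE x in surf \<Omega>1. partial_integral (vol \<Omega>2) s th x = tr \<Omega>1 ?H x"
      using X.tr_unique[OF H has_trace_partial_integral[OF h th sL]] by eventually_elim simp
  qed (use L2_measurable[OF bg] L2_measurable[OF F.partial_integral_L2(1)[OF thL sL]]
      L2_measurable[OF X.tr_L2[OF H]] in auto)
  finally show ?thesis by (simp add: L2_inner_def bdry_form_def)
qed

end

section \<open>Expansion in Robin eigenfunctions\<close>

locale weighted_region = trace_region \<Omega> for \<Omega> :: "'a::euclidean_space set" +
  fixes b :: "'a \<Rightarrow> real"
  assumes B3: "cond_B3 \<Omega> b"
begin

lemma weight_measurable: "b \<in> borel_measurable (surf \<Omega>)"
  using B3 by (simp add: cond_B3_def)

lemma weight_pos: "x \<in> bdry \<Omega> \<Longrightarrow> b x > 0"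
  using B3 by (simp add: cond_B3_def)

lemma weight_bounded: obtains K where "K \<ge> 0" "AE x in surf \<Omega>. \<bar>b x\<bar> \<le> K"
proof -
  obtain C where C: "AE x in surf \<Omega>. b x \<le> C" using B3 by (auto simp: cond_B3_def)
  have "AE x in surf \<Omega>. \<bar>b x\<bar> \<le> max C 0"
    using C AE_space by eventually_elim (use weight_pos in \<open>fastforce simp: space_surf\<close>)
  then show thesis by (intro that[of "max C 0"]) auto
qed

lemma bdry_form_inner: "bdry_form \<Omega> b u v = L2_inner (surf \<Omega>) (\<lambda>x. b x * tr \<Omega> u x) (tr \<Omega> v)"
  by (simp add: bdry_form_def L2_inner_def)

lemma weighted_L2: "t \<in> Lp (surf \<Omega>) 2 \<Longrightarrow> (\<lambda>x. b x * t x) \<in> Lp (surf \<Omega>) 2" for t :: "'a \<Rightarrow> real"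
proof -
  assume t: "t \<in> Lp (surf \<Omega>) 2"
  obtain K where "AE x in surf \<Omega>. \<bar>b x\<bar> \<le> K" by (rule weight_bounded)
  from L2_mult_bounded[OF t weight_measurable this] show ?thesis by simp
qed

lemma bdry_form_nonneg: "0 \<le> bdry_form \<Omega> b u u"
proof -
  have "AE x in surf \<Omega>. 0 \<le> b x * tr \<Omega> u x * tr \<Omega> u x"
    using AE_space by eventually_elim (use weight_pos in \<open>simp add: space_surf less_imp_le mult.assoc\<close>)
  then show ?thesis unfolding bdry_form_def by (rule integral_nonneg_AE)
qed

lemma bdry_form_le:
  assumes K: "AE x in surf \<Omega>. \<bar>b x\<bar> \<le> K" and u: "u \<in> H1 \<Omega>"
  shows "bdry_form \<Omega> b u u \<le> K * L2_inner (surf \<Omega>) (tr \<Omega> u) (tr \<Omega> u)"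
proof -
  note tL = tr_L2[OF u]
  have "bdry_form \<Omega> b u u \<le> (LINT x|surf \<Omega>. K * (tr \<Omega> u x \<bullet> tr \<Omega> u x))"
    unfolding bdry_form_inner L2_inner_def
  proof (rule integral_mono_AE)
    show "integrable (surf \<Omega>) (\<lambda>x. (b x * tr \<Omega> u x) \<bullet> tr \<Omega> u x)"
      by (rule L2_integrable_inner[OF weighted_L2[OF tL] tL])
    show "integrable (surf \<Omega>) (\<lambda>x. K * (tr \<Omega> u x \<bullet> tr \<Omega> u x))"
      by (intro integrable_mult_right L2_integrable_inner tL)
    show "AE x in surf \<Omega>. (b x * tr \<Omega> u x) \<bullet> tr \<Omega> u x \<le> K * (tr \<Omega> u x \<bullet> tr \<Omega> u x)"
      using K
    proof eventually_elim
      case (elim x)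
      have "b x * (tr \<Omega> u x * tr \<Omega> u x) \<le> K * (tr \<Omega> u x * tr \<Omega> u x)"
        using elim by (intro mult_right_mono) auto
      then show ?case by (simp add: mult.assoc)
    qed
  qed
  then show ?thesis by (simp add: L2_inner_def)
qed

sublocale E: semi_inner_functions "H1 \<Omega>" "b_inner \<Omega> b"
proof
  show "(\<lambda>_. 0) \<in> H1 \<Omega>" by (rule H1_zero)
  show "\<And>f g. f \<in> H1 \<Omega> \<Longrightarrow> g \<in> H1 \<Omega> \<Longrightarrow> (\<lambda>x. f x + g x) \<in> H1 \<Omega>" by (rule H1_add)
  show "\<And>f c. f \<in> H1 \<Omega> \<Longrightarrow> (\<lambda>x. c *\<^sub>R f x) \<in> H1 \<Omega>" using H1_scale by simp
  show "\<And>f g. b_inner \<Omega> b f g = b_inner \<Omega> b g f"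
    by (simp add: b_inner_def grad_form_def bdry_form_def inner_commute mult_ac)
  show "0 \<le> b_inner \<Omega> b f f" for f
    using bdry_form_nonneg[of f] by (simp add: b_inner_def grad_form_def)
  fix f h assume f: "f \<in> H1 \<Omega>" and h: "h \<in> H1 \<Omega>"
  show "b_inner \<Omega> b (\<lambda>x. c *\<^sub>R f x) h = c * b_inner \<Omega> b f h" for c
  proof -
    have "grad_form \<Omega> (\<lambda>x. c * f x) h = c * grad_form \<Omega> f h"
      unfolding grad_form_pair[OF H1_pair_scale[OF H1_pair_wgrad[OF f]] H1_pair_wgrad[OF h]]
      by (simp add: L2.scale_left H1_L2 f h grad_form_inner)
    moreover have "bdry_form \<Omega> b (\<lambda>x. c * f x) h = c * bdry_form \<Omega> b f h"
    proof -
      have "bdry_form \<Omega> b (\<lambda>x. c * f x) h = L2_inner (surf \<Omega>) (\<lambda>x. c *\<^sub>R (b x * tr \<Omega> f x)) (tr \<Omega> h)"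
        unfolding bdry_form_inner
      proof (rule L2_cong_AE)
        show "AE x in surf \<Omega>. b x * tr \<Omega> (\<lambda>x. c * f x) x = c *\<^sub>R (b x * tr \<Omega> f x)"
          using tr_scale[OF f, of c] by eventually_elim simp
      qed (use L2_measurable[OF weighted_L2[OF tr_L2[OF H1_scale[OF f]]]]
          L2_measurable[OF weighted_L2[OF tr_L2[OF f]]] L2_measurable[OF tr_L2[OF h]] in auto)
      then show ?thesis
        using L2.scale_left[OF weighted_L2[OF tr_L2[OF f]] tr_L2[OF h], of c] by (simp add: bdry_form_inner)
    qed
    ultimately show ?thesis by (simp add: b_inner_def distrib_left)
  qed
  fix g assume g: "g \<in> H1 \<Omega>"
  have "grad_form \<Omega> (\<lambda>x. f x + g x) h = grad_form \<Omega> f h + grad_form \<Omega> g h"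
    unfolding grad_form_pair[OF H1_pair_add[OF H1_pair_wgrad[OF f] H1_pair_wgrad[OF g]] H1_pair_wgrad[OF h]]
    by (simp add: L2.add_left H1_L2 f g h grad_form_inner)
  moreover have "bdry_form \<Omega> b (\<lambda>x. f x + g x) h = bdry_form \<Omega> b f h + bdry_form \<Omega> b g h"
  proof -
    have "bdry_form \<Omega> b (\<lambda>x. f x + g x) h
      = L2_inner (surf \<Omega>) (\<lambda>x. b x * tr \<Omega> f x + b x * tr \<Omega> g x) (tr \<Omega> h)"
      unfolding bdry_form_inner
    proof (rule L2_cong_AE)
      show "AE x in surf \<Omega>. b x * tr \<Omega> (\<lambda>x. f x + g x) x = b x * tr \<Omega> f x + b x * tr \<Omega> g x"
        using tr_add[OF f g] by eventually_elim (simp add: distrib_left)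
    qed (use L2_measurable[OF weighted_L2[OF tr_L2[OF H1_add[OF f g]]]]
        L2_measurable[OF weighted_L2[OF tr_L2[OF f]]] L2_measurable[OF weighted_L2[OF tr_L2[OF g]]]
        L2_measurable[OF tr_L2[OF h]] in auto)
    then show ?thesis
      using L2.add_left[OF weighted_L2[OF tr_L2[OF f]] weighted_L2[OF tr_L2[OF g]] tr_L2[OF h]]
      by (simp add: bdry_form_inner)
  qed
  ultimately show "b_inner \<Omega> b (\<lambda>x. f x + g x) h = b_inner \<Omega> b f h + b_inner \<Omega> b g h"
    by (simp add: b_inner_def)
qed

lemma grad_form_le_b_inner: "grad_form \<Omega> u u \<le> b_inner \<Omega> b u u"
  using bdry_form_nonneg[of u] by (simp add: b_inner_def)

lemma b_inner_bounded:
  obtains C where "C \<ge> 0" "\<And>u. u \<in> H1 \<Omega> \<Longrightarrow> b_inner \<Omega> b u u \<le> C * (H1_norm \<Omega> u)\<^sup>2"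
proof -
  obtain K where K: "K \<ge> 0" "AE x in surf \<Omega>. \<bar>b x\<bar> \<le> K" by (rule weight_bounded)
  obtain C where C: "C \<ge> 0" "\<And>u. u \<in> H1 \<Omega> \<Longrightarrow> L2_norm (surf \<Omega>) (tr \<Omega> u) \<le> C * H1_norm \<Omega> u"
    using trace_bounded by blast
  have "b_inner \<Omega> b u u \<le> (1 + K * C\<^sup>2) * (H1_norm \<Omega> u)\<^sup>2" if u: "u \<in> H1 \<Omega>" for u
  proof -
    have "grad_form \<Omega> u u \<le> (H1_norm \<Omega> u)\<^sup>2"
      using L2.nonneg[OF H1_L2(1)[OF u]] L2.nonneg[OF H1_L2(2)[OF u]]
      by (simp add: H1_norm_sq[OF H1_pair_wgrad[OF u]] grad_form_inner)
    moreover have "bdry_form \<Omega> b u u \<le> K * (C * H1_norm \<Omega> u)\<^sup>2"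
    proof -
      have "L2_inner (surf \<Omega>) (tr \<Omega> u) (tr \<Omega> u) \<le> (C * H1_norm \<Omega> u)\<^sup>2"
        unfolding L2.nrm_sq[OF tr_L2[OF u], symmetric]
        using C(2)[OF u] L2.nrm_nonneg[OF tr_L2[OF u]] by (intro power_mono)
      then have "K * L2_inner (surf \<Omega>) (tr \<Omega> u) (tr \<Omega> u) \<le> K * (C * H1_norm \<Omega> u)\<^sup>2"
        using K(1) by (rule mult_left_mono)
      with bdry_form_le[OF K(2) u] show ?thesis by linarith
    qed
    ultimately show ?thesis by (simp add: b_inner_def algebra_simps power_mult_distrib)
  qed
  moreover have "0 \<le> 1 + K * C\<^sup>2" using K(1) by simp
  ultimately show thesis using that by blast
qed

end

locale robin_region = weighted_region \<Omega> b for \<Omega> :: "'a::euclidean_space set" and b +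
  fixes lam :: "nat \<Rightarrow> real" and g :: "nat \<Rightarrow> 'a \<Rightarrow> real"
  assumes eigendata: "robin_eigendata \<Omega> b lam g"
begin

lemma eigen: "robin_eigenfunction \<Omega> b (lam (Suc j)) (g (Suc j))" "lam (Suc j) > 0"
  using eigendata unfolding robin_eigendata_def by simp_all

lemma g_H1: "g (Suc j) \<in> H1 \<Omega>"
  using eigen(1)[of j] unfolding robin_eigenfunction_def by simp

lemma lam_mono: "lam (Suc 0) \<le> lam (Suc j)"
  using eigendata unfolding robin_eigendata_def mono_on_def by simp

lemma b_inner_g: "h \<in> H1 \<Omega> \<Longrightarrow> b_inner \<Omega> b (g (Suc j)) h = lam (Suc j) * L2_inner (vol \<Omega>) (g (Suc j)) h"
  using eigen(1)[of j] unfolding robin_eigenfunction_def by (simp add: L2_inner_def)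

lemma g_orthonormal: "E.orthonormal UNIV (\<lambda>j. g (Suc j))"
proof -
  have "\<forall>i\<ge>1. \<forall>j\<ge>1. b_inner \<Omega> b (g i) (g j) = (if i = j then 1 else 0)"
    using eigendata unfolding robin_eigendata_def by (elim conjE)
  then show ?thesis unfolding E.orthonormal_def using g_H1 by auto
qed

text \<open>By the Cauchy--Schwarz inequality a function of zero energy is orthogonal to everything, so unless
  it vanishes it is a Robin eigenfunction with eigenvalue zero. The eigendata list every eigenspace, and all
  listed eigenvalues are positive.\<close>

lemma b_inner_definite:
  assumes w: "w \<in> H1 \<Omega>" "b_inner \<Omega> b w w = 0"
  shows "AE x in vol \<Omega>. w x = 0"
proof (rule ccontr)
  assume nz: "\<not> (AE x in vol \<Omega>. w x = 0)"
  have "b_inner \<Omega> b w h = 0" if "h \<in> H1 \<Omega>" for h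
    using E.Cauchy_Schwarz[OF w(1) that] w(2) by simp
  then have eig: "robin_eigenfunction \<Omega> b 0 w"
    using w(1) nz by (simp add: robin_eigenfunction_def nonzero_on_def)
  have "\<forall>\<mu> u. robin_eigenfunction \<Omega> b \<mu> u \<longrightarrow> finite {j. j \<ge> 1 \<and> lam j = \<mu>} \<and>
        (\<exists>c :: nat \<Rightarrow> real. AE x in vol \<Omega>. u x = (\<Sum>j | j \<ge> 1 \<and> lam j = \<mu>. c j * g j x))"
    using eigendata unfolding robin_eigendata_def by (elim conjE)
  from this[rule_format, OF eig] obtain c :: "nat \<Rightarrow> real" where
    c: "AE x in vol \<Omega>. w x = (\<Sum>j | j \<ge> 1 \<and> lam j = 0. c j * g j x)" by blast
  have "lam j \<noteq> 0" if "j \<ge> 1" for j using eigen(2)[of "j - 1"] that by simp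
  then have empty: "{j. j \<ge> 1 \<and> lam j = 0} = {}" by auto
  have "AE x in vol \<Omega>. w x = 0" using c unfolding empty by simp
  with nz show False by blast
qed

text \<open>Maximality of the orthonormal system excludes orthogonal functions of energy 1; scaling excludes
  those of any positive energy, and definiteness the rest.\<close>

lemma g_complete:
  assumes w: "w \<in> H1 \<Omega>" "\<And>j. b_inner \<Omega> b w (g (Suc j)) = 0"
  shows "AE x in vol \<Omega>. w x = 0"
proof (rule b_inner_definite[OF w(1)], rule ccontr)
  assume "b_inner \<Omega> b w w \<noteq> 0"
  then have pos: "b_inner \<Omega> b w w > 0" using E.nonneg[OF w(1)] by simp
  let ?c = "1 / sqrt (b_inner \<Omega> b w w)"
  let ?h = "\<lambda>x. ?c *\<^sub>R w x"
  have hH: "?h \<in> H1 \<Omega>" by (rule E.scale_closed[OF w(1)])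
  have "b_inner \<Omega> b ?h ?h = 1"
  proof -
    have "b_inner \<Omega> b ?h ?h = ?c * (?c * b_inner \<Omega> b w w)"
      unfolding E.scale_left[OF w(1) hH] E.scale_right[OF w(1) w(1)] ..
    then show ?thesis using pos by (simp add: field_simps)
  qed
  moreover have "b_inner \<Omega> b (g j) ?h = 0" if j1: "j \<ge> 1" for j
  proof -
    obtain i where j: "j = Suc i" using j1 by (cases j) simp_all
    have "b_inner \<Omega> b (g (Suc i)) ?h = ?c * b_inner \<Omega> b (g (Suc i)) w"
      by (rule E.scale_right[OF w(1) g_H1])
    also have "b_inner \<Omega> b (g (Suc i)) w = b_inner \<Omega> b w (g (Suc i))" by (rule E.sym)
    finally show ?thesis unfolding j w(2) by simp
  qed
  ultimately have "\<exists>h\<in>H1 \<Omega>. b_inner \<Omega> b h h = 1 \<and> (\<forall>j\<ge>1. b_inner \<Omega> b (g j) h = 0)"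
    using hH by (intro bexI[of _ ?h] conjI allI impI)
  moreover have "\<not> (\<exists>h\<in>H1 \<Omega>. b_inner \<Omega> b h h = 1 \<and> (\<forall>j\<ge>1. b_inner \<Omega> b (g j) h = 0))"
    using eigendata unfolding robin_eigendata_def by (elim conjE)
  ultimately show False by (rule notE[rotated])
qed

text \<open>The eigenfunctions are normalised in the energy, where their square \<open>L\<^sup>2\<close> norms are the reciprocal
  eigenvalues; the factor renormalises them in \<open>L\<^sup>2\<close>. The index is shifted because
  the eigendata are numbered from 1.\<close>

definition eigenbasis :: "nat \<Rightarrow> 'a \<Rightarrow> real" where
  "eigenbasis j x = sqrt (lam (Suc j)) * g (Suc j) x"

lemma basis_H1: "eigenbasis j \<in> H1 \<Omega>"
  unfolding eigenbasis_def[abs_def] by (rule H1_scale[OF g_H1])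

lemma basis_L2: "eigenbasis j \<in> Lp (vol \<Omega>) 2"
  by (rule H1_L2(1)[OF basis_H1])

lemma b_inner_basis:
  assumes h: "h \<in> H1 \<Omega>"
  shows "b_inner \<Omega> b (eigenbasis j) h = sqrt (lam (Suc j)) * b_inner \<Omega> b (g (Suc j)) h"
    and "b_inner \<Omega> b (eigenbasis j) h = lam (Suc j) * L2_inner (vol \<Omega>) (eigenbasis j) h"
proof -
  show 1: "b_inner \<Omega> b (eigenbasis j) h = sqrt (lam (Suc j)) * b_inner \<Omega> b (g (Suc j)) h"
    using E.scale_left[OF g_H1 h, of "sqrt (lam (Suc j))" j] by (simp add: eigenbasis_def[abs_def])
  have "L2_inner (vol \<Omega>) (eigenbasis j) h = sqrt (lam (Suc j)) * L2_inner (vol \<Omega>) (g (Suc j)) h"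
    using L2.scale_left[OF H1_L2(1)[OF g_H1] H1_L2(1)[OF h], of "sqrt (lam (Suc j))" j]
    by (simp add: eigenbasis_def[abs_def])
  then show "b_inner \<Omega> b (eigenbasis j) h = lam (Suc j) * L2_inner (vol \<Omega>) (eigenbasis j) h"
    unfolding 1 b_inner_g[OF h] by simp
qed

lemma b_inner_basis_basis: "b_inner \<Omega> b (eigenbasis i) (eigenbasis j) = (if i = j then lam (Suc i) else 0)"
proof -
  have "b_inner \<Omega> b (eigenbasis i) (eigenbasis j)
    = sqrt (lam (Suc i)) * (sqrt (lam (Suc j)) * b_inner \<Omega> b (g (Suc i)) (g (Suc j)))"
    using E.scale_right[OF g_H1 g_H1, of i "sqrt (lam (Suc j))" j] b_inner_basis(1)[OF basis_H1, of i j]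
    by (simp add: eigenbasis_def[abs_def])
  moreover have "b_inner \<Omega> b (g (Suc i)) (g (Suc j)) = (if i = j then 1 else 0)"
    using g_orthonormal by (simp add: E.orthonormal_def)
  ultimately show ?thesis using eigen(2)[of i] by (cases "i = j") auto
qed

lemma basis_orthonormal: "L2.orthonormal (vol \<Omega>) UNIV eigenbasis"
proof -
  have "L2_inner (vol \<Omega>) (eigenbasis i) (eigenbasis j) = (if i = j then 1 else 0)" for i j
    using b_inner_basis(2)[OF basis_H1, of i j] b_inner_basis_basis[of i j] eigen(2)[of i]
    by (auto split: if_splits)
  then show ?thesis using basis_L2 by (auto simp: L2.orthonormal_def)
qed

text \<open>Energy controls the \<open>L\<^sup>2\<close> norm on the span of the eigenfunctions, since the eigenvalues are
  bounded below by the first one.\<close>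

lemma eigen_lincomb:
  fixes c :: "nat \<Rightarrow> real"
  assumes "finite A"
  defines "D \<equiv> \<lambda>x. \<Sum>j\<in>A. c j * g (Suc j) x"
  shows "D \<in> H1 \<Omega>" "j \<in> A \<Longrightarrow> b_inner \<Omega> b (g (Suc j)) D = c j"
    and "L2_inner (vol \<Omega>) D D \<le> (1 / lam (Suc 0)) * (\<Sum>j\<in>A. (c j)\<^sup>2)"
    and "grad_form \<Omega> D D \<le> (\<Sum>j\<in>A. (c j)\<^sup>2)"
proof -
  have sc: "(\<lambda>x. c j * g (Suc j) x) \<in> H1 \<Omega>" for j by (rule H1_scale[OF g_H1])
  show DH: "D \<in> H1 \<Omega>" unfolding D_def by (rule H1_sum[OF sc])
  have gD: "b_inner \<Omega> b (g (Suc j)) D = c j" if "j \<in> A" for j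
  proof -
    have "b_inner \<Omega> b (g (Suc j)) D = (\<Sum>i\<in>A. b_inner \<Omega> b (g (Suc j)) (\<lambda>x. c i * g (Suc i) x))"
      unfolding D_def by (rule E.sum_right[OF sc g_H1])
    also have "\<dots> = (\<Sum>i\<in>A. c i * b_inner \<Omega> b (g (Suc j)) (g (Suc i)))"
      using E.scale_right[OF g_H1 g_H1] by simp
    also have "\<dots> = (\<Sum>i\<in>A. if i = j then c j else 0)"
      using g_orthonormal by (intro sum.cong) (auto simp: E.orthonormal_def)
    finally show ?thesis using that assms(1) by simp
  qed
  then show "j \<in> A \<Longrightarrow> b_inner \<Omega> b (g (Suc j)) D = c j" .
  have "b_inner \<Omega> b D D = (\<Sum>j\<in>A. b_inner \<Omega> b (\<lambda>x. c j * g (Suc j) x) D)"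
    by (subst (1) D_def) (rule E.sum_left[OF sc DH])
  also have "\<dots> = (\<Sum>j\<in>A. (c j)\<^sup>2)"
    using E.scale_left[OF g_H1 DH] gD by (intro sum.cong) (auto simp: power2_eq_square)
  finally show "grad_form \<Omega> D D \<le> (\<Sum>j\<in>A. (c j)\<^sup>2)"
    using grad_form_le_b_inner[of D] by simp
  have "L2_inner (vol \<Omega>) D D = (\<Sum>j\<in>A. L2_inner (vol \<Omega>) (\<lambda>x. c j * g (Suc j) x) D)"
    by (subst (1) D_def) (rule L2.sum_left[OF H1_L2(1)[OF sc] H1_L2(1)[OF DH]])
  also have "\<dots> \<le> (\<Sum>j\<in>A. (1 / lam (Suc 0)) * (c j)\<^sup>2)"
  proof (rule sum_mono)
    fix j assume j: "j \<in> A"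
    have "L2_inner (vol \<Omega>) (\<lambda>x. c j * g (Suc j) x) D = c j * L2_inner (vol \<Omega>) (g (Suc j)) D"
      using L2.scale_left[OF H1_L2(1)[OF g_H1] H1_L2(1)[OF DH]] by simp
    also have "L2_inner (vol \<Omega>) (g (Suc j)) D = c j / lam (Suc j)"
      using b_inner_g[OF DH, of j] gD[OF j] eigen(2)[of j] by (simp add: field_simps)
    finally have "L2_inner (vol \<Omega>) (\<lambda>x. c j * g (Suc j) x) D = (1 / lam (Suc j)) * (c j)\<^sup>2"
      by (simp add: power2_eq_square)
    also have "\<dots> \<le> (1 / lam (Suc 0)) * (c j)\<^sup>2"
      using lam_mono[of j] eigen(2)[of 0] by (intro mult_right_mono frac_le) auto
    finally show "L2_inner (vol \<Omega>) (\<lambda>x. c j * g (Suc j) x) D \<le> (1 / lam (Suc 0)) * (c j)\<^sup>2" .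
  qed
  finally show "L2_inner (vol \<Omega>) D D \<le> (1 / lam (Suc 0)) * (\<Sum>j\<in>A. (c j)\<^sup>2)"
    by (simp add: sum_distrib_left)
qed

text \<open>The energy Fourier series of \<open>h\<close> converges in \<open>H\<^sup>1\<close>: its partial sums are Cauchy by Bessel's
  inequality, and \<open>H\<^sup>1\<close> is complete. The energy form is continuous on \<open>H\<^sup>1\<close>, so the limit has the same
  coefficients as \<open>h\<close> and by completeness of the eigenfunctions equals \<open>h\<close>.\<close>

lemma eigen_expansion:
  assumes h: "h \<in> H1 \<Omega>"
  shows "L2_tendsto (vol \<Omega>) (\<lambda>n x. \<Sum>j<n. b_inner \<Omega> b h (g (Suc j)) * g (Suc j) x) h"
proof -
  define c where "c = (\<lambda>j. b_inner \<Omega> b h (g (Suc j)))"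
  define S where "S = (\<lambda>n x. \<Sum>j<n. c j * g (Suc j) x)"
  note lc = eigen_lincomb[where c = c]
  have SH: "S n \<in> H1 \<Omega>" for n unfolding S_def by (rule lc(1)) simp
  note p = H1_pair_wgrad[OF SH]
  have "(\<Sum>j<n. (c j)\<^sup>2) \<le> b_inner \<Omega> b h h" for n
    unfolding c_def by (rule E.Bessel) (use g_orthonormal h in \<open>auto simp: E.orthonormal_def\<close>)
  then have summable: "summable (\<lambda>j. (c j)\<^sup>2)" by (intro summableI_nonneg_bounded) auto
  have diff: "(\<lambda>x. S m x - S n x) = (\<lambda>x. \<Sum>j\<in>{n..<m}. c j * g (Suc j) x)" if "n \<le> m" for m n
    using sum_diff_nat_ivl[of 0 n m] that by (auto simp: S_def atLeast0LessThan)
  have c1: "\<exists>K. \<forall>m\<ge>K. \<forall>n\<ge>K. L2_norm (vol \<Omega>) (\<lambda>x. S m x - S n x) < e" if e0: "e > 0" for e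
  proof (rule Cauchy_if_summable_bound[OF summable _ _ _ _ e0])
    show "(L2_norm (vol \<Omega>) (\<lambda>x. S m x - S n x))\<^sup>2 \<le> 1 / lam (Suc 0) * (\<Sum>j\<in>{n..<m}. (c j)\<^sup>2)"
      if "n \<le> m" for m n
      unfolding diff[OF that] L2.nrm_sq[OF H1_L2(1)[OF lc(1)[OF finite_atLeastLessThan]]]
      by (rule lc(3)) simp
    show "L2_norm (vol \<Omega>) (\<lambda>x. S m x - S n x) = L2_norm (vol \<Omega>) (\<lambda>x. S n x - S m x)" for m n
      by (rule L2.nrm_minus_commute[OF H1_L2(1)[OF SH] H1_L2(1)[OF SH]])
  qed (use eigen(2)[of 0] in auto)
  have c2: "\<exists>K. \<forall>m\<ge>K. \<forall>n\<ge>K. L2_norm (vol \<Omega>) (\<lambda>x. wgrad \<Omega> (S m) x - wgrad \<Omega> (S n) x) < e" if e0: "e > 0" for e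
  proof (rule Cauchy_if_summable_bound[OF summable _ _ _ _ e0])
    show "(L2_norm (vol \<Omega>) (\<lambda>x. wgrad \<Omega> (S m) x - wgrad \<Omega> (S n) x))\<^sup>2 \<le> 1 * (\<Sum>j\<in>{n..<m}. (c j)\<^sup>2)"
      if "n \<le> m" for m n
    proof -
      have "(L2_norm (vol \<Omega>) (\<lambda>x. wgrad \<Omega> (S m) x - wgrad \<Omega> (S n) x))\<^sup>2
        = grad_form \<Omega> (\<lambda>x. S m x - S n x) (\<lambda>x. S m x - S n x)"
        unfolding grad_form_pair[OF H1_pair_diff[OF p p] H1_pair_diff[OF p p]]
        by (rule L2.nrm_sq[OF L2.diff_closed[OF H1_L2(2)[OF SH] H1_L2(2)[OF SH]]])
      also have "\<dots> \<le> (\<Sum>j\<in>{n..<m}. (c j)\<^sup>2)"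
        unfolding diff[OF that] by (rule lc(4)) simp
      finally show ?thesis by simp
    qed
    show "L2_norm (vol \<Omega>) (\<lambda>x. wgrad \<Omega> (S m) x - wgrad \<Omega> (S n) x)
      = L2_norm (vol \<Omega>) (\<lambda>x. wgrad \<Omega> (S n) x - wgrad \<Omega> (S m) x)" for m n
      by (rule L2.nrm_minus_commute[OF H1_L2(2)[OF SH] H1_L2(2)[OF SH]])
  qed auto
  obtain v where v: "v \<in> H1 \<Omega>" "H1_tendsto \<Omega> S v" 
    by (rule H1_complete[of S "\<lambda>n. wgrad \<Omega> (S n)", OF p c1 c2]) (assumption | rule that)+
  obtain C where C: "C \<ge> 0" "\<And>u. u \<in> H1 \<Omega> \<Longrightarrow> b_inner \<Omega> b u u \<le> C * (H1_norm \<Omega> u)\<^sup>2"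
    using b_inner_bounded by blast
  have Elim: "(\<lambda>n. E.nrm (\<lambda>x. S n x - v x)) \<longlonglongrightarrow> 0"
  proof (rule Lim_null_comparison)
    show "\<forall>\<^sub>F n in sequentially. norm (E.nrm (\<lambda>x. S n x - v x)) \<le> sqrt C * H1_norm \<Omega> (\<lambda>x. S n x - v x)"
    proof (intro always_eventually allI)
      fix n
      note d = H1_diff[OF SH v(1), of n]
      have "E.nrm (\<lambda>x. S n x - v x) \<le> sqrt (C * (H1_norm \<Omega> (\<lambda>x. S n x - v x))\<^sup>2)"
        unfolding E.nrm_def using C(2)[OF d] by (rule real_sqrt_le_mono)
      then show "norm (E.nrm (\<lambda>x. S n x - v x)) \<le> sqrt C * H1_norm \<Omega> (\<lambda>x. S n x - v x)"
        using E.nrm_nonneg[OF d] H1_norm_nonneg[of "\<lambda>x. S n x - v x"] by (simp add: real_sqrt_mult)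
    qed
    show "(\<lambda>n. sqrt C * H1_norm \<Omega> (\<lambda>x. S n x - v x)) \<longlonglongrightarrow> 0"
      using tendsto_mult_right_zero[OF v(2)[unfolded H1_tendsto_def]] .
  qed
  \<comment> \<open>the coefficients of the limit are eventually those of the partial sums\<close>
  have "b_inner \<Omega> b v (g (Suc j)) = c j" for j
  proof -
    have "(\<lambda>n. b_inner \<Omega> b (S n) (g (Suc j))) \<longlonglongrightarrow> b_inner \<Omega> b v (g (Suc j))"
      by (rule E.B_tendsto_left[OF SH v(1) g_H1 Elim])
    moreover have "\<forall>\<^sub>F n in sequentially. b_inner \<Omega> b (S n) (g (Suc j)) = c j"
    proof (rule eventually_sequentiallyI[of "Suc j"])
      fix n assume "Suc j \<le> n"
      then have "b_inner \<Omega> b (g (Suc j)) (S n) = c j"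
        unfolding S_def by (intro lc(2)) auto
      then show "b_inner \<Omega> b (S n) (g (Suc j)) = c j" using E.sym[of "S n"] by simp
    qed
    ultimately show ?thesis using LIMSEQ_unique[OF _ tendsto_eventually] by metis
  qed
  then have "b_inner \<Omega> b (\<lambda>x. v x - h x) (g (Suc j)) = 0" for j
    using E.diff_left[OF v(1) h g_H1, of j] by (simp add: c_def)
  then have vh: "AE x in vol \<Omega>. v x - h x = 0" by (rule g_complete[OF H1_diff[OF v(1) h]])
  have "L2_norm (vol \<Omega>) (\<lambda>x. S n x - h x) = L2_norm (vol \<Omega>) (\<lambda>x. S n x - v x)" for n
  proof (rule L2_norm_cong_AE)
    show "AE x in vol \<Omega>. S n x - h x = S n x - v x" using vh by eventually_elim simp
  qed (use L2_measurable[OF H1_L2(1)[OF SH]] L2_measurable[OF H1_L2(1)[OF h]]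
      L2_measurable[OF H1_L2(1)[OF v(1)]] in auto)
  then show ?thesis using H1_tendstoD(1)[OF SH v] by (simp add: S_def c_def)
qed

text \<open>A function orthogonal to all eigenfunctions is orthogonal to all limits of their linear
  combinations, among them the test functions.\<close>

lemma basis_complete:
  assumes f: "f \<in> Lp (vol \<Omega>) 2" "\<And>j. L2_inner (vol \<Omega>) (eigenbasis j) f = 0"
  shows "AE x in vol \<Omega>. f x = 0"
proof (rule L2_test_zero[OF f(1)])
  fix \<phi> assume "\<phi> \<in> test_functions \<Omega>"
  then have \<phi>: "\<phi> \<in> H1 \<Omega>" by (rule test_function_H1)
  let ?S = "\<lambda>n x. \<Sum>j<n. b_inner \<Omega> b \<phi> (g (Suc j)) * g (Suc j) x"
  have sL: "(\<lambda>x. b_inner \<Omega> b \<phi> (g (Suc j)) * g (Suc j) x) \<in> Lp (vol \<Omega>) 2" for j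
    by (rule H1_L2(1)[OF H1_scale[OF g_H1]])
  have gf: "L2_inner (vol \<Omega>) (g (Suc j)) f = 0" for j
  proof -
    have "L2_inner (vol \<Omega>) (eigenbasis j) f = sqrt (lam (Suc j)) * L2_inner (vol \<Omega>) (g (Suc j)) f"
      using L2.scale_left[OF H1_L2(1)[OF g_H1] f(1), of "sqrt (lam (Suc j))" j]
      by (simp add: eigenbasis_def[abs_def])
    then show ?thesis using f(2)[of j] eigen(2)[of j] by simp
  qed
  have "L2_inner (vol \<Omega>) (?S n) f = 0" for n
  proof -
    have "L2_inner (vol \<Omega>) (?S n) f = (\<Sum>j<n. L2_inner (vol \<Omega>) (\<lambda>x. b_inner \<Omega> b \<phi> (g (Suc j)) * g (Suc j) x) f)"
      by (rule L2.sum_left[OF sL f(1)])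
    also have "\<dots> = 0"
      using L2.scale_left[OF H1_L2(1)[OF g_H1] f(1)] gf by simp
    finally show ?thesis .
  qed
  moreover have "(\<lambda>n. L2_inner (vol \<Omega>) (?S n) f) \<longlonglongrightarrow> L2_inner (vol \<Omega>) \<phi> f"
    by (rule L2.B_tendsto_left[OF L2.sum_closed[OF sL] H1_L2(1)[OF \<phi>] f(1) eigen_expansion[OF \<phi>]])
  ultimately have "L2_inner (vol \<Omega>) \<phi> f = 0" using LIMSEQ_unique[OF _ tendsto_const] by fastforce
  then show "L2_inner (vol \<Omega>) f \<phi> = 0" using L2.sym[of "vol \<Omega>" f] by simp
qed

end

section \<open>Density of tensor products\<close>

text \<open>The energy of a combination of eigenfunctions dominates its gradient, and the energy form is
  diagonal in this basis.\<close>

lemma (in robin_region) basis_gradient_le: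
  fixes c :: "nat \<Rightarrow> real"
  assumes A: "finite A"
  shows "L2_inner (vol \<Omega>) (\<lambda>x. \<Sum>j\<in>A. c j *\<^sub>R wgrad \<Omega> (eigenbasis j) x)
      (\<lambda>x. \<Sum>j\<in>A. c j *\<^sub>R wgrad \<Omega> (eigenbasis j) x) \<le> (\<Sum>j\<in>A. lam (Suc j) * (c j)\<^sup>2)"
proof -
  let ?D = "\<lambda>x. \<Sum>j\<in>A. (c j * sqrt (lam (Suc j))) * g (Suc j) x"
  have eq: "?D = (\<lambda>x. \<Sum>j\<in>A. c j * eigenbasis j x)"
    by (simp add: eigenbasis_def mult.assoc)
  have p: "H1_pair \<Omega> ?D (\<lambda>x. \<Sum>j\<in>A. c j *\<^sub>R wgrad \<Omega> (eigenbasis j) x)"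
    unfolding eq by (intro H1_pair_sum H1_pair_scale H1_pair_wgrad basis_H1)
  have "grad_form \<Omega> ?D ?D \<le> (\<Sum>j\<in>A. (c j * sqrt (lam (Suc j)))\<^sup>2)"
    by (rule eigen_lincomb(4)[OF A])
  also have "\<dots> = (\<Sum>j\<in>A. lam (Suc j) * (c j)\<^sup>2)"
    using eigen(2) by (intro sum.cong) (auto simp: power_mult_distrib less_imp_le mult.commute)
  finally show ?thesis unfolding grad_form_pair[OF p p] .
qed

locale robin_product = X: bounded_open \<Omega>1 + R: robin_region \<Omega>2 b lam g
  for \<Omega>1 :: "'a::euclidean_space set" and \<Omega>2 :: "'b::euclidean_space set" and b lam g
begin

sublocale bounded_open_pair \<Omega>1 \<Omega>2
  by unfold_locales

definition coeff :: "('a \<times> 'b \<Rightarrow> real) \<Rightarrow> nat \<Rightarrow> 'a \<Rightarrow> real" where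
  "coeff h j = partial_integral (vol \<Omega>2) (R.eigenbasis j) h"

lemma coeff_H1: "h \<in> H1 (\<Omega>1 \<times> \<Omega>2) \<Longrightarrow> coeff h j \<in> H1 \<Omega>1"
  unfolding coeff_def by (rule H1_partial_integral[OF _ R.basis_L2])

text \<open>The sum is the energy in the second variable of the expansion of \<open>h\<close>. If almost every slice were
  known to be in \<open>H\<^sup>1\<close>, Bessel's inequality in each slice would give the bound. Instead of slices, partial
  integrals of \<open>h\<close> against finitely many orthonormal functions \<open>e k\<close> of the first variable are used:
  if the \<open>e k\<close> span the coefficients with index below \<open>J\<close>, then the coefficients are determined by
  those partial integrals, and summing Bessel's inequality over \<open>k\<close> gives a bound that does not depend
  on \<open>J\<close>.\<close>

lemma coeff_energy_bounded:
  assumes h: "h \<in> H1 (\<Omega>1 \<times> \<Omega>2)"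
  shows "\<exists>B. \<forall>J. (\<Sum>j<J. lam (Suc j) * L2_inner (vol \<Omega>1) (coeff h j) (coeff h j)) \<le> B"
proof -
  interpret Q: bounded_open_pair \<Omega>2 \<Omega>1 by (rule swap_regions)
  obtain C where C: "C \<ge> 0" "\<And>u. u \<in> H1 \<Omega>2 \<Longrightarrow> b_inner \<Omega>2 b u u \<le> C * (H1_norm \<Omega>2 u)\<^sup>2"
    using R.b_inner_bounded by blast
  let ?h = "\<lambda>z. h (prod.swap z)"
  let ?H = "\<lambda>z. prod.swap (wgrad (\<Omega>1 \<times> \<Omega>2) h (prod.swap z))"
  let ?V = "vol \<Omega>2 \<Otimes>\<^sub>M vol \<Omega>1"
  note p = H1_pair_swap[OF H1_pair_wgrad[OF h]]
  note pL = H1_pair_D[OF p, unfolded Q.vol_prod]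
  note hL = H1_L2(1)[OF h, unfolded vol_prod]
  define B where "B = C * (L2_inner ?V ?h ?h + L2_inner ?V (\<lambda>z. fst (?H z)) (\<lambda>z. fst (?H z)))"
  have "(\<Sum>j<J. lam (Suc j) * L2_inner (vol \<Omega>1) (coeff h j) (coeff h j)) \<le> B" for J
  proof -
    have cL: "coeff h j \<in> Lp (vol \<Omega>1) 2" for j by (rule H1_L2(1)[OF coeff_H1[OF h]])
    \<comment> \<open>an orthonormal basis of the span of the first \<open>J\<close> coefficients\<close>
    obtain n and e :: "nat \<Rightarrow> 'a \<Rightarrow> real" where e: "L2.orthonormal (vol \<Omega>1) {..<n} e"
      and ce: "\<forall>j\<in>{..<J}. L2_inner (vol \<Omega>1) (coeff h j) (coeff h j)
        = (\<Sum>k<n. (L2_inner (vol \<Omega>1) (coeff h j) (e k))\<^sup>2)"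
      using L2.Gram_Schmidt[of "{..<J}" "coeff h" "vol \<Omega>1", OF finite_lessThan cL] by blast
    have eL: "e k \<in> Lp (vol \<Omega>1) 2" if "k < n" for k using e that by (auto simp: L2.orthonormal_def)
    define K where "K = (\<lambda>k. partial_integral (vol \<Omega>1) (e k) ?h)"
    define G where "G = (\<lambda>k. partial_integral (vol \<Omega>1) (e k) (\<lambda>z. fst (?H z)))"
    have KG: "H1_pair \<Omega>2 (K k) (G k)" if "k < n" for k
      unfolding K_def G_def by (rule Q.H1_pair_partial_integral[OF p eL[OF that]])
    \<comment> \<open>both sides come from the double integral of \<open>h\<close> against \<open>e k\<close> and the eigenfunction\<close>
    have coeff_eq: "lam (Suc j) * (L2_inner (vol \<Omega>1) (coeff h j) (e k))\<^sup>2 = (b_inner \<Omega>2 b (K k) (g (Suc j)))\<^sup>2"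
      if k: "k < n" for j k
    proof -
      have KH: "K k \<in> H1 \<Omega>2" by (rule H1_pair_imp_H1[OF KG[OF k]])
      have "L2_inner (vol \<Omega>1) (coeff h j) (e k) = L2_inner (vol \<Omega>1) (e k) (coeff h j)" by (rule L2.sym)
      also have "\<dots> = L2_inner (vol \<Omega>2) (R.eigenbasis j) (K k)"
        unfolding coeff_def K_def inner_partial_integral_swap[OF eL[OF k] hL R.basis_L2]
        by (rule inner_partial_integral[OF eL[OF k] hL R.basis_L2, symmetric])
      finally have 1: "lam (Suc j) * L2_inner (vol \<Omega>1) (coeff h j) (e k)
          = sqrt (lam (Suc j)) * b_inner \<Omega>2 b (g (Suc j)) (K k)"
        using R.b_inner_basis[OF KH, of j] by simp
      have pos: "lam (Suc j) > 0" by (rule R.eigen(2))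
      have "lam (Suc j) * (lam (Suc j) * (L2_inner (vol \<Omega>1) (coeff h j) (e k))\<^sup>2)
        = (lam (Suc j) * L2_inner (vol \<Omega>1) (coeff h j) (e k))\<^sup>2"
        by (simp add: power2_eq_square algebra_simps)
      also have "\<dots> = lam (Suc j) * (b_inner \<Omega>2 b (g (Suc j)) (K k))\<^sup>2"
        unfolding 1 power_mult_distrib using pos by simp
      finally have "lam (Suc j) * (L2_inner (vol \<Omega>1) (coeff h j) (e k))\<^sup>2 = (b_inner \<Omega>2 b (g (Suc j)) (K k))\<^sup>2"
        using pos by simp
      then show ?thesis by (simp only: R.E.sym[of "K k"])
    qed
    have "(\<Sum>j<J. lam (Suc j) * L2_inner (vol \<Omega>1) (coeff h j) (coeff h j))
      = (\<Sum>j<J. \<Sum>k<n. lam (Suc j) * (L2_inner (vol \<Omega>1) (coeff h j) (e k))\<^sup>2)"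
      using ce by (intro sum.cong) (auto simp: sum_distrib_left)
    also have "\<dots> = (\<Sum>k<n. \<Sum>j<J. lam (Suc j) * (L2_inner (vol \<Omega>1) (coeff h j) (e k))\<^sup>2)"
      by (rule sum.swap)
    also have "\<dots> = (\<Sum>k<n. \<Sum>j<J. (b_inner \<Omega>2 b (K k) (g (Suc j)))\<^sup>2)"
      by (intro sum.cong refl coeff_eq) simp
    also have "\<dots> \<le> (\<Sum>k<n. C * (L2_inner (vol \<Omega>2) (K k) (K k) + L2_inner (vol \<Omega>2) (G k) (G k)))"
    proof (rule sum_mono)
      fix k assume "k \<in> {..<n}"
      then have k: "k < n" by simp
      have KH: "K k \<in> H1 \<Omega>2" by (rule H1_pair_imp_H1[OF KG[OF k]])
      have "(\<Sum>j<J. (b_inner \<Omega>2 b (K k) (g (Suc j)))\<^sup>2) \<le> b_inner \<Omega>2 b (K k) (K k)"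
        by (rule R.E.Bessel[of "{..<J}" "\<lambda>j. g (Suc j)"])
          (use R.g_orthonormal KH in \<open>auto simp: R.E.orthonormal_def\<close>)
      also have "\<dots> \<le> C * (H1_norm \<Omega>2 (K k))\<^sup>2" by (rule C(2)[OF KH])
      also have "(H1_norm \<Omega>2 (K k))\<^sup>2 = L2_inner (vol \<Omega>2) (K k) (K k) + L2_inner (vol \<Omega>2) (G k) (G k)"
        unfolding R.H1_norm_sq[OF KG[OF k]]
        using L2.nonneg[OF H1_pair_D(1)[OF KG[OF k]]] L2.nonneg[OF H1_pair_D(2)[OF KG[OF k]]] by simp
      finally show "(\<Sum>j<J. (b_inner \<Omega>2 b (K k) (g (Suc j)))\<^sup>2)
        \<le> C * (L2_inner (vol \<Omega>2) (K k) (K k) + L2_inner (vol \<Omega>2) (G k) (G k))" .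
    qed
    also have "\<dots> = C * ((\<Sum>k<n. L2_inner (vol \<Omega>2) (K k) (K k)) + (\<Sum>k<n. L2_inner (vol \<Omega>2) (G k) (G k)))"
      by (simp only: sum_distrib_left[symmetric] sum.distrib)
    also have "\<dots> \<le> B"
      unfolding B_def K_def G_def
      by (intro mult_left_mono add_mono Q.partial_Bessel[OF e finite_lessThan] pL(1) L2_fst_snd(1)[OF pL(2)] C(1))
    finally show ?thesis .
  qed
  then show ?thesis by blast
qed

text \<open>The expansion of \<open>h\<close> in the eigenfunctions of the second factor converges in \<open>L\<^sup>2\<close>, and so does
  that of its gradient in the first variable, whose coefficients are the gradients of those of \<open>h\<close>.
  The gradients in the second variable form a Cauchy sequence by the energy bound. Since weak gradients
  are closed, the limit of the gradients is the gradient of \<open>h\<close>.\<close>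

theorem tensor_series:
  assumes h: "h \<in> H1 (\<Omega>1 \<times> \<Omega>2)"
  shows "H1_tensor_series \<Omega>1 \<Omega>2 h"
proof -
  interpret Q: bounded_open_pair \<Omega>2 \<Omega>1 by (rule swap_regions)
  let ?V = "vol \<Omega>1 \<Otimes>\<^sub>M vol \<Omega>2"
  let ?e = R.eigenbasis
  let ?H = "wgrad (\<Omega>1 \<times> \<Omega>2) h"
  let ?c = "coeff h" and ?d = "\<lambda>j. partial_integral (vol \<Omega>2) (?e j) (\<lambda>z. fst (?H z))"
  note p = H1_pair_wgrad[OF h]
  note hL = H1_pair_D[OF p, unfolded vol_prod]
  note fL = L2_fst_snd(1)[OF hL(2)]
  note cL = H1_L2(1)[OF coeff_H1[OF h]]
  note wL = H1_L2(2)[OF R.basis_H1]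
  define F where "F = (\<lambda>n z. \<Sum>j<n. vtensor (?c j) (?e j) z)"
  define G1 where "G1 = (\<lambda>n z. \<Sum>j<n. vtensor (?d j) (?e j) z)"
  define G2 where "G2 = (\<lambda>n z. \<Sum>j<n. ?c j (fst z) *\<^sub>R wgrad \<Omega>2 (?e j) (snd z))"
  have dL: "?d j \<in> Lp (vol \<Omega>1) 2" for j by (rule partial_integral_L2(1)[OF fL R.basis_L2])
  have FL: "F n \<in> Lp ?V 2" for n unfolding F_def by (intro L2.sum_closed vtensor_L2 cL R.basis_L2)
  have G1L: "G1 n \<in> Lp ?V 2" for n unfolding G1_def by (intro L2.sum_closed vtensor_L2 dL R.basis_L2)
  have G2L: "G2 n \<in> Lp ?V 2" for n unfolding G2_def by (intro L2.sum_closed vtensor_swap_L2 cL wL)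
  have pair: "H1_pair (\<Omega>1 \<times> \<Omega>2) (F n) (\<lambda>z. (G1 n z, G2 n z))" for n
  proof -
    have "H1_pair \<Omega>1 (?c j) (?d j)" for j
      unfolding coeff_def by (rule H1_pair_partial_integral[OF p R.basis_L2])
    then have "H1_pair (\<Omega>1 \<times> \<Omega>2) (F n)
        (\<lambda>z. \<Sum>j<n. (vtensor (?d j) (?e j) z, ?c j (fst z) *\<^sub>R wgrad \<Omega>2 (?e j) (snd z)))"
      unfolding F_def by (intro P.H1_pair_sum H1_pair_tensor H1_pair_wgrad R.basis_H1)
    then show ?thesis by (simp add: G1_def G2_def sum_prod)
  qed
  have Flim: "L2_tendsto ?V F h"
    unfolding F_def coeff_def
    by (rule partial_expansion_tendsto[OF R.basis_orthonormal R.basis_complete hL(1)])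
  have G1lim: "L2_tendsto ?V G1 (\<lambda>z. fst (?H z))"
    unfolding G1_def
    by (rule partial_expansion_tendsto[OF R.basis_orthonormal R.basis_complete fL])
  define q where "q = (\<lambda>j. lam (Suc j) * L2_inner (vol \<Omega>1) (?c j) (?c j))"
  have q0: "q j \<ge> 0" for j
    unfolding q_def using R.eigen(2)[of j] L2.nonneg[OF cL] by (simp add: less_imp_le)
  obtain B where B: "\<forall>J. sum q {..<J} \<le> B"
    using coeff_energy_bounded[OF h] unfolding q_def by blast
  have q_summable: "summable q" by (rule summableI_nonneg_bounded[OF q0]) (use B in blast)
  have cauchy: "\<exists>K. \<forall>m\<ge>K. \<forall>n\<ge>K. L2_norm ?V (\<lambda>z. G2 m z - G2 n z) < \<epsilon>" if pos: "\<epsilon> > 0" for \<epsilon>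
  proof (rule Cauchy_if_summable_bound[OF q_summable _ q0 _ _ pos])
    show "(0::real) \<le> 1" by simp
    show "L2_norm ?V (\<lambda>z. G2 m z - G2 n z) = L2_norm ?V (\<lambda>z. G2 n z - G2 m z)" for m n
      by (rule L2.nrm_minus_commute[OF G2L G2L])
    show "(L2_norm ?V (\<lambda>z. G2 m z - G2 n z))\<^sup>2 \<le> 1 * sum q {n..<m}" if "n \<le> m" for m n
    proof -
      let ?A = "{n..<m}"
      let ?W = "vol \<Omega>2 \<Otimes>\<^sub>M vol \<Omega>1"
      let ?k = "\<lambda>z. \<Sum>j\<in>?A. vtensor (wgrad \<Omega>2 (?e j)) (?c j) z"
      let ?s = "\<lambda>x. L2_inner (vol \<Omega>2) (\<lambda>y. \<Sum>j\<in>?A. ?c j x *\<^sub>R wgrad \<Omega>2 (?e j) y)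
        (\<lambda>y. \<Sum>j\<in>?A. ?c j x *\<^sub>R wgrad \<Omega>2 (?e j) y)"
      have kL: "?k \<in> Lp ?W 2" by (intro L2.sum_closed Q.vtensor_L2 cL wL)
      \<comment> \<open>the variables are exchanged so that the gradients of the eigenfunctions are the vector-valued factors\<close>
      have "(\<lambda>z. G2 m z - G2 n z) = (\<lambda>z. ?k (prod.swap z))"
        using sum_diff_nat_ivl[of 0 n m] that by (auto simp: G2_def vtensor_def atLeast0LessThan)
      then have "(L2_norm ?V (\<lambda>z. G2 m z - G2 n z))\<^sup>2 = L2_inner ?W ?k ?k"
        using Q.L2_norm_swap[OF kL] L2.nrm_sq[OF kL] by simp
      also have "\<dots> = (LINT x|vol \<Omega>1. ?s x)"
        by (rule Q.inner_sum_vtensor(2)[OF wL cL])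
      also have "\<dots> \<le> (LINT x|vol \<Omega>1. (\<Sum>j\<in>?A. lam (Suc j) * (?c j x \<bullet> ?c j x)))"
      proof (rule integral_mono)
        show "integrable (vol \<Omega>1) ?s" by (rule Q.inner_sum_vtensor(1)[OF wL cL])
        show "integrable (vol \<Omega>1) (\<lambda>x. \<Sum>j\<in>?A. lam (Suc j) * (?c j x \<bullet> ?c j x))"
          by (intro Bochner_Integration.integrable_sum integrable_mult_right L2_integrable_inner cL)
        show "?s x \<le> (\<Sum>j\<in>?A. lam (Suc j) * (?c j x \<bullet> ?c j x))" for x
          using R.basis_gradient_le[of ?A "\<lambda>j. ?c j x"] by (simp add: power2_eq_square)
      qed
      also have "\<dots> = (\<Sum>j\<in>?A. LINT x|vol \<Omega>1. lam (Suc j) * (?c j x \<bullet> ?c j x))"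
        by (intro Bochner_Integration.integral_sum integrable_mult_right L2_integrable_inner cL)
      also have "\<dots> = sum q ?A" by (simp add: q_def L2_inner_def)
      finally show ?thesis by simp
    qed
  qed
  obtain K where K: "K \<in> Lp ?V 2" "L2_tendsto ?V G2 K"
    by (rule L2_complete[OF finite_MN G2L cauchy]) (assumption | rule that)+
  have Glim: "L2_tendsto ?V (\<lambda>n z. (G1 n z, G2 n z)) (\<lambda>z. (fst (?H z), K z))"
  proof -
    have "(\<lambda>n. L2_norm ?V (\<lambda>z. (G1 n z - fst (?H z), G2 n z - K z))) \<longlonglongrightarrow> 0"
      by (subst L2_norm_Pair_tendsto) (intro L2.diff_closed G1L G2L fL K(1) conjI G1lim K(2))+
    then show ?thesis by simp
  qed
  have hK: "H1_pair (\<Omega>1 \<times> \<Omega>2) h (\<lambda>z. (fst (?H z), K z))"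
    by (rule P.H1_pair_limit[OF pair, unfolded vol_prod, OF hL(1) L2_Pair[OF fL K(1)] Flim Glim])
  have "H1_tendsto (\<Omega>1 \<times> \<Omega>2) F h"
    using P.H1_tendsto_iff[of F "\<lambda>n z. (G1 n z, G2 n z)", OF pair hK] Flim Glim by (simp add: vol_prod)
  then show ?thesis
    unfolding H1_tensor_series_def F_def
    by (intro exI[of _ ?c] exI[of _ ?e] conjI allI coeff_H1[OF h] R.basis_H1)
qed

end

section \<open>The Robin--Steklov eigenfunctions\<close>

theorem theorem10p4:
  fixes \<Omega>1 :: "(real ^ 'n::finite) set" and \<Omega>2 :: "(real ^ 'm::finite) set"
    and b :: "(real ^ 'n) \<times> (real ^ 'm) \<Rightarrow> ennreal"
    and b1 :: "real ^ 'n \<Rightarrow> real" and b2 :: "real ^ 'm \<Rightarrow> real"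
    and lam1 :: "nat \<Rightarrow> real" and g1 :: "nat \<Rightarrow> real ^ 'n \<Rightarrow> real"
    and del2 :: "nat \<Rightarrow> real" and s2 :: "nat \<Rightarrow> real ^ 'm \<Rightarrow> real"
    and u :: "nat \<Rightarrow> nat \<Rightarrow> (real ^ 'n) \<times> (real ^ 'm) \<Rightarrow> real"
  assumes "region \<Omega>1" "cond_B1 \<Omega>1" "cond_B2 \<Omega>1"
    and "region \<Omega>2" "cond_B1 \<Omega>2" "cond_B2 \<Omega>2"
    and "cond_B4 \<Omega>1 \<Omega>2 b b1 b2"
    and "robin_eigendata \<Omega>1 b1 lam1 g1"
    and "steklov_eigendata \<Omega>2 b2 del2 s2"
    and "\<And>j k. u j k = tensor (g1 j) (s2 k)"
  shows "\<forall>j\<ge>1. \<forall>k. RSL_eigenfunction \<Omega>1 \<Omega>2 b1 b2 (lam1 j) (del2 k) (u j k)"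
proof (intro allI impI)
  fix j k :: nat assume j: "j \<ge> 1"
  interpret X: bounded_open \<Omega>1
    using assms(1,2) by unfold_locales (simp_all add: region_def cond_B1_def)
  interpret Y: bounded_open \<Omega>2
    using assms(4,5) by unfold_locales (simp_all add: region_def cond_B1_def)
  have B3: "cond_B3 \<Omega>1 b1" "cond_B3 \<Omega>2 b2" using assms(7) by (simp_all add: cond_B4_def)
  interpret R: robin_region \<Omega>1 b1 lam1 g1 by unfold_locales (fact assms B3)+
  interpret W: weighted_region \<Omega>2 b2 by unfold_locales (fact assms B3)+
  interpret TP: trace_pair \<Omega>1 \<Omega>2 by unfold_locales
  interpret TQ: trace_pair \<Omega>2 \<Omega>1 by unfold_locales
  \<comment> \<open>the expansion takes place in the second factor, hence the exchanged order\<close>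
  interpret RP: robin_product \<Omega>2 \<Omega>1 b1 lam1 g1 by unfold_locales
  let ?O = "\<Omega>1 \<times> \<Omega>2" and ?g = "g1 j" and ?s = "s2 k"
  let ?M1 = "surf \<Omega>1 \<Otimes>\<^sub>M vol \<Omega>2" and ?M2 = "vol \<Omega>1 \<Otimes>\<^sub>M surf \<Omega>2"
  have g: "robin_eigenfunction \<Omega>1 b1 (lam1 j) ?g"
    using assms(8) j unfolding robin_eigendata_def by simp
  have s: "steklov_eigenfunction \<Omega>2 b2 (del2 k) ?s"
    using assms(9) unfolding steklov_eigendata_def by simp
  have gH: "?g \<in> H1 \<Omega>1" and gnz: "nonzero_on \<Omega>1 ?g"
    and g_eq: "\<And>h. h \<in> H1 \<Omega>1 \<Longrightarrow> b_inner \<Omega>1 b1 ?g h = lam1 j * (LINT x|vol \<Omega>1. ?g x * h x)"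
    using g unfolding robin_eigenfunction_def by simp_all
  have sH: "?s \<in> H1 \<Omega>2" and snz: "nonzero_on \<Omega>2 ?s"
    and s_eq: "\<And>h. h \<in> H1 \<Omega>2 \<Longrightarrow> grad_form \<Omega>2 ?s h = del2 k * bdry_form \<Omega>2 b2 ?s h"
    using s unfolding steklov_eigenfunction_def by simp_all
  have u: "u j k = vtensor ?g ?s" by (simp add: assms(10) tensor_eq_vtensor)
  have uH: "vtensor ?g ?s \<in> H1 ?O" by (rule TP.H1_tensor[OF gH sH])
  note swapH = TP.H1_swap
  have trace1: "has_trace ?O ?M1 h (trace_face1 \<Omega>1 \<Omega>2 h)" if h: "h \<in> H1 ?O" for h
  proof -
    \<comment> \<open>the Robin eigenfunctions belong to the first factor, so \<open>h\<close> is expanded after a swap\<close>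
    have "H1_tensor_series \<Omega>1 \<Omega>2 (\<lambda>z. h (prod.swap (prod.swap z)))"
      by (rule TQ.H1_tensor_series_swap[OF swapH[OF h] RP.tensor_series[OF swapH[OF h]]])
    then have "H1_tensor_series \<Omega>1 \<Omega>2 h" by simp
    then obtain t where "has_trace ?O ?M1 h t" by (rule TP.face_trace_exists[OF h])
    then show ?thesis
      unfolding trace_face1_def bdry_trace_def by (rule someI[of "has_trace ?O ?M1 h"])
  qed
  have trace2: "has_trace ?O ?M2 h (trace_face2 \<Omega>1 \<Omega>2 h)" if h: "h \<in> H1 ?O" for h
  proof -
    obtain t where t: "has_trace (\<Omega>2 \<times> \<Omega>1) (surf \<Omega>2 \<Otimes>\<^sub>M vol \<Omega>1) (\<lambda>z. h (prod.swap z)) t"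
      by (rule TQ.face_trace_exists[OF swapH[OF h] RP.tensor_series[OF swapH[OF h]]])
    have "has_trace ?O ?M2 (\<lambda>z. h (prod.swap (prod.swap z))) (\<lambda>z. t (prod.swap z))"
      by (rule has_trace_swap[OF W.S.trace_measure_axioms X.trace_measure_vol swapH[OF h] t])
    then have "has_trace ?O ?M2 h (\<lambda>z. t (prod.swap z))" by simp
    then show ?thesis
      unfolding trace_face2_def bdry_trace_def by (rule someI[of "has_trace ?O ?M2 h"])
  qed
  have weak: "grad_form ?O (vtensor ?g ?s) h +
      (LINT y|vol \<Omega>2. LINT x|surf \<Omega>1.
         b1 x * trace_face1 \<Omega>1 \<Omega>2 (vtensor ?g ?s) (x, y) * trace_face1 \<Omega>1 \<Omega>2 h (x, y)) =
      lam1 j * (LINT z|vol ?O. vtensor ?g ?s z * h z) +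
      del2 k * (LINT x|vol \<Omega>1. LINT y|surf \<Omega>2.
         b2 y * trace_face2 \<Omega>1 \<Omega>2 (vtensor ?g ?s) (x, y) * trace_face2 \<Omega>1 \<Omega>2 h (x, y))"
    if h: "h \<in> H1 ?O" for h
  proof -
    let ?h = "\<lambda>z. h (prod.swap z)"
    let ?H = "partial_integral (vol \<Omega>2) ?s h" and ?K = "partial_integral (vol \<Omega>1) ?g ?h"
    note gL = H1_L2(1)[OF gH] and sL = H1_L2(1)[OF sH]
    have HH: "?H \<in> H1 \<Omega>1" by (rule TP.H1_partial_integral[OF h sL])
    have KH: "?K \<in> H1 \<Omega>2" by (rule TQ.H1_partial_integral[OF swapH[OF h] gL])
    obtain K1 where K1: "AE x in surf \<Omega>1. \<bar>b1 x\<bar> \<le> K1" by (rule R.weight_bounded)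
    obtain K2 where K2: "AE x in surf \<Omega>2. \<bar>b2 x\<bar> \<le> K2" by (rule W.weight_bounded)
    have face1: "(LINT y|vol \<Omega>2. LINT x|surf \<Omega>1.
         b1 x * trace_face1 \<Omega>1 \<Omega>2 (vtensor ?g ?s) (x, y) * trace_face1 \<Omega>1 \<Omega>2 h (x, y))
      = bdry_form \<Omega>1 b1 ?g ?H"
      by (rule TP.face_integral_tensor[OF R.weight_measurable K1 gH sH h trace1[OF uH] trace1[OF h]])
    have face2: "(LINT x|vol \<Omega>1. LINT y|surf \<Omega>2.
         b2 y * trace_face2 \<Omega>1 \<Omega>2 (vtensor ?g ?s) (x, y) * trace_face2 \<Omega>1 \<Omega>2 h (x, y))
      = bdry_form \<Omega>2 b2 ?s ?K"
    proof -
      note sw = has_trace_swap[OF X.trace_measure_vol W.S.trace_measure_axioms]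
      have "(\<lambda>z. vtensor ?g ?s (prod.swap z)) = vtensor ?s ?g" by (simp add: vtensor_def mult.commute)
      then have tu: "has_trace (\<Omega>2 \<times> \<Omega>1) (surf \<Omega>2 \<Otimes>\<^sub>M vol \<Omega>1) (vtensor ?s ?g)
          (\<lambda>z. trace_face2 \<Omega>1 \<Omega>2 (vtensor ?g ?s) (prod.swap z))"
        using sw[OF uH trace2[OF uH]] by simp
      from TQ.face_integral_tensor[OF W.weight_measurable K2 sH gH swapH[OF h] tu sw[OF h trace2[OF h]]]
      show ?thesis by simp
    qed
    have "(LINT z|vol ?O. vtensor ?g ?s z * h z) = L2_inner (vol \<Omega>1) ?g ?H"
      using TP.inner_partial_integral[OF gL H1_L2(1)[OF h, unfolded TP.vol_prod] sL]
      by (simp add: L2_inner_def TP.vol_prod)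
    then have "lam1 j * (LINT z|vol ?O. vtensor ?g ?s z * h z) = b_inner \<Omega>1 b1 ?g ?H"
      using g_eq[OF HH] by (simp add: L2_inner_def)
    then show ?thesis
      unfolding face1 face2 TP.grad_form_tensor[OF gH sH h] s_eq[OF KH, symmetric]
      by (simp add: b_inner_def)
  qed
  show "RSL_eigenfunction \<Omega>1 \<Omega>2 b1 b2 (lam1 j) (del2 k) (u j k)"
    unfolding RSL_eigenfunction_def u
    by (intro conjI ballI uH weak TP.nonzero_on_tensor[OF H1_L2(1)[OF gH] gnz snz])
qed

end
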